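(* Let $q\in(0,1)$ and let $\varphi:\Gamma^q\to\mathbb{R}$ be an $\mathbb{F}$-positive specialization such that $\varphi_1<1$ and $\sum_n\varphi_n<\infty$. Then there is a constant $Z_\varphi\in(0,\infty)$ depending only on $\varphi$ such that for every fixed partition $\mu$, $\mathbb{P}_{\varphi,\mu}(\lambda):=\frac{c_{\lambda,\mu}\,\varphi(\mathbb{F}_{\lambda/\mu})}{Z_\varphi}$, with $c_{\lambda,\mu}:=\frac{\prod_{i\ge1}(q;q)_{m_i(\mu')}}{\prod_{i\ge1}(q;q)_{m_i(\lambda')}}$, defines a probability distribution on the set of partitions $\lambda\supseteq\mu$.
   Context: Partitions have finitely many nonzero parts; $m_i(\lambda)$ is the number of parts of $\lambda$ equal to $i$; $\lambda'$ is the conjugate partition; $\lambda\supseteq\mu$ means $\lambda_i\ge\mu_i$ for all $i$; $\mu\prec\lambda$ means $\lambda_{i+1}\le\mu_i\le\lambda_i$ for all $i$; $(x;q)_k=\prod_{i=0}^{k-1}(1-xq^i)$; $1^n$ is the partition with $n$ parts equal to $1$. Inhomogeneous $q$-Whittaker functions: $\mathbb{F}_{\lambda/\mu}(x)=\mathbf{1}_{\mu\prec\lambda}\,x^{|\lambda|-|\mu|}\prod_{r=1}^{\ell(\lambda)}(x;q)_{\mu_r-\lambda_{r+1}}\frac{(q;q)_{\lambda_r-\lambda_{r+1}}}{(q;q)_{\lambda_r-\mu_r}(q;q)_{\mu_r-\lambda_{r+1}}}$, $\mathbb{F}_{\lambda/\mu}(x_1,\dots,x_n)=\sum_\nu\mathbb{F}_{\nu/\mu}(x_1,\dots,x_{n-1})\mathbb{F}_{\lambda/\nu}(x_n)$,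 extended to countably many variables by stability; $\mathbb{F}_\lambda=\mathbb{F}_{\lambda/\varnothing}$. Standing facts: the real span $\Gamma^q$ of $\{\mathbb{F}_\lambda\}$ inside the degree completion of the ring of symmetric functions is a ring with basis $\{\mathbb{F}_\lambda\}$ containing every $\mathbb{F}_{\lambda/\mu}$. A specialization is a unital ring homomorphism $\varphi:\Gamma^q\to\mathbb{R}$; it is $\mathbb{F}$-positive if $\varphi(\mathbb{F}_{\lambda/\mu})\ge0$ for all $\lambda,\mu$; $\varphi_n:=\varphi(\mathbb{F}_{1^n})$. *)

theory Defs
  imports "HOL-Analysis.Analysis" "HOL-Library.Poly_Mapping"
begin

section \<open>Real power series in countably many variables\<close>

text \<open>
  The degree completion of the ring of real symmetric functions consists of the symmetric elements
  of the ring of all formal power series \<open>\<real>[[x\<^sub>0, x\<^sub>1, x\<^sub>2, \<dots>]]\<close>, of arbitrary (possibly unbounded)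
  degree. A series is given by its coefficients, and a monomial by its exponent vector of type
  \<open>nat \<Rightarrow>\<^sub>0 nat\<close>.
\<close>

typedef pseries = "UNIV :: ((nat \<Rightarrow>\<^sub>0 nat) \<Rightarrow> real) set"
  morphisms coeff_ps Abs_pseries ..

setup_lifting type_definition_pseries

lemma pseries_eqI: "(\<And>m. coeff_ps f m = coeff_ps g m) \<Longrightarrow> f = g"
  by (simp add: coeff_ps_inject[symmetric] fun_eq_iff)

definition splits :: "(nat \<Rightarrow>\<^sub>0 nat) \<Rightarrow> ((nat \<Rightarrow>\<^sub>0 nat) \<times> (nat \<Rightarrow>\<^sub>0 nat)) set" where
  "splits m = {(a, b). a + b = m}"

lemma finite_splits [simp]: "finite (splits m)"
proof -
  let ?L = "Poly_Mapping.lookup"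
  let ?K = "Poly_Mapping.keys m"
  let ?B = "{..(\<Sum>i\<in>?K. ?L m i)}"
  let ?S = "{f::nat \<Rightarrow> nat. \<forall>i. (i \<in> ?K \<longrightarrow> f i \<in> ?B) \<and> (i \<notin> ?K \<longrightarrow> f i = 0)}"
  have le: "?L m i \<le> (\<Sum>i\<in>?K. ?L m i)" if "i \<in> ?K" for i
    using that by (intro member_le_sum) auto
  have sub: "?L a \<in> ?S" if "a + b = m" for a b
  proof -
    have am: "?L a i \<le> ?L m i" for i
      using that by (auto simp: lookup_add)
    have "?L a i \<in> ?B" if "i \<in> ?K" for i
      using order_trans[OF am le[OF that]] by simp
    moreover have "?L a i = 0" if "i \<notin> ?K" for i
      using am[of i] that by (simp add: in_keys_iff)
    ultimately show ?thesis by blast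
  qed
  have fin: "finite ?S"
    by (rule finite_set_of_finite_funs) auto
  have "inj_on (\<lambda>(a, b). (?L a, ?L b)) (splits m)"
    by (auto simp: inj_on_def intro: poly_mapping_eqI)
  moreover have "(\<lambda>(a, b). (?L a, ?L b)) ` splits m \<subseteq> ?S \<times> ?S"
  proof
    fix p assume "p \<in> (\<lambda>(a, b). (?L a, ?L b)) ` splits m"
    then obtain a b where p: "p = (?L a, ?L b)" and ab: "a + b = m"
      by (auto simp: splits_def)
    from ab have "b + a = m" by (simp add: add.commute)
    from sub[OF ab] sub[OF this] show "p \<in> ?S \<times> ?S" unfolding p by (rule SigmaI)
  qed
  ultimately show ?thesis
    using fin by (meson finite_SigmaI finite_imageD finite_subset)
qed

instantiation pseries :: comm_ring_1
begin

lift_definition zero_pseries :: pseries is "\<lambda>_. 0" .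
lift_definition one_pseries :: pseries is "\<lambda>m. if m = 0 then 1 else 0" .
lift_definition plus_pseries :: "pseries \<Rightarrow> pseries \<Rightarrow> pseries" is "\<lambda>f g m. f m + g m" .
lift_definition minus_pseries :: "pseries \<Rightarrow> pseries \<Rightarrow> pseries" is "\<lambda>f g m. f m - g m" .
lift_definition uminus_pseries :: "pseries \<Rightarrow> pseries" is "\<lambda>f m. - f m" .
lift_definition times_pseries :: "pseries \<Rightarrow> pseries \<Rightarrow> pseries"
  is "\<lambda>f g m. \<Sum>(a, b)\<in>splits m. f a * g b" .

instance
proof
  fix f g h :: pseries
  show "f * g * h = f * (g * h)"
  proof transfer
    fix f g h :: "(nat \<Rightarrow>\<^sub>0 nat) \<Rightarrow> real"
    have "(\<Sum>(a, b)\<in>splits m. (\<Sum>(c, d)\<in>splits a. f c * g d) * h b) =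
          (\<Sum>(a, b)\<in>splits m. f a * (\<Sum>(c, d)\<in>splits b. g c * h d))" for m
    proof -
      have "(\<Sum>(a, b)\<in>splits m. (\<Sum>(c, d)\<in>splits a. f c * g d) * h b) =
            (\<Sum>p\<in>splits m. \<Sum>s\<in>splits (fst p). f (fst s) * g (snd s) * h (snd p))"
        by (simp add: case_prod_unfold sum_distrib_right)
      also have "\<dots> = (\<Sum>(p, s)\<in>Sigma (splits m) (\<lambda>p. splits (fst p)).
                          f (fst s) * g (snd s) * h (snd p))"
        by (simp add: sum.Sigma)
      also have "\<dots> = (\<Sum>(p, s)\<in>Sigma (splits m) (\<lambda>p. splits (snd p)).
                          f (fst p) * (g (fst s) * h (snd s)))"
        by (rule sum.reindex_bij_witness
              [where i = "\<lambda>((a, b), (c, d)). ((a + c, d), (a, c))"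
                 and j = "\<lambda>((a, b), (c, d)). ((c, d + b), (d, b))"])
           (auto simp: splits_def add.assoc mult.assoc)
      also have "\<dots> = (\<Sum>p\<in>splits m. \<Sum>s\<in>splits (snd p). f (fst p) * (g (fst s) * h (snd s)))"
        by (simp add: sum.Sigma)
      also have "\<dots> = (\<Sum>(a, b)\<in>splits m. f a * (\<Sum>(c, d)\<in>splits b. g c * h d))"
        by (simp add: case_prod_unfold sum_distrib_left)
      finally show ?thesis .
    qed
    then show "(\<lambda>m. \<Sum>(a, b)\<in>splits m. (\<Sum>(c, d)\<in>splits a. f c * g d) * h b) =
          (\<lambda>m. \<Sum>(a, b)\<in>splits m. f a * (\<Sum>(c, d)\<in>splits b. g c * h d))"
      by blast
  qed
  show "f * g = g * f"
  proof transfer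
    fix f g :: "(nat \<Rightarrow>\<^sub>0 nat) \<Rightarrow> real"
    have "(\<Sum>(a, b)\<in>splits m. f a * g b) = (\<Sum>(a, b)\<in>splits m. g a * f b)" for m
      by (rule sum.reindex_bij_witness[where i = prod.swap and j = prod.swap])
         (auto simp: splits_def add.commute mult.commute)
    then show "(\<lambda>m. \<Sum>(a, b)\<in>splits m. f a * g b) = (\<lambda>m. \<Sum>(a, b)\<in>splits m. g a * f b)"
      by blast
  qed
  show "1 * f = f"
  proof transfer
    fix f :: "(nat \<Rightarrow>\<^sub>0 nat) \<Rightarrow> real"
    have "(\<Sum>(a, b)\<in>splits m. (if a = 0 then 1 else 0) * f b) = f m" for m
    proof -
      have "(\<Sum>(a, b)\<in>splits m. (if a = 0 then 1 else 0) * f b) =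
            (\<Sum>(a, b)\<in>{(0 :: nat \<Rightarrow>\<^sub>0 nat, m)}. (if a = 0 then 1 else 0) * f b)"
        by (rule sum.mono_neutral_right) (simp, auto simp: splits_def split: if_splits)
      then show ?thesis by simp
    qed
    then show "(\<lambda>m. \<Sum>(a, b)\<in>splits m. (if a = 0 then 1 else 0) * f b) = f"
      by blast
  qed
  show "(f + g) * h = f * h + g * h"
    by transfer (simp add: case_prod_unfold sum.distrib distrib_right)
  show "(0::pseries) \<noteq> 1"
    by transfer (auto simp: fun_eq_iff)
  show "f + g + h = f + (g + h)" "f + g = g + f" "0 + f = f" "- f + f = 0" "f - g = f + - g"
    by (transfer, simp add: fun_eq_iff)+
qed

end

instantiation pseries :: real_algebra_1
begin

lift_definition scaleR_pseries :: "real \<Rightarrow> pseries \<Rightarrow> pseries" is "\<lambda>c f m. c * f m" .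

instance
proof
  fix c :: real and f g :: pseries
  show "c *\<^sub>R f * g = c *\<^sub>R (f * g)" "f * c *\<^sub>R g = c *\<^sub>R (f * g)"
    by (transfer, simp add: case_prod_unfold sum_distrib_left algebra_simps)+
  fix d :: real
  show "c *\<^sub>R (f + g) = c *\<^sub>R f + c *\<^sub>R g" "(c + d) *\<^sub>R f = c *\<^sub>R f + d *\<^sub>R f"
    "c *\<^sub>R d *\<^sub>R f = (c * d) *\<^sub>R f" "1 *\<^sub>R f = f"
    by (transfer, simp add: fun_eq_iff algebra_simps)+
qed

end

lift_definition Var :: "nat \<Rightarrow> pseries"
  is "\<lambda>i m. if m = Poly_Mapping.single i 1 then 1 else 0" .


section \<open>Partitions\<close>

text \<open>
  A partition is its sequence of parts, padded by zeros and indexed from 0, so that \<open>l i\<close> is the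
  part usually written \<open>\<lambda>\<close> with index \<open>i + 1\<close>.
\<close>

definition is_partition :: "(nat \<Rightarrow> nat) \<Rightarrow> bool" where
  "is_partition l \<longleftrightarrow> antimono l \<and> finite {i. l i \<noteq> 0}"

definition psize :: "(nat \<Rightarrow> nat) \<Rightarrow> nat" where
  "psize l = (\<Sum>i | l i \<noteq> 0. l i)"

definition plength :: "(nat \<Rightarrow> nat) \<Rightarrow> nat" where
  "plength l = card {i. l i \<noteq> 0}"

definition conj_partition :: "(nat \<Rightarrow> nat) \<Rightarrow> nat \<Rightarrow> nat" where
  "conj_partition l j = card {i. j < l i}"

text \<open>Only meaningful for \<open>i \<ge> 1\<close>: there are infinitely many zero parts.\<close>

definition part_mult :: "nat \<Rightarrow> (nat \<Rightarrow> nat) \<Rightarrow> nat" where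
  "part_mult i l = card {r. l r = i}"

definition partition_le :: "(nat \<Rightarrow> nat) \<Rightarrow> (nat \<Rightarrow> nat) \<Rightarrow> bool" where
  "partition_le mu l \<longleftrightarrow> (\<forall>i. mu i \<le> l i)"

definition interlaces :: "(nat \<Rightarrow> nat) \<Rightarrow> (nat \<Rightarrow> nat) \<Rightarrow> bool" where
  "interlaces mu l \<longleftrightarrow> (\<forall>i. l (Suc i) \<le> mu i \<and> mu i \<le> l i)"

definition empty_partition :: "nat \<Rightarrow> nat" where
  "empty_partition = (\<lambda>_. 0)"

definition column_partition :: "nat \<Rightarrow> nat \<Rightarrow> nat" where
  "column_partition n = (\<lambda>i. if i < n then 1 else 0)"

lemma finite_interlaces:
  assumes "is_partition l"
  shows "finite {nu. is_partition nu \<and> interlaces nu l}"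
proof (rule finite_subset)
  let ?A = "{i. l i \<noteq> 0}"
  show "finite {f. \<forall>i. (i \<in> ?A \<longrightarrow> f i \<in> {..l 0}) \<and> (i \<notin> ?A \<longrightarrow> f i = 0)}"
    using assms by (intro finite_set_of_finite_funs) (auto simp: is_partition_def)
  show "{nu. is_partition nu \<and> interlaces nu l} \<subseteq>
        {f. \<forall>i. (i \<in> ?A \<longrightarrow> f i \<in> {..l 0}) \<and> (i \<notin> ?A \<longrightarrow> f i = 0)}"
  proof
    fix nu assume "nu \<in> {nu. is_partition nu \<and> interlaces nu l}"
    then have le: "nu i \<le> l i" for i by (simp add: interlaces_def)
    have "l i \<le> l 0" for i
      using assms by (auto simp: is_partition_def intro: antimonoD)
    then have "nu i \<le> l 0" for i using le order_trans by blast
    moreover have "nu i = 0" if "l i = 0" for i using le[of i] that by simp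
    ultimately show "nu \<in> {f. \<forall>i. (i \<in> ?A \<longrightarrow> f i \<in> {..l 0}) \<and> (i \<notin> ?A \<longrightarrow> f i = 0)}"
      by simp
  qed
qed


section \<open>Inhomogeneous q-Whittaker functions\<close>

definition qpoch :: "'a::comm_ring_1 \<Rightarrow> 'a \<Rightarrow> nat \<Rightarrow> 'a" where
  "qpoch x q k = (\<Prod>i<k. 1 - x * q ^ i)"

definition F_one ::
  "real \<Rightarrow> (nat \<Rightarrow> nat) \<Rightarrow> (nat \<Rightarrow> nat) \<Rightarrow> 'a \<Rightarrow> 'a::{comm_ring_1, real_algebra_1}" where
  "F_one q l mu x =
    (if interlaces mu l
     then x ^ (psize l - psize mu) *
       (\<Prod>r<plength l. qpoch x (of_real q) (mu r - l (Suc r)) *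
          of_real (qpoch q q (l r - l (Suc r)) /
                   (qpoch q q (l r - mu r) * qpoch q q (mu r - l (Suc r)))))
     else 0)"

text \<open>
  \<open>F_fin q x n l mu\<close> is the skew function in the \<open>n\<close> variables \<open>x 0, \<dots>, x (n - 1)\<close>. The
  branching sum is restricted to those \<open>nu\<close> for which \<open>F_one q l nu\<close> does not vanish by definition.
\<close>

primrec F_fin ::
  "real \<Rightarrow> (nat \<Rightarrow> 'a) \<Rightarrow> nat \<Rightarrow> (nat \<Rightarrow> nat) \<Rightarrow> (nat \<Rightarrow> nat) \<Rightarrow> 'a::{comm_ring_1, real_algebra_1}"
where
  "F_fin q x 0 l mu = (if l = mu then 1 else 0)"
| "F_fin q x (Suc n) l mu =
    (\<Sum>nu | is_partition nu \<and> interlaces nu l. F_fin q x n nu mu * F_one q l nu (x n))"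

text \<open>
  In countably many variables, the coefficient of a monomial is read off from finitely many
  variables, enough to contain those of the monomial; lemma \<open>coeff_F_skew\<close> (stability) says that
  any such number of variables gives the same coefficient.
\<close>

definition F_skew :: "real \<Rightarrow> (nat \<Rightarrow> nat) \<Rightarrow> (nat \<Rightarrow> nat) \<Rightarrow> pseries" where
  "F_skew q l mu = Abs_pseries
    (\<lambda>m. coeff_ps (F_fin q Var (LEAST n. Poly_Mapping.keys m \<subseteq> {..<n}) l mu) m)"

lemma F_one_mod_variable:
  fixes x :: "'a::{comm_ring_1, real_algebra_1}"
  assumes q: "0 < q" "q < 1" and l: "is_partition l" and mu: "is_partition mu"
  shows "x dvd F_one q l mu x - (if l = mu then 1 else 0)"
proof (cases "interlaces mu l")
  case False
  then have "l \<noteq> mu"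
    using l by (auto simp: interlaces_def is_partition_def antimono_iff_le_Suc)
  with False show ?thesis by (simp add: F_one_def)
next
  case True
  have finl: "finite {i. l i \<noteq> 0}" and finm: "finite {i. mu i \<noteq> 0}"
    using l mu by (auto simp: is_partition_def)
  have le: "mu i \<le> l i" for i using True by (auto simp: interlaces_def)
  have smu: "psize mu = (\<Sum>i | l i \<noteq> 0. mu i)"
    unfolding psize_def
    by (rule sum.mono_neutral_left) (use finl le in \<open>auto simp: neq0_conv intro: less_le_trans\<close>)
  show ?thesis
  proof (cases "l = mu")
    case False
    then obtain j where "mu j < l j" using le by (metis ext order_less_le)
    then have "psize mu < psize l"
      unfolding smu unfolding psize_def using finl le
      by (intro sum_strict_mono_ex1) (auto intro!: exI[of _ j])
    then have "x dvd x ^ (psize l - psize mu)" by (simp add: dvd_power)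
    then show ?thesis using True False by (simp add: F_one_def dvd_mult2)
  next
    case eq: True
    have pos: "qpoch q q k \<noteq> 0" for k
    proof -
      have "q * q ^ i < 1" for i
        using q by (metis power_Suc power_Suc_less_one)
      then show ?thesis unfolding qpoch_def by (simp add: less_imp_neq[symmetric])
    qed
    have prod_mod: "x dvd (\<Prod>i<k. g i) - 1" if "\<And>i. x dvd g i - 1" for g :: "nat \<Rightarrow> 'a" and k
    proof (induction k)
      case (Suc k)
      have "(\<Prod>i<Suc k. g i) - 1 = ((\<Prod>i<k. g i) - 1) * g k + (g k - 1)"
        by (simp add: algebra_simps)
      then show ?case using Suc that by (metis dvd_add dvd_mult2)
    qed simp
    have "x dvd qpoch x (of_real q) k - 1" for k
      unfolding qpoch_def by (rule prod_mod) (simp add: dvd_minus_iff)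
    then have "x dvd (\<Prod>r<plength l. qpoch x (of_real q) (mu r - l (Suc r))) - 1"
      by (intro prod_mod)
    moreover have "qpoch q q 0 = 1" by (simp add: qpoch_def)
    ultimately show ?thesis using True eq pos by (simp add: F_one_def)
  qed
qed

lemma coeff_Var_mult:
  assumes "n \<notin> Poly_Mapping.keys m"
  shows "coeff_ps (Var n * g) m = 0"
proof -
  have "a \<noteq> Poly_Mapping.single n 1" if "(a, b) \<in> splits m" for a b
    using that assms by (auto simp: splits_def lookup_add in_keys_iff)
  then show ?thesis
    unfolding times_pseries.rep_eq Var.rep_eq by (intro sum.neutral) auto
qed

lemma F_fin_stable:
  assumes q: "0 < q" "q < 1" and l: "is_partition l"
    and n: "n \<notin> Poly_Mapping.keys m"
  shows "coeff_ps (F_fin q Var (Suc n) l mu) m = coeff_ps (F_fin q Var n l mu) m"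
proof -
  let ?N = "{nu. is_partition nu \<and> interlaces nu l}"
  let ?d = "\<lambda>nu. if l = nu then 1 else (0::pseries)"
  have "Var n dvd F_fin q Var n nu mu * (F_one q l nu (Var n) - ?d nu)" if "nu \<in> ?N" for nu
    using F_one_mod_variable[OF q l, of nu "Var n"] that by (intro dvd_mult) simp
  then have "Var n dvd (\<Sum>nu\<in>?N. F_fin q Var n nu mu * (F_one q l nu (Var n) - ?d nu))"
    by (rule dvd_sum)
  then obtain g where
    "(\<Sum>nu\<in>?N. F_fin q Var n nu mu * (F_one q l nu (Var n) - ?d nu)) = Var n * g"
    by (elim dvdE)
  moreover have "l \<in> ?N"
    using l by (auto simp: interlaces_def is_partition_def antimono_iff_le_Suc)
  then have "(\<Sum>nu\<in>?N. F_fin q Var n nu mu * ?d nu) = F_fin q Var n l mu"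
    using finite_interlaces[OF l] by (simp add: if_distrib sum.delta cong: if_cong)
  ultimately have "F_fin q Var (Suc n) l mu = F_fin q Var n l mu + Var n * g"
    by (simp add: right_diff_distrib sum_subtractf algebra_simps)
  then show ?thesis
    using coeff_Var_mult[OF n] by (simp add: plus_pseries.rep_eq)
qed

lemma coeff_F_skew:
  assumes "0 < q" "q < 1" "is_partition l" and N: "Poly_Mapping.keys m \<subseteq> {..<N}"
  shows "coeff_ps (F_skew q l mu) m = coeff_ps (F_fin q Var N l mu) m"
proof -
  define n where "n = (LEAST n. Poly_Mapping.keys m \<subseteq> {..<n})"
  have n: "Poly_Mapping.keys m \<subseteq> {..<n}" unfolding n_def by (rule LeastI) (rule N)
  have "n \<le> N" unfolding n_def by (rule Least_le) (rule N)
  then have "coeff_ps (F_fin q Var N l mu) m = coeff_ps (F_fin q Var n l mu) m"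
  proof (induction N rule: dec_induct)
    case (step k)
    then have "k \<notin> Poly_Mapping.keys m" using n by auto
    with F_fin_stable[OF assms(1-3)] step.IH show ?case by metis
  qed simp
  then show ?thesis by (simp add: F_skew_def Abs_pseries_inverse n_def)
qed

abbreviation FF :: "real \<Rightarrow> (nat \<Rightarrow> nat) \<Rightarrow> pseries" where
  "FF q l \<equiv> F_skew q l empty_partition"


section \<open>Specializations\<close>

definition Gamma :: "real \<Rightarrow> pseries set" where
  "Gamma q = span (FF q ` {l. is_partition l})"

text \<open>
  A unital ring homomorphism \<open>Gamma q \<rightarrow> \<real>\<close> is represented by a total function, of which only the
  values on \<open>Gamma q\<close> are constrained. Additivity and multiplicativity force real linearity on
  \<open>Gamma q\<close>, the only ring endomorphism of \<open>\<real>\<close> being the identity.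
\<close>

definition specialization :: "real \<Rightarrow> (pseries \<Rightarrow> real) \<Rightarrow> bool" where
  "specialization q \<phi> \<longleftrightarrow> \<phi> 1 = 1 \<and>
    (\<forall>f\<in>Gamma q. \<forall>g\<in>Gamma q. \<phi> (f + g) = \<phi> f + \<phi> g \<and> \<phi> (f * g) = \<phi> f * \<phi> g)"

definition F_positive :: "real \<Rightarrow> (pseries \<Rightarrow> real) \<Rightarrow> bool" where
  "F_positive q \<phi> \<longleftrightarrow>
    (\<forall>l mu. is_partition l \<longrightarrow> is_partition mu \<longrightarrow> 0 \<le> \<phi> (F_skew q l mu))"

text \<open>The factors with multiplicity 0, omitted from the product, are \<open>(q;q)\<^sub>0 = 1\<close>.\<close>

definition conj_mult_prod :: "real \<Rightarrow> (nat \<Rightarrow> nat) \<Rightarrow> real" where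
  "conj_mult_prod q l =
    (\<Prod>i | 1 \<le> i \<and> part_mult i (conj_partition l) \<noteq> 0. qpoch q q (part_mult i (conj_partition l)))"

definition c_coeff :: "real \<Rightarrow> (nat \<Rightarrow> nat) \<Rightarrow> (nat \<Rightarrow> nat) \<Rightarrow> real" where
  "c_coeff q l mu = conj_mult_prod q mu / conj_mult_prod q l"

definition prob_distribution_on :: "'a set \<Rightarrow> ('a \<Rightarrow> real) \<Rightarrow> bool" where
  "prob_distribution_on A p \<longleftrightarrow> (\<forall>x\<in>A. 0 \<le> p x) \<and> (p has_sum 1) A"

end

theory Submission
  imports Defs "HOL-Computational_Algebra.Polynomial"
begin

text \<open>
  In one variable, \<open>F\<^bsub>\<lambda>/\<nu>\<^esub>(x)\<close> is the weight of a step from \<open>\<lambda>\<close> to \<open>\<nu>\<close> in which a row with gap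
  \<open>n = \<lambda>\<^sub>r - \<lambda>\<^sub>r\<^sub>+\<^sub>1\<close> to the next one loses \<open>k \<le> n\<close> boxes, independently for all rows, with weight
  \<open>x\<^sup>k (x;q)\<^sub>n\<^sub>-\<^sub>k [n choose k]\<^sub>q\<close>. These weights sum to 1, so \<open>\<Sum>\<^sub>\<kappa> F\<^bsub>\<nu>/\<kappa>\<^esub> = 1\<close>, a finite identity.

  The steps for different variables commute. Hence every \<open>F\<^bsub>\<lambda>/\<mu>\<^esub>\<close> lies in the span \<open>\<Gamma>\<close> of the \<open>F\<^sub>\<lambda>\<close>, and
  passing to complements in a rectangle with rows of length \<open>K\<close>, which reverses the steps, turns
  \<open>F\<^bsub>(K,\<lambda>)/(K,\<mu>)\<^esub>\<close>, weighted by \<open>c\<close>, into \<open>F\<^bsub>\<mu>\<^sup>c/\<lambda>\<^sup>c\<^esub>\<close>. So for fixed \<open>\<mu>\<close> and \<open>j\<close> the sum of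
  \<open>c \<phi>(F\<^bsub>(K,\<lambda>)/(K,\<mu>)\<^esub>)\<close> over all \<open>\<lambda>\<close> with \<open>\<lambda>\<^sub>1 = \<mu>\<^sub>1 + j\<close> and a bounded number of rows is \<open>\<phi>(F\<^bsub>(n)/(n-j)\<^esub>)\<close> with
  \<open>n = K - \<mu>\<^sub>1\<close>, up to an error that the first moment of \<open>q\<^bsup>-\<kappa>\<^sub>1\<^esup>\<close> bounds by a tail of \<open>\<Sum>\<^sub>n \<phi>\<^sub>n\<close>.

  The moments of the first row are polynomials in \<open>q\<^bsup>-K\<^esup>\<close> whose leading coefficients are
  \<open>F\<^bsub>\<lambda>/\<mu>\<^esub> \<Prod>\<^sub>i (x\<^sub>i;q)\<^sub>d\<close>. By multiplicativity \<open>\<phi>(F\<^bsub>(K,\<lambda>)/(K,\<mu>)\<^esub>)\<close> tends to \<open>p \<phi>(F\<^bsub>\<lambda>/\<mu>\<^esub>)\<close> for \<open>K \<rightarrow> \<infinity>\<close>, where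
  \<open>p = lim\<^sub>d \<phi>(\<Prod>\<^sub>i (x\<^sub>i;q)\<^sub>d)\<close>. Therefore \<open>p \<Sum> c \<phi>(F\<^bsub>\<lambda>/\<mu>\<^esub>)\<close>, summed over \<open>\<lambda>\<^sub>1 = \<mu>\<^sub>1 + j\<close>, equals
  \<open>lim\<^sub>n \<phi>(F\<^bsub>(n)/(n-j)\<^esub>)\<close>, which does not depend on \<open>\<mu>\<close>, and these limits sum to at most 1. Finally \<open>p > 0\<close>:
  otherwise all these limits vanish, but \<open>\<Sum>\<^sub>j q\<^sup>j \<phi>(F\<^bsub>(n)/(n-j)\<^esub>)\<close> tends to \<open>1 - \<phi>\<^sub>1 > 0\<close>.
\<close>

section \<open>Weights of a single row\<close>

lemma qpoch_0 [simp]: "qpoch x y 0 = 1"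
  and qpoch_Suc: "qpoch x y (Suc k) = qpoch x y k * (1 - x * y ^ k)"
  by (simp_all add: qpoch_def)

text \<open>The factor of one row in \<open>F_one\<close>: of the \<open>n\<close> boxes by which
  the row exceeds the next one, \<open>i\<close> are kept. The type of \<open>x\<close> covers
  numbers as well as power series.\<close>

definition wt :: "real \<Rightarrow> 'a \<Rightarrow> nat \<Rightarrow> nat \<Rightarrow> 'a::{comm_ring_1, real_algebra_1}" where
  "wt q x n i = (if i \<le> n
     then x ^ (n - i) * qpoch x (of_real q) i *
       of_real (qpoch q q n / (qpoch q q (n - i) * qpoch q q i))
     else 0)"

lemma wt_eq_0: "n < i \<Longrightarrow> wt q x n i = 0"
  by (simp add: wt_def)

lemma qpoch_Suc_shift: "qpoch x y (Suc k) = (1 - x) * qpoch (x * y) y k"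
  unfolding qpoch_def by (subst prod.lessThan_Suc_shift) (simp add: mult.assoc)

context
  fixes q :: real
  assumes q0: "0 < q" and q1: "q < 1"
begin

lemma qpoch_q_pos: "0 < qpoch q q k"
  using q0 q1 unfolding qpoch_def
  by (intro prod_pos) (metis diff_gt_0_iff_gt power_Suc power_Suc_less_one)

lemma qpoch_q_nz [simp]: "qpoch q q k \<noteq> 0"
  using qpoch_q_pos[of k] by simp

lemma q_pow_neq_1 [simp]: "q * q ^ k \<noteq> 1"
  using qpoch_q_nz[of "Suc k"] unfolding qpoch_Suc by fastforce

lemma wt_0 [simp]: "wt q x 0 0 = 1" 
  by (simp add: wt_def)

lemma wt_self: "wt q x n n = qpoch x (of_real q) n" 
  by (simp add: wt_def)

text \<open>Ratio of neighbouring q-binomial coefficients, multiplied out because \<open>x\<close>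
  need not be invertible.\<close>

lemma wt_ratio:
  fixes x :: "'a::{comm_ring_1, real_algebra_1}"
  assumes "i \<le> n"
  shows "(1 - of_real q ^ Suc i) * x * wt q x n (Suc i) =
    (1 - of_real q ^ (n - i)) * (1 - x * of_real q ^ i) * wt q x n i"
proof (cases "i = n")
  case True
  then show ?thesis by (simp add: wt_def)
next
  case False
  then obtain k where n: "n = Suc (i + k)"
    using assms by (metis le_neq_implies_less less_iff_Suc_add)
  let ?A = "qpoch q q n / (qpoch q q k * qpoch q q (Suc i))"
  let ?B = "qpoch q q n / (qpoch q q (Suc k) * qpoch q q i)"
  have "(1 - q ^ Suc i) * ?A = (1 - q ^ Suc k) * ?B"
    by (simp add: qpoch_Suc divide_simps)
  then have "of_real (1 - q ^ Suc i) * of_real ?A = of_real (1 - q ^ Suc k) * (of_real ?B :: 'a)"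
    by (metis of_real_mult)
  then have AB: "(1 - of_real q ^ Suc i) * of_real ?A = (1 - of_real q ^ Suc k) * (of_real ?B :: 'a)"
    by (simp only: of_real_diff of_real_1 of_real_power)
  have "(1 - of_real q ^ Suc i) * x * wt q x n (Suc i) =
     x ^ Suc k * qpoch x (of_real q) (Suc i) * ((1 - of_real q ^ Suc i) * of_real ?A)"
    unfolding wt_def by (simp add: n ac_simps)
  also have "\<dots> = (1 - of_real q ^ Suc k) * (1 - x * of_real q ^ i) * (x ^ Suc k * qpoch x (of_real q) i * of_real ?B)"
    unfolding AB unfolding qpoch_Suc by (simp only: ac_simps)
  also have "x ^ Suc k * qpoch x (of_real q) i * of_real ?B = wt q x n i"
    unfolding wt_def by (simp add: n Suc_diff_le)
  finally show ?thesis by (simp add: n Suc_diff_le)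
qed

lemma wt_Suc_0: "wt q x (Suc n) 0 = x * wt q x n 0"
  by (simp add: wt_def)

text \<open>The q-Pascal rule \<open>[n+1, i+1] = q^(i+1) [n, i+1] + [n, i]\<close>.\<close>

lemma wt_Suc_Suc:
  fixes x :: "'a::{comm_ring_1, real_algebra_1}"
  shows "wt q x (Suc n) (Suc i) =
    x * of_real q ^ Suc i * wt q x n (Suc i) + (1 - x * of_real q ^ i) * wt q x n i"
proof -
  consider "i > n" | "i = n" | k where "n = Suc (i + k)"
    by (metis less_iff_Suc_add linorder_neqE_nat)
  then show ?thesis
  proof cases
    case 3
    let ?A = "qpoch q q n / (qpoch q q k * qpoch q q (Suc i))"
    let ?B = "qpoch q q n / (qpoch q q (Suc k) * qpoch q q i)"
    let ?C = "qpoch q q (Suc n) / (qpoch q q (Suc k) * qpoch q q (Suc i))"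
    have "q ^ Suc i * ?A + ?B = ?C"
      using q0 by (simp add: qpoch_Suc divide_simps 3 power_add) (simp add: algebra_simps)
    then have C: "of_real ?C = of_real q ^ Suc i * of_real ?A + (of_real ?B :: 'a)"
      by (metis of_real_add of_real_mult of_real_power)
    have w: "wt q x (Suc n) (Suc i) = x ^ Suc k * qpoch x (of_real q) (Suc i) * of_real ?C"
      "wt q x n (Suc i) = x ^ k * qpoch x (of_real q) (Suc i) * of_real ?A"
      "wt q x n i = x ^ Suc k * qpoch x (of_real q) i * of_real ?B"
      unfolding wt_def by (simp_all add: 3 Suc_diff_le)
    show ?thesis
      unfolding w C unfolding qpoch_Suc by (simp add: algebra_simps)
  qed (simp_all add: wt_def qpoch_Suc mult.commute)
qed

text \<open>The q-Pascal rule under the sum: when \<open>j\<close> of the first \<open>n\<close>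
  boxes are kept, one further box is kept with weight \<open>1 - x q^j\<close> and removed with
  weight \<open>x q^j\<close>.\<close>

lemma sum_wt_Suc:
  fixes x :: "'a::{comm_ring_1, real_algebra_1}"
  shows "(\<Sum>j\<le>Suc n. wt q x (Suc n) j * g j) =
    (\<Sum>j\<le>n. wt q x n j * ((1 - x * of_real q ^ j) * g (Suc j) + x * of_real q ^ j * g j))"
proof -
  have "(\<Sum>j\<le>Suc n. wt q x (Suc n) j * g j) =
    x * wt q x n 0 * g 0 + (\<Sum>j\<le>n. wt q x (Suc n) (Suc j) * g (Suc j))"
    by (subst sum.atMost_Suc_shift) (simp add: wt_Suc_0)
  also have "(\<Sum>j\<le>n. wt q x (Suc n) (Suc j) * g (Suc j)) =
    (\<Sum>j\<le>n. x * of_real q ^ Suc j * wt q x n (Suc j) * g (Suc j)) +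
    (\<Sum>j\<le>n. wt q x n j * ((1 - x * of_real q ^ j) * g (Suc j)))"
    by (simp add: wt_Suc_Suc sum.distrib[symmetric] algebra_simps)
  also have "x * wt q x n 0 * g 0 + ((\<Sum>j\<le>n. x * of_real q ^ Suc j * wt q x n (Suc j) * g (Suc j)) + 
      (\<Sum>j\<le>n. wt q x n j * ((1 - x * of_real q ^ j) * g (Suc j)))) = 
      (\<Sum>j\<le>Suc n. x * of_real q ^ j * wt q x n j * g j) +
      (\<Sum>j\<le>n. wt q x n j * ((1 - x * of_real q ^ j) * g (Suc j)))"
    by (subst sum.atMost_Suc_shift[of "\<lambda>j. x * of_real q ^ j * wt q x n j * g j"]) simp
  also have "(\<Sum>j\<le>Suc n. x * of_real q ^ j * wt q x n j * g j) = (\<Sum>j\<le>n. wt q x n j * (x * of_real q ^ j * g j))"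
    by (simp add: wt_eq_0 ac_simps)
  finally show ?thesis by (simp add: sum.distrib[symmetric] algebra_simps)
qed

lemma sum_wt: "(\<Sum>j\<le>n. wt q x n j) = (1 :: 'a::{comm_ring_1, real_algebra_1})"
proof (induction n)
  case (Suc n)
  then show ?case using sum_wt_Suc[of x n "\<lambda>_. 1"] by simp
qed simp

text \<open>An index shift by \<open>wt_ratio\<close>. No boundary terms arise: one end has the
  factor \<open>1 - q^0\<close>, the other the weight of \<open>Suc n\<close> out of
  \<open>n\<close>.\<close>

lemma sum_wt_shift:
  fixes x :: "'a::{comm_ring_1, real_algebra_1}"
  shows "(\<Sum>j\<le>n. wt q x n j * (x * (1 - of_real q ^ j) * e j)) =
    (\<Sum>j\<le>n. wt q x n j * ((1 - of_real q ^ (n - j)) * (1 - x * of_real q ^ j) * e (Suc j)))"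
proof -
  have "(\<Sum>j\<le>n. wt q x n j * (x * (1 - of_real q ^ j) * e j)) =
    (\<Sum>j\<le>Suc n. wt q x n j * (x * (1 - of_real q ^ j) * e j))"
    by (simp add: wt_eq_0)
  also have "\<dots> = (\<Sum>j\<le>n. ((1 - of_real q ^ Suc j) * x * wt q x n (Suc j)) * e (Suc j))"
    by (subst sum.atMost_Suc_shift) (simp add: ac_simps)
  also have "\<dots> = (\<Sum>j\<le>n. wt q x n j * ((1 - of_real q ^ (n - j)) * (1 - x * of_real q ^ j) * e (Suc j)))"
    by (intro sum.cong refl) (simp only: wt_ratio atMost_iff, simp only: ac_simps)
  finally show ?thesis .
qed

end


section \<open>Commutation of the branching steps\<close>

text \<open>
  Lists contain the rows of a partition from the bottom up, so that \<open>map Suc\<close> adds a column through all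
  rows. Read a partition as a monomial in its columns, a column of length \<open>n\<close> being a letter \<open>Z\<^sub>n\<close>, longest
  columns first, with \<open>(Z\<^sub>n\<^sub>-\<^sub>1 - Z\<^sub>n) Z\<^sub>n = q Z\<^sub>n (Z\<^sub>n\<^sub>-\<^sub>1 - Z\<^sub>n)\<close>. A branching step is then the algebra homomorphism
  \<open>Z\<^sub>n \<mapsto> Z\<^sub>n + x (Z\<^sub>n\<^sub>-\<^sub>1 - Z\<^sub>n)\<close>, and any two of these commute. The operators \<open>col_diff\<close> and \<open>col_diff2\<close> are dual to
  left multiplication by \<open>Z\<^sub>n\<^sub>-\<^sub>1 - Z\<^sub>n\<close> and \<open>Z\<^sub>n\<^sub>-\<^sub>2 - 2 Z\<^sub>n\<^sub>-\<^sub>1 + Z\<^sub>n\<close>, where \<open>n\<close> is the number of rows.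
\<close>

primrec list_branch :: "real \<Rightarrow> 'a \<Rightarrow> nat \<Rightarrow> nat list \<Rightarrow> (nat list \<Rightarrow> 'a) \<Rightarrow> 'a::{comm_ring_1, real_algebra_1}"
where
  "list_branch q x b [] f = f []"
| "list_branch q x b (a # l) f =
    (\<Sum>j\<in>{b..a}. wt q x (a - b) (j - b) * list_branch q x a l (\<lambda>l'. f (j # l')))"

primrec col_diff :: "real \<Rightarrow> (nat list \<Rightarrow> 'a) \<Rightarrow> nat list \<Rightarrow> 'a::{comm_ring_1, real_algebra_1}" where
  "col_diff q f [] = 0"
| "col_diff q f (a # l) = of_real q ^ a * (f (a # map Suc l) - f (map Suc (a # l)))"

primrec col_diff2 :: "real \<Rightarrow> (nat list \<Rightarrow> 'a) \<Rightarrow> nat list \<Rightarrow> 'a::{comm_ring_1, real_algebra_1}" where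
  "col_diff2 q f [] = 0"
| "col_diff2 q f (a # l) = col_diff q (\<lambda>l'. f (a # l')) l - col_diff q f (a # l)
    - (1 - of_real q ^ a) * (of_real q ^ (a - 1) * (f ((a - 1) # map Suc l) - f (a # map Suc l))
        - of_real q ^ a * (f (a # map Suc l) - f (Suc a # map Suc l)))"

lemma list_branch_add: "list_branch q x b l (\<lambda>l'. f l' + g l') = list_branch q x b l f + list_branch q x b l g"
  by (induction l arbitrary: b f g) (simp_all add: distrib_left sum.distrib)

lemma list_branch_mult: "list_branch q x b l (\<lambda>l'. c * f l') = c * list_branch q x b l f"
  by (induction l arbitrary: b f) (simp_all add: sum_distrib_left mult.left_commute)

lemma list_branch_diff: "list_branch q x b l (\<lambda>l'. f l' - g l') = list_branch q x b l f - list_branch q x b l g"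
  using list_branch_add[of q x b l f "\<lambda>l'. -1 * g l'"] list_branch_mult[of q x b l "-1" g] by simp

lemma list_branch_cong:
  "(\<And>l'. sorted (b # l') \<Longrightarrow> length l' = length l \<Longrightarrow> f l' = g l') \<Longrightarrow> list_branch q x b l f = list_branch q x b l g"
proof (induction l arbitrary: b f g)
  case (Cons a l)
  have "list_branch q x a l (\<lambda>l'. f (j # l')) = list_branch q x a l (\<lambda>l'. g (j # l'))" if "j \<in> {b..a}" for j
    using that by (intro Cons.IH Cons.prems) (auto intro: order_trans)
  then show ?case unfolding list_branch.simps by (intro sum.cong refl) simp
qed simp

lemma list_branch_map_Suc: "list_branch q x (Suc b) (map Suc l) f = list_branch q x b l (\<lambda>l'. f (map Suc l'))"
proof (induction l arbitrary: b f)
  case (Cons a l)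
  show ?case
    by (simp add: Cons.IH image_Suc_atLeastAtMost[symmetric] sum.reindex del: image_Suc_atLeastAtMost)
qed simp

lemma list_branch_snoc: "list_branch q x b (l @ [a]) f =
  list_branch q x b l (\<lambda>l'. \<Sum>m\<in>{last (b # l)..a}. wt q x (a - last (b # l)) (m - last (b # l)) * f (l' @ [m]))"
proof (induction l arbitrary: b f)
  case (Cons c l)
  have "last (b # c # l) = last (c # l)" by simp
  then show ?case by (simp only: append_Cons list_branch.simps Cons.IH)
qed simp

lemma sum_from_base: "b \<le> a \<Longrightarrow> (\<Sum>j\<in>{b..a}. g j) = (\<Sum>i\<le>a - b. g (b + i))" for a b :: nat
  by (rule sum.reindex_bij_witness[of _ "\<lambda>i. b + i" "\<lambda>j. j - b"]) auto

context
  fixes q :: real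
  assumes q0: "0 < q" and q1: "q < 1"
begin

text \<open>Dual form of the image \<open>Z_n + x (Z_(n-1) - Z_n)\<close> of the leading letter.
  Above a row of length \<open>b\<close> the relevant exponent is \<open>a - b\<close>, whereas
  \<open>col_diff\<close> contains \<open>q^a\<close>; the factor \<open>q^b\<close> makes up for
  this.\<close>

lemma list_branch_add_long_column:
  fixes x :: "'a::{comm_ring_1, real_algebra_1}"
  assumes "l = [] \<or> b \<le> hd l"
  shows "of_real q ^ b * list_branch q x b (map Suc l) f =
    list_branch q x b l (\<lambda>l'. of_real q ^ b * f (map Suc l') + x * col_diff q f l')"
proof (cases l)
  case (Cons a l1)
  then have ab: "b \<le> a" using assms by simp
  define n where "n = a - b"
  have a: "a = b + n" using ab by (simp add: n_def)
  define G where "G i = list_branch q x a l1 (\<lambda>l'. f ((b + i) # map Suc l'))" for i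
  have "list_branch q x b (map Suc l) f = (\<Sum>j\<le>Suc n. wt q x (Suc n) j * G j)"
    unfolding Cons list.map list_branch.simps list_branch_map_Suc
    by (subst sum_from_base) (simp_all add: a G_def Suc_diff_le)
  also have "\<dots> = (\<Sum>j\<le>n. wt q x n j * ((1 - x * of_real q ^ j) * G (Suc j) + x * of_real q ^ j * G j))"
    by (rule sum_wt_Suc[OF q0 q1])
  finally have L: "list_branch q x b (map Suc l) f = \<dots>" .
  have "list_branch q x b l (\<lambda>l'. of_real q ^ b * f (map Suc l') + x * col_diff q f l') =
    (\<Sum>j\<le>n. wt q x n j * (of_real q ^ b * G (Suc j) + x * (of_real q ^ (b + j) * (G j - G (Suc j)))))"
    unfolding Cons list_branch.simps sum_from_base[OF ab]
    by (simp add: a G_def list_branch_add list_branch_mult list_branch_diff)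
  also have "\<dots> = of_real q ^ b * list_branch q x b (map Suc l) f"
    unfolding L sum_distrib_left by (intro sum.cong refl) (simp add: algebra_simps power_add)
  finally show ?thesis by simp
qed simp

lemma list_branch_add_long_column0:
  fixes x :: "'a::{comm_ring_1, real_algebra_1}"
  shows "list_branch q x 0 (map Suc l) f = list_branch q x 0 l (\<lambda>l'. f (map Suc l') + x * col_diff q f l')"
  using list_branch_add_long_column[of l 0 x f] by simp

text \<open>Dual form of the step applied to \<open>Z_(n-1) - Z_n\<close>, whose image is
  \<open>(Z_(n-1) - Z_n) + x (Z_(n-2) - 2 Z_(n-1) + Z_n)\<close>.\<close>

lemma col_diff_list_branch:
  fixes x :: "'a::{comm_ring_1, real_algebra_1}"
  assumes "sorted l"
  shows "col_diff q (\<lambda>l'. list_branch q x 0 l' f) l = list_branch q x 0 l (\<lambda>l'. col_diff q f l' + x * col_diff2 q f l')"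
proof (cases l)
  case (Cons a l1)
  let ?Q = "of_real q :: 'a"
  have hd: "l1 = [] \<or> a \<le> hd l1"
    using assms unfolding Cons by (cases l1) auto
  define G where "G j = list_branch q x a l1 (\<lambda>l'. f (j # map Suc l'))" for j
  define V where "V j = list_branch q x a l1 (col_diff q (\<lambda>l'. f (j # l')))" for j
  define d where "d j = G j - G (Suc j)" for j
  have A: "?Q ^ a * list_branch q x 0 (a # map Suc l1) f = (\<Sum>j\<le>a. wt q x a j * (?Q ^ a * G j + x * V j))"
  proof -
    have "?Q ^ a * list_branch q x 0 (a # map Suc l1) f =
      (\<Sum>j\<le>a. wt q x a j * (?Q ^ a * list_branch q x a (map Suc l1) (\<lambda>l'. f (j # l'))))"
      by (simp add: sum_distrib_left atLeast0AtMost mult.left_commute)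
    also have "\<dots> = (\<Sum>j\<le>a. wt q x a j * (?Q ^ a * G j + x * V j))"
      unfolding list_branch_add_long_column[OF hd] by (simp add: list_branch_add list_branch_mult G_def V_def)
    finally show ?thesis .
  qed
  have B: "list_branch q x 0 (map Suc (a # l1)) f =
      (\<Sum>j\<le>a. wt q x a j * (G (Suc j) + x * (?Q ^ j * (G j - G (Suc j)))))"
    unfolding list_branch_add_long_column0 list_branch.simps atLeast0AtMost
    by (intro sum.cong refl) (simp add: list_branch_add list_branch_mult list_branch_diff G_def)
  have "col_diff q (\<lambda>l'. list_branch q x 0 l' f) l = 
      (\<Sum>j\<le>a. wt q x a j * (?Q ^ a * G j + x * V j)) -
      ?Q ^ a * (\<Sum>j\<le>a. wt q x a j * (G (Suc j) + x * (?Q ^ j * (G j - G (Suc j)))))"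
    unfolding Cons col_diff.simps right_diff_distrib A B ..
  also have "\<dots> = (\<Sum>j\<le>a. wt q x a j * (?Q ^ a * (1 - x * ?Q ^ j) * d j + x * V j))"
    unfolding sum_distrib_left sum_subtractf[symmetric] d_def
    by (intro sum.cong refl) (simp add: algebra_simps)
  finally have L: "col_diff q (\<lambda>l'. list_branch q x 0 l' f) l = \<dots>" .
  \<comment> \<open>At \<open>j = 0\<close> the truncated \<open>j - 1\<close> is harmless because
    of the factor \<open>1 - ?Q ^ j\<close>. The terms with \<open>G (j - 1)\<close> are moved to
    index \<open>j\<close> by \<open>sum_wt_shift\<close> below.\<close>
  have "list_branch q x 0 l (\<lambda>l'. col_diff q f l' + x * col_diff2 q f l') =
    (\<Sum>j\<le>a. wt q x a j * (?Q ^ j * d j + x * (V j - ?Q ^ j * d j -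
       (1 - ?Q ^ j) * (?Q ^ (j - 1) * (G (j - 1) - G j) - ?Q ^ j * d j))))"
    unfolding Cons list_branch.simps atLeast0AtMost
    by (intro sum.cong refl) (simp add: list_branch_add list_branch_mult list_branch_diff G_def V_def d_def)
  also have "\<dots> = (\<Sum>j\<le>a. wt q x a j * (?Q ^ j * (1 - x * ?Q ^ j) * d j + x * V j)) -
     (\<Sum>j\<le>a. wt q x a j * (x * (1 - ?Q ^ j) * (?Q ^ (j - 1) * (G (j - 1) - G j))))"
    unfolding sum_subtractf[symmetric]
    by (intro sum.cong refl) (simp add: algebra_simps)
  also have "\<dots> = (\<Sum>j\<le>a. wt q x a j * (?Q ^ j * (1 - x * ?Q ^ j) * d j + x * V j)) -
     (\<Sum>j\<le>a. wt q x a j * ((1 - ?Q ^ (a - j)) * (1 - x * ?Q ^ j) * (?Q ^ j * d j)))"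
    unfolding sum_wt_shift[OF q0 q1] by (simp add: d_def)
  also have "\<dots> = (\<Sum>j\<le>a. wt q x a j * (?Q ^ a * (1 - x * ?Q ^ j) * d j + x * V j))"
    unfolding sum_subtractf[symmetric]
  proof (intro sum.cong refl, goal_cases)
    case (1 j)
    then have "?Q ^ a = ?Q ^ (a - j) * ?Q ^ j" by (simp flip: power_add)
    then show ?case by (simp add: algebra_simps)
  qed
  finally show ?thesis using L by simp
qed simp

text \<open>Induction on boxes plus rows: an empty bottom row is dropped, otherwise one column
  through all rows is split off.\<close>

lemma list_branch_commute:
  fixes x y :: "'a::{comm_ring_1, real_algebra_1}"
  assumes "sorted l"
  shows "list_branch q x 0 l (\<lambda>l'. list_branch q y 0 l' f) = list_branch q y 0 l (\<lambda>l'. list_branch q x 0 l' f)"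
  using assms
proof (induction "sum_list l + length l" arbitrary: l f rule: less_induct)
  case less
  show ?case
  proof (cases l)
    case (Cons a l1)
    show ?thesis
    proof (cases a)
      case 0
      have "list_branch q x 0 l1 (\<lambda>l'. list_branch q y 0 l' (\<lambda>l''. f (0 # l''))) =
            list_branch q y 0 l1 (\<lambda>l'. list_branch q x 0 l' (\<lambda>l''. f (0 # l'')))"
        using less.prems by (intro less.hyps) (simp_all add: Cons)
      then show ?thesis by (simp add: Cons 0 wt_0[OF q0 q1])
    next
      case (Suc a')
      define k where "k = map (\<lambda>i. i - 1) l"
      have l: "l = map Suc k"
        using less.prems unfolding k_def Cons Suc by (auto intro!: map_idI[symmetric])
      have sk: "sorted k" using less.prems unfolding l by (simp add: sorted_map)
      have "sum_list l = sum_list k + length k"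
        unfolding l by (induction k) auto
      then have m: "sum_list k + length k < sum_list l + length l"
        using Cons l by auto
      \<comment> \<open>The function inside depends on \<open>u\<close> and \<open>v\<close> only
        through \<open>u + v\<close> and \<open>u * v\<close>; the order of the two steps is then
        exchanged on the smaller list \<open>k\<close>.\<close>
      have ex: "list_branch q u 0 l (\<lambda>l'. list_branch q v 0 l' f) =
        list_branch q u 0 k (\<lambda>l'. list_branch q v 0 l' (\<lambda>l''.
          f (map Suc l'') + (u + v) * col_diff q f l'' + u * v * col_diff2 q f l''))"
        for u v :: 'a
      proof -
        have "list_branch q u 0 l (\<lambda>l'. list_branch q v 0 l' f) = list_branch q u 0 k (\<lambda>l'. list_branch q v 0 (map Suc l') f + 
             u * col_diff q (\<lambda>l''. list_branch q v 0 l'' f) l')"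
          unfolding l by (rule list_branch_add_long_column0)
        also have "\<dots> = list_branch q u 0 k (\<lambda>l'. list_branch q v 0 l' (\<lambda>l''. f (map Suc l'') + v * col_diff q f l'') + 
             u * list_branch q v 0 l' (\<lambda>l''. col_diff q f l'' + v * col_diff2 q f l''))"
          by (intro list_branch_cong) (simp add: list_branch_add_long_column0 col_diff_list_branch)
        finally show ?thesis
          unfolding list_branch_mult[symmetric] list_branch_add[symmetric] by (simp only: algebra_simps)
      qed
      show ?thesis
        unfolding ex less.hyps[OF m sk] by (simp only: ac_simps)
    qed
  qed simp
qed

end


section \<open>Partitions and one branching step\<close>

lemma partition_antimono: "is_partition l \<Longrightarrow> i \<le> j \<Longrightarrow> l j \<le> l i"
  by (auto simp: is_partition_def antimono_def)

lemma partition_support: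
  assumes "is_partition l"
  shows "{i. l i \<noteq> 0} = {..<plength l}"
proof -
  have "{i. l i \<noteq> 0} \<noteq> UNIV"
    using assms infinite_UNIV_nat by (metis is_partition_def)
  then have "\<exists>i. l i = 0" by auto
  then obtain i where "l i = 0" ..
  then have z: "l (LEAST i. l i = 0) = 0" by (rule LeastI)
  have "{i. l i \<noteq> 0} = {..<LEAST i. l i = 0}"
  proof (intro set_eqI iffI)
    fix j assume "j \<in> {i. l i \<noteq> 0}"
    then have "\<not> (LEAST i. l i = 0) \<le> j"
      using partition_antimono[OF assms, of "LEAST i. l i = 0" j] z by auto
    then show "j \<in> {..<LEAST i. l i = 0}" by simp
  qed (auto dest: not_less_Least)
  then show ?thesis unfolding plength_def by simp
qed

lemma partition_eq_0_iff: "is_partition l \<Longrightarrow> l i = 0 \<longleftrightarrow> plength l \<le> i"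
  using eqset_imp_iff[OF partition_support, of l i] by auto

lemma psize_eq:
  assumes "is_partition l" "l n = 0"
  shows "psize l = (\<Sum>i<n. l i)"
proof -
  have "{i. l i \<noteq> 0} \<subseteq> {..<n}"
    unfolding partition_support[OF assms(1)] using assms partition_eq_0_iff by auto
  then show ?thesis unfolding psize_def
    by (intro sum.mono_neutral_left) auto
qed

lemma interlaces_partition:
  assumes "is_partition l" "interlaces nu l"
  shows "is_partition nu"
proof -
  have "nu i \<le> l i" "l (Suc i) \<le> nu i" for i
    using assms by (simp_all add: interlaces_def)
  then have sub: "{i. nu i \<noteq> 0} \<subseteq> {i. l i \<noteq> 0}" and mono: "nu (Suc i) \<le> nu i" for i
    by (auto intro: order_trans simp: Collect_mono_iff) (metis le_zero_eq neq0_conv)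
  have "finite {i. nu i \<noteq> 0}"
    using assms by (intro finite_subset[OF sub]) (simp add: is_partition_def)
  with mono show ?thesis by (simp add: is_partition_def antimono_iff_le_Suc)
qed

lemma interlaces_le: "interlaces nu l \<Longrightarrow> partition_le nu l"
  by (simp add: interlaces_def partition_le_def)

lemma partition_le_trans: "partition_le a b \<Longrightarrow> partition_le b c \<Longrightarrow> partition_le a c"
  by (auto simp: partition_le_def intro: order_trans)

lemma interlaces_refl: "is_partition l \<Longrightarrow> interlaces l l"
  by (auto simp: interlaces_def is_partition_def antimono_iff_le_Suc)

text \<open>The power of \<open>x\<close> is distributed over the rows, and each row beyond the
  length contributes \<open>wt q x 0 0 = 1\<close>, so any \<open>n\<close> with
  \<open>l n = 0\<close> will do.\<close>

lemma F_one_prod: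
  fixes x :: "'a::{comm_ring_1, real_algebra_1}"
  assumes l: "is_partition l" and n: "l n = 0" and i: "interlaces mu l"
  shows "F_one q l mu x = (\<Prod>r<n. wt q x (l r - l (Suc r)) (mu r - l (Suc r)))"
proof -
  have mu: "is_partition mu" by (rule interlaces_partition[OF l i])
  have le: "l (Suc r) \<le> mu r" "mu r \<le> l r" for r using i by (auto simp: interlaces_def)
  have mun: "mu n = 0" using le(2)[of n] n by simp
  have z: "l r = 0" "mu r = 0" if "plength l \<le> r" for r
    using that partition_eq_0_iff[OF l, of r] le(2)[of r] by simp_all
  have "psize l - psize mu = (\<Sum>r<n. l r - mu r)"
    unfolding psize_eq[OF l n] psize_eq[OF mu mun] by (rule sum_subtractf_nat[symmetric]) (rule le)
  then have p: "x ^ (psize l - psize mu) = (\<Prod>r<n. x ^ (l r - mu r))" by (simp add: power_sum)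
  have "(\<Prod>r<plength l. qpoch x (of_real q) (mu r - l (Suc r)) *
          of_real (qpoch q q (l r - l (Suc r)) / (qpoch q q (l r - mu r) * qpoch q q (mu r - l (Suc r))))) =
     (\<Prod>r<n. qpoch x (of_real q) (mu r - l (Suc r)) *
          of_real (qpoch q q (l r - l (Suc r)) / (qpoch q q (l r - mu r) * qpoch q q (mu r - l (Suc r)))))"
    using partition_eq_0_iff[OF l] n
    by (intro prod.mono_neutral_left) (auto simp: z)
  moreover have "l r - l (Suc r) - (mu r - l (Suc r)) = l r - mu r" for r
    using le[of r] by simp
  ultimately show ?thesis using i le
    by (simp add: F_one_def p prod.distrib[symmetric] wt_def mult.assoc diff_le_mono)
qed

section \<open>Partitions with a new first row\<close>

definition pcons :: "nat \<Rightarrow> (nat \<Rightarrow> nat) \<Rightarrow> nat \<Rightarrow> nat" where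
  "pcons K l = case_nat K l"

lemma pcons_simps [simp]: "pcons K l 0 = K" "pcons K l (Suc i) = l i"
  by (simp_all add: pcons_def)

lemma all_nat_split: "(\<forall>i::nat. P i) \<longleftrightarrow> P 0 \<and> (\<forall>i. P (Suc i))"
  by (metis not0_implies_Suc)

lemma pcons_eq_iff [simp]: "pcons K l = pcons K' l' \<longleftrightarrow> K = K' \<and> l = l'"
  by (simp add: fun_eq_iff all_nat_split[of "\<lambda>i. pcons K l i = pcons K' l' i"])

lemma pcons_hd_tl: "pcons (l 0) (\<lambda>i. l (Suc i)) = l"
  by (rule ext, case_tac x) simp_all

lemma is_partition_pcons [simp]: "is_partition (pcons K l) \<longleftrightarrow> is_partition l \<and> l 0 \<le> K"
proof -
  have "{i. pcons K l i \<noteq> 0} = (if K = 0 then {} else {0}) \<union> Suc ` {i. l i \<noteq> 0}"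
    by (auto simp: image_iff pcons_def split: nat.splits) (metis not0_implies_Suc neq0_conv)+
  then have "finite {i. pcons K l i \<noteq> 0} \<longleftrightarrow> finite {i. l i \<noteq> 0}"
    by (simp add: finite_image_iff)
  then show ?thesis
    unfolding is_partition_def antimono_iff_le_Suc
    by (subst all_nat_split) auto
qed

lemma pcons_0_empty [simp]: "pcons 0 empty_partition = empty_partition"
  by (rule ext, case_tac x) (simp_all add: empty_partition_def)

lemma is_partition_empty [simp]: "is_partition empty_partition"
  by (simp add: is_partition_def empty_partition_def antimono_def)

lemma empty_partition_apply: "empty_partition i = 0"
  by (simp add: empty_partition_def)

lemma empty_partition_simps [simp]: "empty_partition 0 = 0" "empty_partition (Suc i) = 0"
  by (simp_all add: empty_partition_def)

lemma interlaces_pcons [simp]: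
  "interlaces (pcons m nu) (pcons K l) \<longleftrightarrow> l 0 \<le> m \<and> m \<le> K \<and> interlaces nu l"
  unfolding interlaces_def by (subst all_nat_split) auto

lemma interlaces_tl:
  assumes "interlaces nu (pcons K l)"
  shows "interlaces (\<lambda>i. nu (Suc i)) l" "l 0 \<le> nu 0" "nu 0 \<le> K"
  using assms interlaces_pcons[of "nu 0" "\<lambda>i. nu (Suc i)" K l] by (simp_all add: pcons_hd_tl)

lemma partition_le_pcons [simp]:
  "partition_le (pcons m nu) (pcons K l) \<longleftrightarrow> m \<le> K \<and> partition_le nu l"
  unfolding partition_le_def by (subst all_nat_split) auto

lemma partition_tl: "is_partition l \<Longrightarrow> is_partition (\<lambda>i. l (Suc i))"
  by (subst (asm) pcons_hd_tl[symmetric], subst (asm) is_partition_pcons) simp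

lemma partition_induct [consumes 1, case_names empty pcons]:
  assumes "is_partition l"
    and e: "P empty_partition"
    and c: "\<And>K l. is_partition l \<Longrightarrow> l 0 \<le> K \<Longrightarrow> P l \<Longrightarrow> P (pcons K l)"
  shows "P l"
proof -
  have "\<forall>l. is_partition l \<longrightarrow> l n = 0 \<longrightarrow> P l" for n
  proof (induction n)
    case 0
    have "l = empty_partition" if "is_partition l" "l 0 = 0" for l
      using partition_antimono[OF that(1), of 0] that(2) by (simp add: fun_eq_iff empty_partition_apply)
    then show ?case using e by metis
  next
    case (Suc n)
    show ?case
    proof (intro allI impI)
      fix l assume l: "is_partition l" "l (Suc n) = 0"
      then have "P (\<lambda>i. l (Suc i))" using Suc partition_tl by blast
      then have "P (pcons (l 0) (\<lambda>i. l (Suc i)))"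
        using l partition_antimono[OF l(1), of 0 1] by (intro c partition_tl) auto
      then show "P l" by (simp only: pcons_hd_tl)
    qed
  qed
  moreover have "l (plength l) = 0" using partition_eq_0_iff[OF assms(1)] by simp
  ultimately show ?thesis using assms(1) by blast
qed

lemma F_one_pcons:
  fixes x :: "'a::{comm_ring_1, real_algebra_1}"
  assumes "is_partition (pcons K l)"
  shows "F_one q (pcons K l) (pcons m nu) x =
    (if l 0 \<le> m \<and> m \<le> K then wt q x (K - l 0) (m - l 0) * F_one q l nu x else 0)"
proof (cases "interlaces (pcons m nu) (pcons K l)")
  case True
  have l: "is_partition l" using assms by simp
  have n: "l (plength l) = 0" using partition_eq_0_iff[OF l] by simp
  have i: "interlaces nu l" using True by simp
  have "F_one q (pcons K l) (pcons m nu) x =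
    (\<Prod>r<Suc (plength l). wt q x (pcons K l r - pcons K l (Suc r)) (pcons m nu r - pcons K l (Suc r)))"
    using n by (intro F_one_prod assms True) simp
  then show ?thesis
    using True by (simp add: prod.lessThan_Suc_shift F_one_prod[OF l n i] del: prod.lessThan_Suc)
qed (auto simp: F_one_def)

text \<open>One step as a linear operator on functions of partitions, so that identities between
  skew functions become identities between operators.\<close>

definition branch :: "real \<Rightarrow> 'a \<Rightarrow> (nat \<Rightarrow> nat) \<Rightarrow> ((nat \<Rightarrow> nat) \<Rightarrow> 'a) \<Rightarrow> 'a::{comm_ring_1, real_algebra_1}"
  where "branch q x l f = (\<Sum>nu | is_partition nu \<and> interlaces nu l. F_one q l nu x * f nu)"

lemma branch_cong:
  "(\<And>nu. is_partition nu \<Longrightarrow> interlaces nu l \<Longrightarrow> f nu = g nu) \<Longrightarrow> branch q x l f = branch q x l g"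
  unfolding branch_def by (intro sum.cong) auto

lemma branch_mult: "branch q x l (\<lambda>nu. c * f nu) = c * branch q x l f"
  by (simp add: branch_def sum_distrib_left mult.left_commute)

lemma branch_diff: "branch q x l (\<lambda>nu. f nu - g nu) = branch q x l f - branch q x l g"
  by (simp add: branch_def right_diff_distrib sum_subtractf)

lemma branch_sum: "branch q x l (\<lambda>nu. \<Sum>i\<in>A. f i nu) = (\<Sum>i\<in>A. branch q x l (f i))"
  unfolding branch_def sum_distrib_left by (rule sum.swap)

lemma branch_empty [simp]: "branch q x empty_partition f = f empty_partition"
proof -
  have "{nu. is_partition nu \<and> interlaces nu empty_partition} = {empty_partition}"
    by (auto simp: interlaces_def empty_partition_def interlaces_refl)
       (simp add: is_partition_def antimono_def)
  then show ?thesis by (simp add: branch_def F_one_def interlaces_def plength_def empty_partition_def)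
qed

text \<open>The new length of the first row has a weight that involves only the old lengths
  \<open>K\<close> and \<open>l 0\<close>, hence it is independent of the moves of the lower
  rows.\<close>

lemma branch_pcons:
  fixes x :: "'a::{comm_ring_1, real_algebra_1}"
  assumes l: "is_partition l" and K: "l 0 \<le> K"
  shows "branch q x (pcons K l) f =
    branch q x l (\<lambda>nu. \<Sum>m\<in>{l 0..K}. wt q x (K - l 0) (m - l 0) * f (pcons m nu))"
proof -
  let ?N = "{nu. is_partition nu \<and> interlaces nu l}"
  have nu0: "nu 0 \<le> l 0" if "interlaces nu l" for nu using that by (simp add: interlaces_def)
  have "branch q x (pcons K l) f = (\<Sum>(nu, m)\<in>?N \<times> {l 0..K}. F_one q (pcons K l) (pcons m nu) x * f (pcons m nu))"
    unfolding branch_def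
    by (rule sum.reindex_bij_witness[of _ "\<lambda>(nu, m). pcons m nu" "\<lambda>nu. (\<lambda>i. nu (Suc i), nu 0)"])
       (use l K in \<open>auto simp: pcons_hd_tl intro: partition_tl order_trans[OF nu0] dest: interlaces_tl\<close>)
  also have "\<dots> = (\<Sum>nu\<in>?N. \<Sum>m\<in>{l 0..K}. F_one q l nu x * (wt q x (K - l 0) (m - l 0) * f (pcons m nu)))"
    unfolding sum.cartesian_product[symmetric] using l K
    by (intro sum.cong refl) (simp add: F_one_pcons mult.assoc mult.left_commute)
  finally show ?thesis by (simp add: branch_def sum_distrib_left)
qed

section \<open>Partitions as lists of rows\<close>

definition list_part :: "nat list \<Rightarrow> nat \<Rightarrow> nat" where
  "list_part l = fold pcons l empty_partition"

lemma list_part_simps [simp]: "list_part [] = empty_partition" "list_part (l @ [a]) = pcons a (list_part l)"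
  by (simp_all add: list_part_def)

lemma list_part_0: "list_part l 0 = last (0 # l)"
  by (induction l rule: rev_induct) simp_all

lemma list_part_partition: "sorted l \<Longrightarrow> is_partition (list_part l)"
  by (induction l rule: rev_induct) (auto simp: list_part_0 sorted_append)

lemma partition_list: "is_partition l \<Longrightarrow> \<exists>k. sorted k \<and> l = list_part k"
proof (induction rule: partition_induct)
  case empty
  show ?case by (intro exI[of _ "[]"]) simp
next
  case (pcons K l)
  then obtain k where k: "sorted k" "l = list_part k" by blast
  have "a \<le> K" if "a \<in> set k" for a
  proof -
    have "a \<le> last k"
      using k(1) that by (cases k rule: rev_cases) (auto simp: sorted_append)
    moreover have "last k = l 0" using that k(2) list_part_0[of k] by auto
    ultimately show ?thesis using pcons.hyps by simp
  qed
  then show ?case using k by (intro exI[of _ "k @ [K]"]) (auto simp: sorted_append)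
qed

lemma branch_list_part:
  "sorted l \<Longrightarrow> branch q x (list_part l) f = list_branch q x 0 l (\<lambda>l'. f (list_part l'))"
proof (induction l arbitrary: f rule: rev_induct)
  case (snoc a l)
  then have "sorted l" "list_part l 0 \<le> a" by (auto simp: sorted_append list_part_0)
  then show ?case
    by (simp add: branch_pcons list_part_partition snoc.IH list_branch_snoc list_part_0 del: last.simps)
qed simp

lemma branch_commute:
  assumes "0 < q" "q < 1" "is_partition l"
  shows "branch q x l (\<lambda>nu. branch q y nu f) = branch q y l (\<lambda>nu. branch q x nu f)"
proof -
  obtain k where k: "sorted k" "l = list_part k" using partition_list[OF assms(3)] by blast
  have "branch q u (list_part k) (\<lambda>nu. branch q v nu f) = list_branch q u 0 k (\<lambda>l'. list_branch q v 0 l' (\<lambda>l''. f (list_part l'')))"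
    for u v
    unfolding branch_list_part[OF k(1)] by (rule list_branch_cong) (simp add: branch_list_part)
  then show ?thesis unfolding k(2) by (simp only: list_branch_commute[OF assms(1,2) k(1), of x])
qed


section \<open>Finitely many variables\<close>

text \<open>Starting from \<open>l\<close>, the step for \<open>x (n - 1)\<close> comes first and
  that for \<open>x 0\<close> last. The skew functions \<open>F_fin\<close> are the matrix entries
  of this operator.\<close>

primrec iter :: "real \<Rightarrow> (nat \<Rightarrow> 'a) \<Rightarrow> nat \<Rightarrow> (nat \<Rightarrow> nat) \<Rightarrow> ((nat \<Rightarrow> nat) \<Rightarrow> 'a) \<Rightarrow>
    'a::{comm_ring_1, real_algebra_1}" where
  "iter q x 0 l f = f l"
| "iter q x (Suc n) l f = branch q (x n) l (\<lambda>nu. iter q x n nu f)"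

definition subparts :: "(nat \<Rightarrow> nat) \<Rightarrow> (nat \<Rightarrow> nat) set" where
  "subparts l = {k. is_partition k \<and> partition_le k l}"

lemma finite_subparts:
  assumes "is_partition l"
  shows "finite (subparts l)"
proof (rule finite_subset)
  let ?A = "{i. l i \<noteq> 0}"
  show "finite {f. \<forall>i. (i \<in> ?A \<longrightarrow> f i \<in> {..l 0}) \<and> (i \<notin> ?A \<longrightarrow> f i = 0)}"
    using assms by (intro finite_set_of_finite_funs) (auto simp: is_partition_def)
  have "k i \<le> l 0" "l i = 0 \<Longrightarrow> k i = 0" if "partition_le k l" for k i
    using that partition_antimono[OF assms, of 0 i] by (auto simp: partition_le_def)
      (metis le_trans le_zero_eq)+
  then show "subparts l \<subseteq> {f. \<forall>i. (i \<in> ?A \<longrightarrow> f i \<in> {..l 0}) \<and> (i \<notin> ?A \<longrightarrow> f i = 0)}"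
    by (auto simp: subparts_def)
qed

lemma F_fin_iter: "F_fin q x n l mu = iter q x n l (\<lambda>k. if k = mu then 1 else 0)"
  by (induction n arbitrary: l) (auto simp: branch_def mult.commute)

lemma F_fin_eq_0: "\<not> partition_le mu l \<Longrightarrow> F_fin q x n l mu = 0"
proof (induction n arbitrary: l)
  case 0
  then show ?case by (auto simp: partition_le_def)
next
  case (Suc n)
  have "F_fin q x n nu mu = 0" if "interlaces nu l" for nu
    using Suc.prems that interlaces_le partition_le_trans by (intro Suc.IH) blast
  then show ?case by simp
qed

lemma iter_eq_sum:
  assumes "is_partition l"
  shows "iter q x n l f = (\<Sum>k\<in>subparts l. F_fin q x n l k * f k)"
  using assms
proof (induction n arbitrary: l)
  case 0
  have "(\<Sum>k\<in>subparts l. F_fin q x 0 l k * f k) = (\<Sum>k\<in>subparts l. if l = k then f k else 0)"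
    by (intro sum.cong) auto
  then show ?case using 0 finite_subparts[OF 0] by (simp add: subparts_def partition_le_def)
next
  case (Suc n)
  have "iter q x n nu f = (\<Sum>k\<in>subparts l. F_fin q x n nu k * f k)"
    if "is_partition nu" "interlaces nu l" for nu
    unfolding Suc.IH[OF that(1)] using that Suc.prems
    by (intro sum.mono_neutral_left finite_subparts)
       (auto simp: subparts_def F_fin_eq_0 intro: partition_le_trans dest: interlaces_le)
  then have "iter q x (Suc n) l f =
    branch q (x n) l (\<lambda>nu. \<Sum>k\<in>subparts l. F_fin q x n nu k * f k)"
    by (auto intro!: branch_cong)
  also have "\<dots> = (\<Sum>k\<in>subparts l. F_fin q x (Suc n) l k * f k)"
    unfolding branch_sum F_fin.simps sum_distrib_right by (simp add: branch_def ac_simps)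
  finally show ?case .
qed

lemma branch_delta:
  assumes "is_partition l"
  shows "branch q x l (\<lambda>k. if k = mu then 1 else 0) = F_one q l mu x"
proof -
  have "branch q x l (\<lambda>k. if k = mu then 1 else 0) =
    (\<Sum>nu | is_partition nu \<and> interlaces nu l. if nu = mu then F_one q l nu x else 0)"
    unfolding branch_def by (intro sum.cong) auto
  then show ?thesis
    using finite_interlaces[OF assms] interlaces_partition[OF assms] by (auto simp: F_one_def)
qed

lemma branch_iter_commute:
  assumes "0 < q" "q < 1" "is_partition l"
  shows "branch q y l (\<lambda>nu. iter q x n nu f) = iter q x n l (\<lambda>nu. branch q y nu f)"
  using assms(3)
proof (induction n arbitrary: l)
  case (Suc n)
  show ?case
    unfolding iter.simps branch_commute[OF assms(1,2) Suc.prems, of y]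
    by (rule branch_cong) (rule Suc.IH)
qed simp

text \<open>The additional variable \<open>y\<close> may act last or first: this is
  \<open>branch_iter_commute\<close> for the indicator function of \<open>mu\<close>.\<close>

lemma F_fin_commute:
  assumes "0 < q" "q < 1" "is_partition l"
  shows "(\<Sum>k\<in>subparts l. F_fin q x n l k * F_one q k mu y) =
    branch q y l (\<lambda>nu. F_fin q x n nu mu)"
proof -
  have "branch q y l (\<lambda>nu. F_fin q x n nu mu) = iter q x n l (\<lambda>nu. branch q y nu (\<lambda>k. if k = mu then 1 else 0))"
    unfolding F_fin_iter by (rule branch_iter_commute[OF assms])
  also have "\<dots> = (\<Sum>k\<in>subparts l. F_fin q x n l k * F_one q k mu y)"
    unfolding iter_eq_sum[OF assms(3)] by (intro sum.cong) (auto simp: branch_delta subparts_def)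
  finally show ?thesis by simp
qed

lemma F_fin_Suc: "F_fin q x (Suc n) l mu = branch q (x n) l (\<lambda>nu. F_fin q x n nu mu)"
  by (simp add: branch_def mult.commute)

declare F_fin.simps(2) [simp del]

section \<open>Partitions with all parts equal to 1\<close>

lemma column_0 [simp]: "column_partition 0 = empty_partition"
  by (simp add: column_partition_def empty_partition_def)

lemma column_Suc: "column_partition (Suc j) = pcons 1 (column_partition j)"
  by (rule ext, case_tac x) (simp_all add: column_partition_def)

lemma column_partition_le [simp]: "column_partition j i \<le> 1" "column_partition j i \<le> Suc 0"
  by (simp_all add: column_partition_def)

lemma column_partition [simp]: "is_partition (column_partition j)"
  by (induction j) (simp_all add: column_Suc)

text \<open>Polynomials of degree at most \<open>d\<close> in \<open>p ^ K\<close>, tracked together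
  with their coefficient \<open>R\<close> of degree \<open>d\<close>, which may be 0. With
  \<open>p = 1/q\<close> they describe how moments grow with the length \<open>K\<close> of the
  first row.\<close>

definition qpoly :: "real \<Rightarrow> nat \<Rightarrow> nat \<Rightarrow> 'a \<Rightarrow> (nat \<Rightarrow> 'a::{comm_ring_1, real_algebra_1}) \<Rightarrow> bool" where
  "qpoly p a d R W \<longleftrightarrow> (\<exists>r. r d = R \<and> (\<forall>K\<ge>a. W K = (\<Sum>s\<le>d. of_real (p ^ (K * s)) * r s)))"

lemma qpoly_cong: "qpoly p a d R W \<Longrightarrow> (\<And>K. K \<ge> a \<Longrightarrow> W' K = W K) \<Longrightarrow> R' = R \<Longrightarrow> qpoly p a d R' W'"
  unfolding qpoly_def by metis

lemma qpoly_mult: "qpoly p a d R W \<Longrightarrow> qpoly p a d (c * R) (\<lambda>K. c * W K)"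
proof -
  assume "qpoly p a d R W"
  then obtain r where "r d = R" "\<And>K. K \<ge> a \<Longrightarrow> W K = (\<Sum>s\<le>d. of_real (p ^ (K * s)) * r s)"
    unfolding qpoly_def by blast
  then show ?thesis unfolding qpoly_def
    by (intro exI[of _ "\<lambda>s. c * r s"]) (simp add: sum_distrib_left mult.left_commute)
qed

lemma qpoly_sum:
  assumes "\<And>i. i \<in> A \<Longrightarrow> qpoly p a d (R i) (W i)"
  shows "qpoly p a d (\<Sum>i\<in>A. R i) (\<lambda>K. \<Sum>i\<in>A. W i K)"
proof -
  have "\<forall>i\<in>A. \<exists>r. r d = R i \<and> (\<forall>K\<ge>a. W i K = (\<Sum>s\<le>d. of_real (p ^ (K * s)) * r s))"
    using assms by (simp add: qpoly_def)
  then obtain r where r: "\<forall>i\<in>A. r i d = R i \<and> (\<forall>K\<ge>a. W i K = (\<Sum>s\<le>d. of_real (p ^ (K * s)) * r i s))"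
    by metis
  have "(\<Sum>i\<in>A. W i K) = (\<Sum>s\<le>d. of_real (p ^ (K * s)) * (\<Sum>i\<in>A. r i s))" if "K \<ge> a" for K
    unfolding sum_distrib_left by (subst sum.swap) (use r that in \<open>auto intro!: sum.cong\<close>)
  then show ?thesis unfolding qpoly_def using r
    by (intro exI[of _ "\<lambda>s. \<Sum>i\<in>A. r i s"]) (auto intro!: sum.cong)
qed

lemma qpoly_add: "qpoly p a d R W \<Longrightarrow> qpoly p a d R' W' \<Longrightarrow> qpoly p a d (R + R') (\<lambda>K. W K + W' K)"
  using qpoly_sum[of "{False, True}" p a d "\<lambda>b. if b then R' else R" "\<lambda>b. if b then W' else W"]
  by simp

lemma qpoly_lower:
  assumes "qpoly p a s R W" "s < d"
  shows "qpoly p a d 0 W"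
proof -
  obtain r where r: "\<And>K. K \<ge> a \<Longrightarrow> W K = (\<Sum>s\<le>s. of_real (p ^ (K * s)) * r s)"
    using assms unfolding qpoly_def by blast
  define r' where "r' t = (if t \<le> s then r t else 0)" for t
  have "(\<Sum>t\<le>s. of_real (p ^ (K * t)) * r t) = (\<Sum>t\<le>d. of_real (p ^ (K * t)) * r' t)" for K
    using assms(2) by (intro sum.mono_neutral_cong_left) (auto simp: r'_def)
  then show ?thesis unfolding qpoly_def using r assms(2)
    by (intro exI[of _ r']) (auto simp: r'_def)
qed

lemma qpoly_pow_mult:
  assumes "qpoly p a d R W"
  shows "qpoly p a (Suc d) R (\<lambda>K. of_real (p ^ K) * W K)"
proof -
  obtain r where r: "r d = R" "\<And>K. K \<ge> a \<Longrightarrow> W K = (\<Sum>s\<le>d. of_real (p ^ (K * s)) * r s)"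
    using assms unfolding qpoly_def by blast
  have "of_real (p ^ K) * W K = (\<Sum>s\<le>Suc d. of_real (p ^ (K * s)) * (case s of 0 \<Rightarrow> 0 | Suc t \<Rightarrow> r t))"
    if "K \<ge> a" for K
    by (subst sum.atMost_Suc_shift) (simp add: r(2)[OF that] sum_distrib_left power_add mult.assoc)
  then show ?thesis unfolding qpoly_def
    using r(1) by (intro exI[of _ "\<lambda>s. case s of 0 \<Rightarrow> 0 | Suc t \<Rightarrow> r t"]) simp
qed

section \<open>Moments of row lengths\<close>

context
  fixes q :: real
  assumes q0: "0 < q" and q1: "q < 1"
begin

lemma of_real_inverse_power: "of_real ((1/q) ^ k) * of_real (q ^ k) = (1 :: 'a::real_algebra_1)"
  using q0 by (simp only: of_real_mult[symmetric] power_mult_distrib[symmetric]) simp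

lemma of_real_inverse_power_add:
  "of_real ((1/q) ^ (i + j)) * of_real (q ^ i) = (of_real ((1/q) ^ j) :: 'a::{comm_ring_1, real_algebra_1})"
proof -
  have "of_real ((1/q) ^ (i + j)) * of_real (q ^ i) = (of_real ((1/q) ^ j) :: 'a) * (of_real ((1/q) ^ i) * of_real (q ^ i))"
    by (simp only: power_add of_real_mult ac_simps)
  then show ?thesis by (simp only: of_real_inverse_power mult_1_right)
qed

lemma branch_1: "is_partition l \<Longrightarrow> branch q x l (\<lambda>_. 1) = (1 :: 'a::{comm_ring_1, real_algebra_1})"
proof (induction rule: partition_induct)
  case (pcons K l)
  then show ?case by (simp add: branch_pcons sum_from_base sum_wt[OF q0 q1])
qed simp

lemma branch_const: "is_partition l \<Longrightarrow> branch q x l (\<lambda>_. c) = (c :: 'a::{comm_ring_1, real_algebra_1})"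
  using branch_mult[of q x l c "\<lambda>_. 1"] branch_1[of l x] by simp

lemma iter_1: "is_partition l \<Longrightarrow> iter q x n l (\<lambda>_. 1) = (1 :: 'a::{comm_ring_1, real_algebra_1})"
proof (induction n arbitrary: l)
  case (Suc n)
  have "iter q x (Suc n) l (\<lambda>_. 1) = branch q (x n) l (\<lambda>_. 1)"
    unfolding iter.simps by (rule branch_cong) (rule Suc.IH)
  then show ?case using branch_1[OF Suc.prems] by simp
qed simp

text \<open>From \<open>(q^-(i+1) - 1) [n+1, i+1] = (q^-(n+1) - 1) q^(n-i) [n, i]\<close>. Absorbing
  \<open>q^(n-i)\<close> and splitting \<open>1 - x\<close> off \<open>qpoch\<close> both turn
  \<open>x\<close> into \<open>x q\<close>.\<close>

lemma wt_pow_shift: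
  fixes x :: "'a::{comm_ring_1, real_algebra_1}"
  assumes "i \<le> n"
  shows "(of_real ((1/q) ^ Suc i) - 1) * wt q x (Suc n) (Suc i) =
    (of_real ((1/q) ^ Suc n) - 1) * (1 - x) * wt q (x * of_real q) n i"
proof -
  obtain k where n: "n = i + k" using assms by (metis le_add_diff_inverse)
  let ?A = "qpoch q q (Suc n) / (qpoch q q k * qpoch q q (Suc i))"
  let ?B = "qpoch q q n / (qpoch q q k * qpoch q q i)"
  have "((1/q) ^ Suc i - 1) * ?A = ((1/q) ^ Suc n - 1) * (q ^ k * ?B)"
    using q0 by (simp add: qpoch_Suc divide_simps qpoch_q_nz[OF q0 q1] q_pow_neq_1[OF q0 q1] n power_add)
  then have "of_real ((1/q) ^ Suc i - 1) * of_real ?A = of_real ((1/q) ^ Suc n - 1) * (of_real (q ^ k) * (of_real ?B :: 'a))"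
    by (metis of_real_mult)
  then have AB: "(of_real ((1/q) ^ Suc i) - 1) * of_real ?A = (of_real ((1/q) ^ Suc n) - 1) * (of_real q ^ k * (of_real ?B :: 'a))"
    by (simp only: of_real_diff of_real_1 of_real_power)
  have w: "wt q x (Suc n) (Suc i) = x ^ k * qpoch x (of_real q) (Suc i) * of_real ?A"
    "wt q (x * of_real q) n i = (x * of_real q) ^ k * qpoch (x * of_real q) (of_real q) i * of_real ?B"
    unfolding wt_def by (simp_all add: n)
  have "(of_real ((1/q) ^ Suc i) - 1) * wt q x (Suc n) (Suc i) = 
     x ^ k * qpoch x (of_real q) (Suc i) * ((of_real ((1/q) ^ Suc i) - 1) * of_real ?A)"
    unfolding w by (simp only: ac_simps)
  also have "\<dots> = (of_real ((1/q) ^ Suc n) - 1) * (1 - x) * wt q (x * of_real q) n i"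
    unfolding AB w qpoch_Suc_shift[of x] power_mult_distrib by (simp only: ac_simps)
  finally show ?thesis .
qed

text \<open>One factor \<open>q^-i\<close> of the moment is written as
  \<open>1 + (q^-i - 1)\<close>. At \<open>n = 0\<close> the factor \<open>q^-n - 1\<close>
  vanishes, so the truncated \<open>n - 1\<close> does no harm.\<close>

lemma wt_moment_Suc:
  fixes x :: "'a::{comm_ring_1, real_algebra_1}"
  shows "(\<Sum>i\<le>n. wt q x n i * of_real ((1/q) ^ (i * Suc d))) =
    (\<Sum>i\<le>n. wt q x n i * of_real ((1/q) ^ (i * d))) +
    (of_real ((1/q) ^ n) - 1) * ((1 - x) * of_real ((1/q) ^ d) *
      (\<Sum>i\<le>n - 1. wt q (x * of_real q) (n - 1) i * of_real ((1/q) ^ (i * d))))"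
proof (cases n)
  case (Suc n')
  let ?P = "\<lambda>k. of_real ((1/q) ^ k) :: 'a"
  have "(\<Sum>i\<le>n. wt q x n i * ?P (i * Suc d)) - (\<Sum>i\<le>n. wt q x n i * ?P (i * d)) =
      (\<Sum>i\<le>n. (?P i - 1) * wt q x n i * ?P (i * d))"
    unfolding sum_subtractf[symmetric] by (intro sum.cong refl) (simp add: power_add algebra_simps)
  also have "\<dots> = (\<Sum>i\<le>n'. (?P (Suc i) - 1) * wt q x (Suc n') (Suc i) * ?P (Suc i * d))"
    unfolding Suc by (subst sum.atMost_Suc_shift) simp
  also have "\<dots> = (\<Sum>i\<le>n'. (?P (Suc n') - 1) * (1 - x) * wt q (x * of_real q) n' i * ?P (Suc i * d))"
    by (intro sum.cong refl) (simp only: wt_pow_shift atMost_iff)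
  also have "\<dots> = (?P n - 1) * ((1 - x) * ?P d * (\<Sum>i\<le>n - 1. wt q (x * of_real q) (n - 1) i * ?P (i * d)))"
    unfolding Suc sum_distrib_left diff_Suc_1 mult_Suc power_add of_real_mult
    by (intro sum.cong refl) (simp only: ac_simps)
  finally show ?thesis by (simp add: algebra_simps)
qed simp

text \<open>Induction on \<open>d\<close> for all \<open>x\<close>: each application of
  \<open>wt_moment_Suc\<close> contributes \<open>1 - x\<close> to the leading coefficient and
  replaces \<open>x\<close> by \<open>x q\<close>, which builds up \<open>(x;q)_d\<close>.\<close>

lemma wt_moment:
  "qpoly (1/q) 0 d (qpoch x (of_real q) d) (\<lambda>n. \<Sum>i\<le>n. wt q x n i * of_real ((1/q) ^ (i * d)))"
proof (induction d arbitrary: x)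
  case 0
  show ?case unfolding qpoly_def by (intro exI[of _ "\<lambda>_. 1"]) (simp add: sum_wt[OF q0 q1])
next
  case (Suc d)
  let ?P = "\<lambda>k. of_real ((1/q) ^ k)"
  let ?M = "\<lambda>x d n. \<Sum>i\<le>n. wt q x n i * ?P (i * d)"
  obtain r where r: "r d = qpoch (x * of_real q) (of_real q) d"
    "\<And>n. ?M (x * of_real q) d n = (\<Sum>s\<le>d. ?P (n * s) * r s)"
    using Suc.IH[of "x * of_real q"] unfolding qpoly_def by auto
  \<comment> \<open>For positive \<open>n\<close> this is the second term of
    \<open>wt_moment_Suc\<close> without \<open>q^-n - 1\<close>. Passing from powers of
    \<open>q^-(n-1)\<close> to powers of \<open>q^-n\<close> yields the factor \<open>q^s\<close>,
    which cancels \<open>q^-d\<close> in the top degree.\<close>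
  define W where "W n = (\<Sum>s\<le>d. ?P (n * s) * ((1 - x) * of_real ((1/q) ^ d) * of_real (q ^ s) * r s))" for n
  have "of_real ((1/q) ^ d) * of_real (q ^ d) = (1 :: 'a)"
    by (rule of_real_inverse_power)
  then have top: "(1 - x) * of_real ((1/q) ^ d) * of_real (q ^ d) * r d = qpoch x (of_real q) (Suc d)"
    unfolding qpoch_Suc_shift r(1) by (simp add: mult.assoc)
  have W: "qpoly (1/q) 0 d (qpoch x (of_real q) (Suc d)) W"
    unfolding qpoly_def W_def top[symmetric]
    by (intro exI[of _ "\<lambda>s. (1 - x) * of_real ((1/q) ^ d) * of_real (q ^ s) * r s"]) simp
  have "qpoly (1/q) 0 (Suc d) (0 + (qpoch x (of_real q) (Suc d) + - 1 * 0)) (\<lambda>n. ?M x d n + (?P n * W n + - 1 * W n))"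
    by (intro qpoly_add qpoly_pow_mult qpoly_mult W qpoly_lower[OF W] qpoly_lower[OF Suc.IH]) simp_all
  moreover have "?M x (Suc d) n = ?M x d n + (?P n * W n + - 1 * W n)" for n
  proof (cases n)
    case (Suc n')
    have "?P (n' * s) = (?P (n * s) * of_real (q ^ s) :: 'a)" for s
      by (simp only: Suc mult_Suc of_real_inverse_power_add)
    then have "(1 - x) * ?P d * ?M (x * of_real q) d (n - 1) = W n"
      unfolding r(2) W_def sum_distrib_left
      by (intro sum.cong refl) (simp add: Suc ac_simps)
    then show ?thesis unfolding wt_moment_Suc[of x n d] by (simp only: left_diff_distrib mult_1 mult_minus1 uminus_add_conv_diff add_uminus_conv_diff)
  qed (simp add: W_def)
  ultimately show ?case by (simp add: qpoly_def)
qed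

lemma wt_moment_base:
  "qpoly (1/q) a d (qpoch x (of_real q) d)
    (\<lambda>K. \<Sum>m\<in>{a..K}. wt q x (K - a) (m - a) * of_real ((1/q) ^ (m * d)))"
proof -
  let ?P = "\<lambda>k. of_real ((1/q) ^ k)"
  obtain r where r: "r d = qpoch x (of_real q) d"
    "\<And>n. (\<Sum>i\<le>n. wt q x n i * ?P (i * d)) = (\<Sum>s\<le>d. ?P (n * s) * r s)"
    using wt_moment[of d x] unfolding qpoly_def by auto
  have "(\<Sum>m\<in>{a..K}. wt q x (K - a) (m - a) * ?P (m * d)) =
     (\<Sum>s\<le>d. ?P (K * s) * (?P (a * d) * of_real (q ^ (a * s)) * r s))" if aK: "K \<ge> a" for K
  proof -
    obtain n where K: "K = a + n" using le_Suc_ex[OF aK] by blast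
    have e: "?P ((a + i) * d) = (?P (a * d) * ?P (i * d) :: 'a)" for i
      by (simp only: distrib_right power_add of_real_mult)
    have "(\<Sum>m\<in>{a..K}. wt q x (K - a) (m - a) * ?P (m * d)) =
      (\<Sum>i\<le>n. wt q x n i * (?P (a * d) * ?P (i * d)))"
      by (subst sum_from_base[OF aK]) (simp only: K add_diff_cancel_left' e)
    also have "\<dots> = ?P (a * d) * (\<Sum>i\<le>n. wt q x n i * ?P (i * d))"
      by (simp only: sum_distrib_left mult.left_commute)
    finally have A: "(\<Sum>m\<in>{a..K}. wt q x (K - a) (m - a) * ?P (m * d)) = \<dots>" .
    have "?P (n * s) = (?P (K * s) * of_real (q ^ (a * s)) :: 'a)" for s
      by (simp only: K distrib_right of_real_inverse_power_add)
    then have "?P (a * d) * (?P (n * s) * r s) = ?P (K * s) * (?P (a * d) * of_real (q ^ (a * s)) * r s)" for s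
      by (simp only: mult.assoc mult.left_commute)
    then show ?thesis unfolding A r(2) sum_distrib_left by (simp only:)
  qed
  moreover have "?P (a * d) * of_real (q ^ (a * d)) = (1::'a)"
    by (rule of_real_inverse_power)
  ultimately show ?thesis unfolding qpoly_def
    by (intro exI[of _ "\<lambda>s. ?P (a * d) * of_real (q ^ (a * s)) * r s"]) (simp add: r(1))
qed

text \<open>Only the top coefficient of each step contributes to the top coefficient of the whole,
  so every variable supplies its \<open>(x_i;q)_d\<close>, while the lower rows evolve as if there
  were no row above them.\<close>

lemma iter_moment:
  assumes "is_partition l"
  shows "qpoly (1/q) (l 0) d ((\<Prod>i<n. qpoch (x i) (of_real q) d) * iter q x n l g)
    (\<lambda>K. iter q x n (pcons K l) (\<lambda>k. of_real ((1/q) ^ (k 0 * d)) * g (\<lambda>i. k (Suc i))))"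
  using assms
proof (induction n arbitrary: l)
  case 0
  have "(\<Sum>s\<le>d. of_real ((1 / q) ^ (K * s)) * (if s = d then g l else 0)) = of_real ((1 / q) ^ (K * d)) * g l" for K
    by (simp add: if_distrib cong: if_cong)
  then show ?case unfolding qpoly_def
    by (intro exI[of _ "\<lambda>s. if s = d then g l else 0"]) simp
next
  case (Suc n)
  let ?P = "\<lambda>k. of_real ((1/q) ^ k)"
  let ?f = "\<lambda>k. ?P (k 0 * d) * g (\<lambda>i. k (Suc i))"
  let ?R = "\<lambda>nu. (\<Prod>i<n. qpoch (x i) (of_real q) d) * iter q x n nu g"
  let ?N = "{nu. is_partition nu \<and> interlaces nu l}"
  have "\<forall>nu\<in>?N. \<exists>r. r d = ?R nu \<and> (\<forall>K\<ge>nu 0. iter q x n (pcons K nu) ?f = (\<Sum>s\<le>d. ?P (K * s) * r s))"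
    using Suc.IH unfolding qpoly_def by blast
  from bchoice[OF this] obtain r where r: "\<And>nu. nu \<in> ?N \<Longrightarrow> r nu d = ?R nu"
    "\<And>nu K. nu \<in> ?N \<Longrightarrow> nu 0 \<le> K \<Longrightarrow> iter q x n (pcons K nu) ?f = (\<Sum>s\<le>d. ?P (K * s) * r nu s)"
    by blast
  let ?M = "\<lambda>s K. \<Sum>m\<in>{l 0..K}. wt q (x n) (K - l 0) (m - l 0) * ?P (m * s)"
  \<comment> \<open>Moments of order \<open>s < d\<close> have degree below \<open>d\<close> and add
    nothing to the top coefficient.\<close>
  have M: "qpoly (1/q) (l 0) d (if s = d then qpoch (x n) (of_real q) d else 0) (?M s)" if "s \<le> d" for s
    using that wt_moment_base[of "l 0" s "x n"] qpoly_lower[of "1/q" "l 0" s _ "?M s" d] by auto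
  have "qpoly (1/q) (l 0) d
    (\<Sum>nu\<in>?N. F_one q l nu (x n) * (\<Sum>s\<le>d. r nu s * (if s = d then qpoch (x n) (of_real q) d else 0)))
    (\<lambda>K. \<Sum>nu\<in>?N. F_one q l nu (x n) * (\<Sum>s\<le>d. r nu s * ?M s K))"
    by (intro qpoly_sum qpoly_mult M) simp
  then show ?case
  proof (rule qpoly_cong)
    fix K assume K: "l 0 \<le> K"
    have "iter q x (Suc n) (pcons K l) ?f = (\<Sum>nu\<in>?N. F_one q l nu (x n) *
      (\<Sum>m\<in>{l 0..K}. wt q (x n) (K - l 0) (m - l 0) * iter q x n (pcons m nu) ?f))"
      unfolding iter.simps branch_pcons[OF Suc.prems K] unfolding branch_def ..
    also have "\<dots> = (\<Sum>nu\<in>?N. F_one q l nu (x n) * (\<Sum>s\<le>d. r nu s * ?M s K))"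
    proof (rule sum.cong[OF refl], rule arg_cong2[of _ _ _ _ "(*)", OF refl])
      fix nu assume nu: "nu \<in> ?N"
      then have "nu 0 \<le> l 0" by (simp add: interlaces_def)
      then have "(\<Sum>m\<in>{l 0..K}. wt q (x n) (K - l 0) (m - l 0) * iter q x n (pcons m nu) ?f) =
        (\<Sum>m\<in>{l 0..K}. \<Sum>s\<le>d. wt q (x n) (K - l 0) (m - l 0) * (?P (m * s) * r nu s))"
        by (intro sum.cong refl, subst r(2)[OF nu]) (simp_all add: sum_distrib_left)
      also have "\<dots> = (\<Sum>s\<le>d. r nu s * ?M s K)"
        unfolding sum_distrib_left by (subst sum.swap) (simp only: ac_simps)
      finally show "(\<Sum>m\<in>{l 0..K}. wt q (x n) (K - l 0) (m - l 0) * iter q x n (pcons m nu) ?f) = \<dots>" .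
    qed
    finally show "iter q x (Suc n) (pcons K l) ?f = \<dots>" .
  next
    have "(\<Sum>s\<le>d. r nu s * (if s = d then qpoch (x n) (of_real q) d else 0)) = ?R nu * qpoch (x n) (of_real q) d"
      if "nu \<in> ?N" for nu
      using r(1)[OF that] by (simp add: if_distrib cong: if_cong)
    then show "(\<Prod>i<Suc n. qpoch (x i) (of_real q) d) * iter q x (Suc n) l g = 
      (\<Sum>nu\<in>?N. F_one q l nu (x n) * (\<Sum>s\<le>d. r nu s * (if s = d then qpoch (x n) (of_real q) d else 0)))"
      by (simp add: branch_def sum_distrib_left mult.assoc mult.left_commute mult.commute)
  qed
qed

text \<open>Identifies the leading factor in \<open>iter_moment\<close> as a skew function, on which
  a specialization can be evaluated.\<close>

lemma F_fin_row:
  fixes x :: "nat \<Rightarrow> 'a::{comm_ring_1, real_algebra_1}"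
  shows "F_fin q x n (pcons d empty_partition) (pcons d empty_partition) = (\<Prod>i<n. qpoch (x i) (of_real q) d)"
proof (induction n)
  case (Suc n)
  have "F_fin q x (Suc n) (pcons d empty_partition) (pcons d empty_partition) = 
    (\<Sum>m\<in>{0..d}. wt q (x n) d m * F_fin q x n (pcons m empty_partition) (pcons d empty_partition))"
    unfolding F_fin_Suc by (subst branch_pcons) simp_all
  also have "\<dots> = (\<Sum>m\<in>{d}. wt q (x n) d m * F_fin q x n (pcons m empty_partition) (pcons d empty_partition))"
    by (intro sum.mono_neutral_right) (auto simp: F_fin_eq_0)
  finally show ?case by (simp add: wt_self[OF q0 q1] Suc mult.commute)
qed simp

text \<open>On the average of \<open>q^-(k r)\<close>, a step acts as if the row index jumped from
  \<open>r\<close> to \<open>r + 1\<close> with weight \<open>x\<close>.\<close>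

lemma branch_moment:
  fixes x :: "'a::{comm_ring_1, real_algebra_1}"
  assumes "is_partition l"
  shows "branch q x l (\<lambda>k. of_real ((1/q) ^ k r)) =
    (1 - x) * of_real ((1/q) ^ l r) + x * of_real ((1/q) ^ l (Suc r))"
  using assms
proof (induction arbitrary: r rule: partition_induct)
  case empty
  then show ?case by (simp add: empty_partition_apply[of r])
next
  case (pcons K l)
  let ?P = "\<lambda>k. of_real ((1/q) ^ k) :: 'a"
  show ?case
  proof (cases r)
    case 0
    have "(\<Sum>m\<in>{l 0..K}. wt q x (K - l 0) (m - l 0) * ?P m) = ?P (l 0) * (\<Sum>i\<le>K - l 0. wt q x (K - l 0) i * ?P (i * Suc 0))"
      unfolding sum_from_base[OF pcons.hyps(2)] by (simp add: sum_distrib_left power_add mult.left_commute)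
    also have "(\<Sum>i\<le>K - l 0. wt q x (K - l 0) i * ?P (i * Suc 0)) = 1 + (?P (K - l 0) - 1) * (1 - x)"
      unfolding wt_moment_Suc by (simp add: sum_wt[OF q0 q1])
    also have "?P (l 0) * \<dots> = (1 - x) * ?P K + x * ?P (l 0)"
    proof -
      have "?P K = ?P (l 0) * ?P (K - l 0)" using pcons.hyps by (simp flip: of_real_mult power_add)
      then show ?thesis by (simp add: algebra_simps)
    qed
    finally show ?thesis using pcons.hyps by (simp add: 0 branch_pcons branch_const)
  next
    case (Suc r')
    have "(\<Sum>m\<in>{l 0..K}. wt q x (K - l 0) (m - l 0) * c) = c" for c
      unfolding sum_from_base[OF pcons.hyps(2)] by (simp add: sum_distrib_right[symmetric] sum_wt[OF q0 q1])
    then show ?thesis using pcons by (simp add: Suc branch_pcons)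
  qed
qed

text \<open>Only the lowest row of a column exceeds the row below it, so a step removes at most one
  box.\<close>

lemma branch_column:
  fixes x :: "'a::{comm_ring_1, real_algebra_1}"
  shows "branch q x (column_partition (Suc j)) f =
    (1 - x) * f (column_partition (Suc j)) + x * f (column_partition j)"
proof (induction j arbitrary: f)
  case 0
  show ?case
    using q1 by (simp add: column_Suc branch_pcons wt_def atLeast0AtMost atMost_Suc qpoch_Suc)
next
  case (Suc j)
  have "branch q x (column_partition (Suc (Suc j))) f = branch q x (column_partition (Suc j)) (\<lambda>nu. f (pcons 1 nu))"
    unfolding column_Suc[of "Suc j"] by (subst branch_pcons) (simp_all add: column_Suc wt_0[OF q0 q1])
  then show ?case unfolding Suc column_Suc[symmetric] .
qed

lemma F_fin_column:
  fixes x :: "nat \<Rightarrow> 'a::{comm_ring_1, real_algebra_1}"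
  shows "F_fin q x (Suc n) (column_partition (Suc j)) empty_partition =
    (1 - x n) * F_fin q x n (column_partition (Suc j)) empty_partition +
    x n * F_fin q x n (column_partition j) empty_partition"
  by (simp add: F_fin_Suc branch_column)

lemma F_fin_empty: "F_fin q x n empty_partition empty_partition = 1"
  by (induction n) (simp_all add: F_fin_Suc)

text \<open>By \<open>branch_moment\<close> the row index makes independent jumps with weights
  \<open>x i\<close>; by \<open>F_fin_column\<close> the function of a column of length
  \<open>j\<close> is the weight of at least \<open>j\<close> jumps. The formula is the average over
  the number of jumps after Abel summation.\<close>

lemma iter_first_moment:
  fixes x :: "nat \<Rightarrow> 'a::{comm_ring_1, real_algebra_1}"
  assumes "is_partition l" "l (r + J) = 0"
  shows "iter q x n l (\<lambda>k. of_real ((1/q) ^ k r)) = of_real ((1/q) ^ l r) -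
    (\<Sum>j<J. F_fin q x n (column_partition (Suc j)) empty_partition *
       (of_real ((1/q) ^ l (r + j)) - of_real ((1/q) ^ l (r + Suc j))))"
  using assms
proof (induction n arbitrary: l)
  case 0
  have "column_partition (Suc j) \<noteq> empty_partition" for j
    by (metis One_nat_def column_Suc empty_partition_simps(1) nat.distinct(1) pcons_simps(1))
  then show ?case by simp
next
  case (Suc n)
  let ?h = "\<lambda>r k. of_real ((1/q) ^ k r) :: 'a"
  let ?E = "\<lambda>j. F_fin q x n (column_partition j) empty_partition"
  define D where "D j = ?h (r + j) l - ?h (r + Suc j) l" for j
  have z: "nu (r + J) = 0" if "interlaces nu l" for nu
    using that Suc.prems(2) by (metis interlaces_def le_zero_eq)
  have "iter q x (Suc n) l (?h r) =
    branch q (x n) l (\<lambda>nu. ?h r nu - (\<Sum>j<J. ?E (Suc j) * (?h (r + j) nu - ?h (r + Suc j) nu)))"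
    unfolding iter.simps by (rule branch_cong) (rule Suc.IH, auto intro: z)
  also have "\<dots> = (1 - x n) * ?h r l + x n * ?h (Suc r) l -
     (\<Sum>j<J. ?E (Suc j) * ((1 - x n) * D j + x n * D (Suc j)))"
    unfolding branch_diff branch_sum branch_mult branch_moment[OF Suc.prems(1)] D_def
    by (simp add: algebra_simps)
  also have "\<dots> = ?h r l - (\<Sum>j<J. ((1 - x n) * ?E (Suc j)) * D j) - x n * (D 0 + (\<Sum>j<J. ?E (Suc j) * D (Suc j)))"
    by (simp add: D_def sum_distrib_left sum_subtractf sum.distrib algebra_simps)
  \<comment> \<open>The index is shifted by one: the top term vanishes because both rows in
    \<open>D J\<close> are empty, and \<open>?E 0 = 1\<close> supplies \<open>D 0\<close>.\<close>
  also have "D 0 + (\<Sum>j<J. ?E (Suc j) * D (Suc j)) = (\<Sum>j<J. ?E j * D j)"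
  proof -
    have "l (r + Suc J) = 0" using partition_antimono[OF Suc.prems(1), of "r + J" "r + Suc J"] Suc.prems(2) by simp
    then have "D J = 0" using Suc.prems(2) by (simp add: D_def)
    then have "(\<Sum>j<J. ?E j * D j) = (\<Sum>j<Suc J. ?E j * D j)" by simp
    also have "\<dots> = D 0 + (\<Sum>j<J. ?E (Suc j) * D (Suc j))"
      by (subst sum.lessThan_Suc_shift) (simp add: F_fin_empty)
    finally show ?thesis by simp
  qed
  finally show ?case
    by (simp add: F_fin_column D_def sum_distrib_left sum_subtractf sum.distrib algebra_simps)
qed

text \<open>The lowest row moves independently of the rows above it, whose weights sum to 1.\<close>

lemma branch_last:
  fixes x :: "'a::{comm_ring_1, real_algebra_1}"
  assumes "is_partition l" "l (Suc M) = 0"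
  shows "branch q x l (\<lambda>k. g (k M)) = branch q x (pcons (l M) empty_partition) (\<lambda>k. g (k 0))"
  using assms
proof (induction M arbitrary: l)
  case 0
  have "l = pcons (l 0) empty_partition"
  proof (rule ext)
    fix i show "l i = pcons (l 0) empty_partition i"
      using partition_antimono[OF 0(1), of "Suc 0" i] 0(2) by (cases i) (auto simp: empty_partition_apply)
  qed
  then show ?case by metis
next
  case (Suc M)
  define l' where "l' = (\<lambda>i. l (Suc i))"
  have l': "is_partition l'" "l' 0 \<le> l 0" "l = pcons (l 0) l'"
    using Suc.prems partition_antimono[of l 0 1] unfolding l'_def
    by (simp_all add: partition_tl pcons_hd_tl)
  have c: "(\<Sum>m\<in>{l' 0..l 0}. wt q x (l 0 - l' 0) (m - l' 0) * c) = c" for c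
    unfolding sum_from_base[OF l'(2)] by (simp add: sum_distrib_right[symmetric] sum_wt[OF q0 q1])
  have "branch q x l (\<lambda>k. g (k (Suc M))) = branch q x l' (\<lambda>k. g (k M))"
    by (subst l'(3), subst branch_pcons[OF l'(1,2)]) (simp add: c)
  also have "\<dots> = branch q x (pcons (l' M) empty_partition) (\<lambda>k. g (k 0))"
    by (rule Suc.IH) (use l' Suc.prems in \<open>simp_all add: l'_def\<close>)
  finally show ?case by (simp add: l'_def)
qed

lemma iter_last:
  fixes x :: "nat \<Rightarrow> 'a::{comm_ring_1, real_algebra_1}"
  assumes "is_partition l" "l (Suc M) = 0"
  shows "iter q x n l (\<lambda>k. g (k M)) = iter q x n (pcons (l M) empty_partition) (\<lambda>k. g (k 0))"
  using assms
proof (induction n arbitrary: l)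
  case (Suc n)
  let ?G = "\<lambda>a. iter q x n (pcons a empty_partition) (\<lambda>k. g (k 0))"
  have z: "nu (Suc M) = 0" if "interlaces nu l" for nu
    using that Suc.prems(2) by (metis interlaces_def le_zero_eq)
  have "iter q x (Suc n) l (\<lambda>k. g (k M)) = branch q (x n) l (\<lambda>nu. ?G (nu M))"
    unfolding iter.simps by (rule branch_cong) (rule Suc.IH, auto intro: z)
  also have "\<dots> = branch q (x n) (pcons (l M) empty_partition) (\<lambda>nu. ?G (nu 0))"
    by (rule branch_last[OF Suc.prems])
  also have "\<dots> = branch q (x n) (pcons (l M) empty_partition) (\<lambda>nu. iter q x n nu (\<lambda>k. g (k 0)))"
  proof (rule branch_cong)
    fix nu assume nu: "is_partition nu" "interlaces nu (pcons (l M) empty_partition)"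
    then have "(\<lambda>i. nu (Suc i)) = empty_partition"
      using interlaces_tl(1)[OF nu(2)] by (simp add: interlaces_def fun_eq_iff empty_partition_apply)
    then have "nu = pcons (nu 0) empty_partition" using pcons_hd_tl[of nu] by simp
    then show "?G (nu 0) = iter q x n nu (\<lambda>k. g (k 0))" by simp
  qed
  finally show ?case by simp
qed simp

end


section \<open>Complements in a rectangle\<close>

definition gap_prod :: "real \<Rightarrow> nat \<Rightarrow> (nat \<Rightarrow> nat) \<Rightarrow> real" where
  "gap_prod q n l = (\<Prod>r<n. qpoch q q (l r - l (Suc r)))"

lemma less_conj_partition_iff:
  assumes "is_partition l"
  shows "r < conj_partition l j \<longleftrightarrow> j < l r"
proof -
  define k where "k i = (if j < l i then l i else 0)" for i
  have "is_partition k"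
    unfolding is_partition_def
  proof
    show "antimono k"
      unfolding antimono_def k_def using partition_antimono[OF assms] by (auto intro: less_le_trans)
    show "finite {i. k i \<noteq> 0}"
      using assms by (auto simp: is_partition_def k_def intro: finite_subset[of _ "{i. l i \<noteq> 0}"])
  qed
  moreover have "{i. k i \<noteq> 0} = {i. j < l i}" by (auto simp: k_def)
  ultimately have "{i. j < l i} = {..<card {i. j < l i}}"
    using partition_support[of k] by (simp add: plength_def)
  then show ?thesis unfolding conj_partition_def by auto
qed

lemma part_mult_conj:
  assumes "is_partition l"
  shows "part_mult (Suc i) (conj_partition l) = l i - l (Suc i)"
proof -
  have "conj_partition l j = Suc i \<longleftrightarrow> j \<in> {l (Suc i)..<l i}" for j
    using less_conj_partition_iff[OF assms, of i j] less_conj_partition_iff[OF assms, of "Suc i" j]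
    by auto
  then have "{r. conj_partition l r = Suc i} = {l (Suc i)..<l i}" by blast
  then show ?thesis unfolding part_mult_def by simp
qed

text \<open>Columns of length \<open>i + 1\<close> are counted by the gap
  \<open>l i - l (Suc i)\<close>, and zero gaps give factors 1.\<close>

lemma conj_mult_prod_eq:
  assumes "is_partition l" "l n = 0"
  shows "conj_mult_prod q l = gap_prod q n l"
proof -
  let ?S = "{i. 1 \<le> i \<and> part_mult i (conj_partition l) \<noteq> 0}"
  have sub: "?S \<subseteq> Suc ` {..<n}"
  proof
    fix i assume i: "i \<in> ?S"
    then obtain k where k: "i = Suc k" by (cases i) auto
    have "\<not> n \<le> k"
      using i part_mult_conj[OF assms(1), of k] partition_antimono[OF assms(1), of n k] assms(2)
      by (auto simp: k)
    then show "i \<in> Suc ` {..<n}" by (simp add: k)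
  qed
  have "conj_mult_prod q l = (\<Prod>i\<in>Suc ` {..<n}. qpoch q q (part_mult i (conj_partition l)))"
    unfolding conj_mult_prod_def using sub by (intro prod.mono_neutral_left) auto
  then show ?thesis
    by (simp add: prod.reindex part_mult_conj[OF assms(1)] gap_prod_def)
qed

text \<open>The complement of \<open>l\<close> in the rectangle with \<open>Suc M\<close> rows of length \<open>K\<close>, rotated by 180 degrees.\<close>

definition box_compl :: "nat \<Rightarrow> nat \<Rightarrow> (nat \<Rightarrow> nat) \<Rightarrow> nat \<Rightarrow> nat" where
  "box_compl K M l s = K - pcons K l (Suc M - s)"

lemma box_compl_Suc: "box_compl K M l (Suc M) = 0"
  by (simp add: box_compl_def)

lemma box_compl_le: "box_compl K M l s \<le> K"
  by (simp add: box_compl_def)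

lemma box_compl_last: "box_compl K M l M = K - l 0"
  by (simp add: box_compl_def Suc_diff_le)

lemma box_compl_0: "box_compl K M l 0 = K - l M"
  by (simp add: box_compl_def)

lemma is_partition_box_compl:
  assumes "is_partition l" "l 0 \<le> K"
  shows "is_partition (box_compl K M l)"
  unfolding is_partition_def
proof
  have p: "is_partition (pcons K l)" using assms by simp
  show "antimono (box_compl K M l)"
    unfolding antimono_def box_compl_def
    by (intro allI impI diff_le_mono2 partition_antimono[OF p]) simp
  have "box_compl K M l i = 0" if "M < i" for i
    using that by (simp add: box_compl_def)
  then have "{i. box_compl K M l i \<noteq> 0} \<subseteq> {..M}"
    by (metis (mono_tags, lifting) atMost_iff mem_Collect_eq not_le subsetI)
  then show "finite {i. box_compl K M l i \<noteq> 0}" by (rule finite_subset) simp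
qed

lemma box_compl_box_compl:
  assumes "is_partition l" "l 0 \<le> K" "l (Suc M) = 0"
  shows "box_compl K M (box_compl K M l) = l"
proof
  fix s
  have K: "l s \<le> K" using partition_antimono[OF assms(1), of 0 s] assms(2) by simp
  show "box_compl K M (box_compl K M l) s = l s"
  proof (cases "s \<le> M")
    case True
    then have "Suc M - s = Suc (M - s)" "Suc M - (M - s) = Suc s" by auto
    then show ?thesis using K by (simp add: box_compl_def)
  next
    case False
    then have "l s = 0" using partition_antimono[OF assms(1), of "Suc M" s] assms(3) by simp
    moreover have "Suc M - s = 0" using False by simp
    ultimately show ?thesis by (simp add: box_compl_def)
  qed
qed

lemma box_compl_antimono: "partition_le a b \<Longrightarrow> partition_le (box_compl K M b) (box_compl K M a)"
  using partition_le_pcons[of K a K b] by (auto simp: partition_le_def box_compl_def intro: diff_le_mono2)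

lemma box_compl_interlaces:
  assumes "interlaces a b" "b 0 \<le> K"
  shows "interlaces (box_compl K M b) (box_compl K M a)"
  unfolding interlaces_def
proof (intro allI conjI)
  have i: "interlaces (pcons K a) (pcons K b)" using assms by simp
  fix s
  show "box_compl K M b s \<le> box_compl K M a s"
    using i by (auto simp: interlaces_def box_compl_def intro: diff_le_mono2)
  show "box_compl K M a (Suc s) \<le> box_compl K M b s"
  proof (cases "s \<le> M")
    case True
    then have "Suc M - s = Suc (M - s)" by simp
    then show ?thesis using i by (auto simp: interlaces_def box_compl_def simp del: pcons_simps intro: diff_le_mono2)
  next
    case False
    then show ?thesis by (simp add: box_compl_def)
  qed
qed

context
  fixes q :: real
  assumes q0: "0 < q" and q1: "q < 1"
begin

lemma gap_prod_nz [simp]: "gap_prod q n l \<noteq> 0"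
  by (simp add: gap_prod_def qpoch_q_nz[OF q0 q1])

text \<open>Both sides consist of factors \<open>A\<close> for kept and \<open>B\<close> for removed
  boxes, with the index of \<open>B\<close> shifted by one. Only the numerators of the q-binomials
  differ, and the gap products correct these.\<close>

lemma F_one_box_compl:
  fixes x :: "'a::{comm_ring_1, real_algebra_1}"
  assumes l: "is_partition l" "l 0 \<le> K" "l M = 0" and i: "interlaces mu l"
  shows "of_real (gap_prod q (Suc M) (pcons K mu) / gap_prod q (Suc M) (pcons K l)) *
      F_one q (pcons K l) (pcons K mu) x =
    F_one q (box_compl K M mu) (box_compl K M l) x"
proof -
  let ?l = "pcons K l" and ?m = "pcons K mu"
  have mu: "is_partition mu" "mu 0 \<le> K" "mu M = 0"
    using interlaces_partition[OF l(1) i] i l by (auto simp: interlaces_def) (metis le_trans, metis le_zero_eq)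
  have I: "interlaces ?m ?l" using i l by simp
  have le: "?l (Suc r) \<le> ?m r" "?m r \<le> ?l r" for r
    using I by (auto simp: interlaces_def simp del: pcons_simps)
  have mm: "?m (Suc r) \<le> ?m r" "?l r \<le> K" "?m r \<le> K" for r
    using partition_antimono[of ?m r "Suc r"] partition_antimono[of ?m 0 r] partition_antimono[of ?l 0 r] mu l by simp_all
  define A where "A r = qpoch x (of_real q) (?m r - ?l (Suc r)) * of_real (1 / qpoch q q (?m r - ?l (Suc r)))" for r
  define B where "B r = x ^ (?l r - ?m r) * of_real (1 / qpoch q q (?l r - ?m r))" for r
  have wl: "wt q x (?l r - ?l (Suc r)) (?m r - ?l (Suc r)) = of_real (qpoch q q (?l r - ?l (Suc r))) * (A r * B r)" for r
  proof -
    have "?l r - ?l (Suc r) - (?m r - ?l (Suc r)) = ?l r - ?m r" using le[of r] by simp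
    then show ?thesis using le[of r] unfolding wt_def A_def B_def
      by (simp add: diff_le_mono divide_inverse del: pcons_simps)
  qed
  have wm: "wt q x (?m r - ?m (Suc r)) (?m r - ?l (Suc r)) = of_real (qpoch q q (?m r - ?m (Suc r))) * (A r * B (Suc r))" for r
  proof -
    have "?m r - ?m (Suc r) - (?m r - ?l (Suc r)) = ?l (Suc r) - ?m (Suc r)"
      using le[of r] le[of "Suc r"] by simp
    then show ?thesis using le[of "Suc r"] unfolding wt_def A_def B_def
      by (simp add: diff_le_mono2 divide_inverse del: pcons_simps)
  qed
  \<comment> \<open>Both first rows are \<open>K\<close> and both rows with index
    \<open>Suc M\<close> are empty, so the shift does not change the product of the
    \<open>B\<close>.\<close>
  have "B 0 = 1" "B (Suc M) = 1" using mu l by (simp_all add: B_def)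
  then have BB: "(\<Prod>r<Suc M. B (Suc r)) = (\<Prod>r<Suc M. B r)"
    using prod.lessThan_Suc_shift[of B "Suc M"] by simp
  have "F_one q (box_compl K M mu) (box_compl K M l) x =
    (\<Prod>s<Suc M. wt q x (box_compl K M mu s - box_compl K M mu (Suc s)) (box_compl K M l s - box_compl K M mu (Suc s)))"
    by (intro F_one_prod is_partition_box_compl box_compl_Suc box_compl_interlaces i mu l)
  also have "\<dots> = (\<Prod>r<Suc M. wt q x (?m r - ?m (Suc r)) (?m r - ?l (Suc r)))"
  proof (rule prod.reindex_bij_witness[of _ "\<lambda>r. M - r" "\<lambda>s. M - s"])
    fix s assume s: "s \<in> {..<Suc M}"
    then have e: "Suc M - s = Suc (M - s)" "Suc M - Suc s = M - s" by auto
    show "wt q x (?m (M - s) - ?m (Suc (M - s))) (?m (M - s) - ?l (Suc (M - s))) =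
      wt q x (box_compl K M mu s - box_compl K M mu (Suc s)) (box_compl K M l s - box_compl K M mu (Suc s))"
      unfolding box_compl_def e using mm[of "M - s"] mm(2)[of "Suc (M - s)"] le[of "M - s"]
      by (intro arg_cong2[of _ _ _ _ "wt q x"]) (simp_all del: pcons_simps)
  qed auto
  also have "\<dots> = of_real (gap_prod q (Suc M) ?m) * ((\<Prod>r<Suc M. A r) * (\<Prod>r<Suc M. B r))"
    unfolding wm prod.distrib BB gap_prod_def of_real_prod ..
  finally have R: "F_one q (box_compl K M mu) (box_compl K M l) x = \<dots>" .
  have "F_one q ?l ?m x = (\<Prod>r<Suc M. wt q x (?l r - ?l (Suc r)) (?m r - ?l (Suc r)))"
    using l by (intro F_one_prod I) simp_all
  also have "\<dots> = of_real (gap_prod q (Suc M) ?l) * ((\<Prod>r<Suc M. A r) * (\<Prod>r<Suc M. B r))"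
    unfolding wl prod.distrib gap_prod_def of_real_prod ..
  finally have L: "F_one q ?l ?m x = \<dots>" .
  have "of_real (gap_prod q (Suc M) ?m / gap_prod q (Suc M) ?l) * of_real (gap_prod q (Suc M) ?l) = (of_real (gap_prod q (Suc M) ?m) :: 'a)"
    unfolding of_real_mult[symmetric] by simp
  then show ?thesis unfolding L R mult.assoc[symmetric] by simp
qed

text \<open>Complements reverse each step by \<open>F_one_box_compl\<close> and thereby the order of
  the variables, which \<open>F_fin_commute\<close> restores.\<close>

lemma F_fin_box_compl:
  fixes x :: "nat \<Rightarrow> 'a::{comm_ring_1, real_algebra_1}"
  assumes l: "is_partition l" "l 0 \<le> K" "l M = 0" and mu: "is_partition mu" "mu 0 \<le> K" "mu M = 0"
  shows "of_real (gap_prod q (Suc M) (pcons K mu) / gap_prod q (Suc M) (pcons K l)) *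
      F_fin q x n (pcons K l) (pcons K mu) =
    F_fin q x n (box_compl K M mu) (box_compl K M l)"
  using l
proof (induction n arbitrary: l)
  case 0
  have z: "k (Suc M) = 0" if "is_partition k" "k M = 0" for k
    using partition_antimono[OF that(1), of M "Suc M"] that(2) by simp
  have "box_compl K M mu = box_compl K M l \<longleftrightarrow> l = mu"
    using box_compl_box_compl[of l K M] box_compl_box_compl[of mu K M] z 0 mu by metis
  then show ?case by simp
next
  case (Suc n)
  let ?c = "box_compl K M"
  let ?N = "{nu. is_partition nu \<and> interlaces nu l}"
  let ?G = "\<lambda>l. gap_prod q (Suc M) (pcons K l)"
  have Np: "nu 0 \<le> K" "nu M = 0" "nu (Suc M) = 0" if "nu \<in> ?N" for nu
    using that Suc.prems by (auto simp: interlaces_def) (metis le_trans, (metis le_zero_eq)+)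
  have muS: "mu (Suc M) = 0" "l (Suc M) = 0"
    using partition_antimono[of _ M "Suc M"] mu Suc.prems by (metis le_SucI le_refl le_zero_eq)+
  have cmu: "is_partition (?c mu)" by (rule is_partition_box_compl[OF mu(1,2)])
  have "F_fin q x (Suc n) (pcons K l) (pcons K mu) = branch q (x n) l (\<lambda>nu. \<Sum>m\<in>{l 0..K}.
      wt q (x n) (K - l 0) (m - l 0) * F_fin q x n (pcons m nu) (pcons K mu))"
    unfolding F_fin_Suc branch_pcons[OF Suc.prems(1,2)] ..
  \<comment> \<open>The target has first row \<open>K\<close>, so the first row may not shrink and
    only \<open>m = K\<close> contributes.\<close>
  also have "\<dots> = branch q (x n) l (\<lambda>nu. wt q (x n) (K - l 0) (K - l 0) * F_fin q x n (pcons K nu) (pcons K mu))"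
  proof (rule branch_cong)
    fix nu
    have "(\<Sum>m\<in>{l 0..K}. wt q (x n) (K - l 0) (m - l 0) * F_fin q x n (pcons m nu) (pcons K mu)) =
      (\<Sum>m\<in>{K}. wt q (x n) (K - l 0) (m - l 0) * F_fin q x n (pcons m nu) (pcons K mu))"
      using Suc.prems by (intro sum.mono_neutral_right) (auto simp: F_fin_eq_0)
    then show "(\<Sum>m\<in>{l 0..K}. wt q (x n) (K - l 0) (m - l 0) * F_fin q x n (pcons m nu) (pcons K mu)) =
      wt q (x n) (K - l 0) (K - l 0) * F_fin q x n (pcons K nu) (pcons K mu)" by simp
  qed
  also have "\<dots> = (\<Sum>nu\<in>?N. F_one q (pcons K l) (pcons K nu) (x n) * F_fin q x n (pcons K nu) (pcons K mu))"
    unfolding branch_def using Suc.prems by (intro sum.cong) (simp_all add: F_one_pcons mult.assoc mult.left_commute)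
  finally have "of_real (?G mu / ?G l) * F_fin q x (Suc n) (pcons K l) (pcons K mu) = 
     (\<Sum>nu\<in>?N. of_real (?G mu / ?G l) * (F_one q (pcons K l) (pcons K nu) (x n) * F_fin q x n (pcons K nu) (pcons K mu)))"
    by (simp only: sum_distrib_left)
  also have "\<dots> = (\<Sum>nu\<in>?N. F_one q (?c nu) (?c l) (x n) * F_fin q x n (?c mu) (?c nu))"
  proof (rule sum.cong[OF refl])
    fix nu assume nu: "nu \<in> ?N"
    have "of_real (?G mu / ?G l) = (of_real (?G nu / ?G l) * of_real (?G mu / ?G nu) :: 'a)"
      unfolding of_real_mult[symmetric] by simp
    then have "of_real (?G mu / ?G l) * (F_one q (pcons K l) (pcons K nu) (x n) * F_fin q x n (pcons K nu) (pcons K mu)) = 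
      (of_real (?G nu / ?G l) * F_one q (pcons K l) (pcons K nu) (x n)) * (of_real (?G mu / ?G nu) * F_fin q x n (pcons K nu) (pcons K mu))"
      by (simp only: ac_simps)
    then show "of_real (?G mu / ?G l) * (F_one q (pcons K l) (pcons K nu) (x n) * F_fin q x n (pcons K nu) (pcons K mu)) =
      F_one q (?c nu) (?c l) (x n) * F_fin q x n (?c mu) (?c nu)"
      using nu Suc.prems Np[OF nu] by (simp only: F_one_box_compl Suc.IH mem_Collect_eq)
  qed
  \<comment> \<open>The dropped terms vanish; on the remaining \<open>nu\<close> the complement is a
    bijection onto the partitions inside the complement of \<open>mu\<close> that occur in the next
    sum.\<close>
  also have "\<dots> = (\<Sum>nu | nu \<in> ?N \<and> partition_le mu nu. F_one q (?c nu) (?c l) (x n) * F_fin q x n (?c mu) (?c nu))"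
  proof (rule sum.mono_neutral_right)
    show "\<forall>nu\<in>?N - {nu. nu \<in> ?N \<and> partition_le mu nu}. F_one q (?c nu) (?c l) (x n) * F_fin q x n (?c mu) (?c nu) = 0"
    proof
      fix nu assume nu: "nu \<in> ?N - {nu. nu \<in> ?N \<and> partition_le mu nu}"
      have "\<not> partition_le (?c nu) (?c mu)"
      proof
        assume "partition_le (?c nu) (?c mu)"
        then have "partition_le (?c (?c mu)) (?c (?c nu))" by (rule box_compl_antimono)
        then show False using nu Np[of nu] mu muS by (simp add: box_compl_box_compl)
      qed
      then show "F_one q (?c nu) (?c l) (x n) * F_fin q x n (?c mu) (?c nu) = 0" by (simp add: F_fin_eq_0)
    qed
  qed (use finite_interlaces[OF Suc.prems(1)] in auto)
  also have "\<dots> = (\<Sum>k | k \<in> subparts (?c mu) \<and> interlaces (?c l) k. F_one q k (?c l) (x n) * F_fin q x n (?c mu) k)"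
  proof (rule sum.reindex_bij_witness[of _ ?c ?c])
    fix nu assume "nu \<in> {nu. nu \<in> ?N \<and> partition_le mu nu}"
    then show "?c (?c nu) = nu" "?c nu \<in> {k. k \<in> subparts (?c mu) \<and> interlaces (?c l) k}"
      using Np[of nu] Suc.prems
      by (auto simp: box_compl_box_compl subparts_def is_partition_box_compl box_compl_antimono box_compl_interlaces)
  next
    fix k assume "k \<in> {k. k \<in> subparts (?c mu) \<and> interlaces (?c l) k}"
    then have k: "is_partition k" "partition_le k (?c mu)" "interlaces (?c l) k" by (auto simp: subparts_def)
    then have k0: "k 0 \<le> K" "k (Suc M) = 0"
      using box_compl_le[of K M mu] box_compl_Suc[of K M mu] by (auto simp: partition_le_def) (metis le_trans, metis le_zero_eq)
    show "?c (?c k) = k" by (rule box_compl_box_compl[OF k(1) k0])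
    have "interlaces (?c k) (?c (?c l))" by (rule box_compl_interlaces[OF k(3) k0(1)])
    moreover have "partition_le (?c (?c mu)) (?c k)" by (rule box_compl_antimono[OF k(2)])
    ultimately show "?c k \<in> {nu. nu \<in> ?N \<and> partition_le mu nu}"
      using k k0 mu muS Suc.prems by (simp add: box_compl_box_compl is_partition_box_compl)
  qed auto
  also have "\<dots> = (\<Sum>k\<in>subparts (?c mu). F_fin q x n (?c mu) k * F_one q k (?c l) (x n))"
    using finite_subparts[OF cmu] by (intro sum.mono_neutral_cong_left) (auto simp: F_one_def)
  also have "\<dots> = F_fin q x (Suc n) (?c mu) (?c l)"
    unfolding F_fin_commute[OF q0 q1 cmu] F_fin_Suc ..
  finally show ?case .
qed

end


section \<open>Countably many variables\<close>

text \<open>Equality after setting all variables from index \<open>N\<close> on to 0. Identities for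
  \<open>F_fin\<close> with every \<open>N\<close> become identities of power series through
  \<open>agree_eqI\<close>.\<close>

definition agree :: "nat \<Rightarrow> pseries \<Rightarrow> pseries \<Rightarrow> bool" where
  "agree N f g \<longleftrightarrow> (\<forall>m. Poly_Mapping.keys m \<subseteq> {..<N} \<longrightarrow> coeff_ps f m = coeff_ps g m)"

lemma agree_refl: "agree N f f"
  and agree_sym: "agree N f g \<Longrightarrow> agree N g f"
  and agree_trans: "agree N f g \<Longrightarrow> agree N g h \<Longrightarrow> agree N f h"
  by (simp_all add: agree_def)

lemma agree_eqI:
  assumes "\<And>N. agree N f g"
  shows "f = g"
proof (rule pseries_eqI)
  fix m :: "nat \<Rightarrow>\<^sub>0 nat"
  obtain N where "Poly_Mapping.keys m \<subseteq> {..<N}"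
    using finite_nat_iff_bounded[of "Poly_Mapping.keys m"] by auto
  then show "coeff_ps f m = coeff_ps g m" using assms by (simp add: agree_def)
qed

lemma agree_add: "agree N f g \<Longrightarrow> agree N f' g' \<Longrightarrow> agree N (f + f') (g + g')"
  by (simp add: agree_def plus_pseries.rep_eq)

lemma agree_diff: "agree N f g \<Longrightarrow> agree N f' g' \<Longrightarrow> agree N (f - f') (g - g')"
  by (simp add: agree_def minus_pseries.rep_eq)

lemma agree_scaleR: "agree N f g \<Longrightarrow> agree N (c *\<^sub>R f) (c *\<^sub>R g)"
  by (simp add: agree_def scaleR_pseries.rep_eq)

lemma agree_sum: "(\<And>i. i \<in> A \<Longrightarrow> agree N (f i) (g i)) \<Longrightarrow> agree N (\<Sum>i\<in>A. f i) (\<Sum>i\<in>A. g i)"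
  by (induction A rule: infinite_finite_induct) (simp_all add: agree_refl agree_add)

lemma agree_mult:
  assumes "agree N f g" "agree N f' g'"
  shows "agree N (f * f') (g * g')"
  unfolding agree_def times_pseries.rep_eq
proof (intro allI impI sum.cong refl)
  fix m :: "nat \<Rightarrow>\<^sub>0 nat" and z
  assume m: "Poly_Mapping.keys m \<subseteq> {..<N}" and z: "z \<in> splits m"
  obtain a b where ab: "z = (a, b)" "a + b = m" using z by (auto simp: splits_def)
  then have "Poly_Mapping.keys a \<subseteq> Poly_Mapping.keys m" "Poly_Mapping.keys b \<subseteq> Poly_Mapping.keys m"
    by (auto simp: in_keys_iff lookup_add)
  then show "(case z of (a, b) \<Rightarrow> coeff_ps f a * coeff_ps f' b) = (case z of (a, b) \<Rightarrow> coeff_ps g a * coeff_ps g' b)"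
    using assms m by (simp add: agree_def ab)
qed

lemma coeff_ps_sum: "coeff_ps (\<Sum>i\<in>A. f i) m = (\<Sum>i\<in>A. coeff_ps (f i) m)"
  by (induction A rule: infinite_finite_induct)
     (simp_all add: zero_pseries.rep_eq plus_pseries.rep_eq)

lemma F_one_of_real:
  "F_one q l mu (of_real y :: 'a::{comm_ring_1, real_algebra_1}) = of_real (F_one q l mu y)"
proof -
  have "qpoch (of_real y) (of_real q) k = (of_real (qpoch y q k) :: 'a)" for k
    by (simp add: qpoch_def)
  then show ?thesis
    by (simp only: F_one_def if_distrib[of of_real] of_real_mult of_real_power of_real_prod of_real_0
      of_real_eq_id id_apply)
qed

lemma subparts_row: "subparts (pcons b empty_partition) = (\<lambda>a. pcons a empty_partition) ` {..b}"
proof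
  show "subparts (pcons b empty_partition) \<subseteq> (\<lambda>a. pcons a empty_partition) ` {..b}"
  proof
    fix k assume k: "k \<in> subparts (pcons b empty_partition)"
    then have "partition_le (pcons (k 0) (\<lambda>i. k (Suc i))) (pcons b empty_partition)"
      by (simp add: subparts_def pcons_hd_tl)
    then have "k 0 \<le> b" "partition_le (\<lambda>i. k (Suc i)) empty_partition"
      unfolding partition_le_pcons by simp_all
    moreover from this(2) have "(\<lambda>i. k (Suc i)) = empty_partition"
      by (simp add: partition_le_def fun_eq_iff empty_partition_apply)
    ultimately have "k = pcons (k 0) empty_partition" "k 0 \<in> {..b}"
      using pcons_hd_tl[of k] by simp_all
    then show "k \<in> (\<lambda>a. pcons a empty_partition) ` {..b}"
      by (rule image_eqI)
  qed
  show "(\<lambda>a. pcons a empty_partition) ` {..b} \<subseteq> subparts (pcons b empty_partition)"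
    by (auto simp: subparts_def) (simp add: partition_le_def)
qed

text \<open>If \<open>d\<close> is the degree, \<open>W (K + 1) - p^d W K\<close> cancels the top
  coefficient and multiplies the others by the nonzero numbers \<open>p^t - p^d\<close>, without
  leaving the subspace.\<close>

lemma subspace_qpoly_coeffs:
  fixes r :: "nat \<Rightarrow> 'a::real_vector"
  assumes V: "subspace V" and p: "p > 1"
    and W: "\<And>K. K \<ge> a \<Longrightarrow> (\<Sum>s\<le>d. p ^ (K * s) *\<^sub>R r s) \<in> V"
  shows "s \<le> d \<Longrightarrow> r s \<in> V"
  using W
proof (induction d arbitrary: r s)
  case 0
  then show ?case by auto
next
  case (Suc d)
  let ?W = "\<lambda>K. \<Sum>s\<le>Suc d. p ^ (K * s) *\<^sub>R r s"
  have lower: "r t \<in> V" if t: "t \<le> d" for t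
  proof -
    have "(p ^ t - p ^ Suc d) *\<^sub>R r t \<in> V"
    proof (rule Suc.IH[OF t])
      fix K assume K: "a \<le> K"
      have "?W (Suc K) - p ^ Suc d *\<^sub>R ?W K \<in> V"
        using K by (intro subspace_diff subspace_scale V Suc.prems(2)) simp_all
      also have "?W (Suc K) - p ^ Suc d *\<^sub>R ?W K = (\<Sum>s\<le>Suc d. p ^ (K * s) *\<^sub>R (p ^ s - p ^ Suc d) *\<^sub>R r s)"
        unfolding scaleR_sum_right sum_subtractf[symmetric]
        by (intro sum.cong refl) (simp add: power_add algebra_simps)
      finally show "(\<Sum>s\<le>d. p ^ (K * s) *\<^sub>R (p ^ s - p ^ Suc d) *\<^sub>R r s) \<in> V" by simp
    qed
    moreover have "p ^ t - p ^ Suc d \<noteq> 0"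
      using power_strict_increasing[of t "Suc d" p] t p by simp
    ultimately show ?thesis
      using subspace_scale[OF V, of "(p ^ t - p ^ Suc d) *\<^sub>R r t" "1 / (p ^ t - p ^ Suc d)"] by simp
  qed
  show ?case
  proof (cases "s \<le> d")
    case False
    then have s: "s = Suc d" using Suc.prems(1) by simp
    have "?W a - (\<Sum>s\<le>d. p ^ (a * s) *\<^sub>R r s) \<in> V"
      by (intro subspace_diff subspace_sum subspace_scale V Suc.prems(2) lower) simp_all
    then show ?thesis
      using p s subspace_scale[OF V, of "p ^ (a * Suc d) *\<^sub>R r (Suc d)" "1 / p ^ (a * Suc d)"] by simp
  qed (rule lower)
qed

text \<open>Allows coefficients in a numerical variable to be compared. The term of lowest degree
  comes from \<open>qpoch 0 q k = 1\<close>, which leaves the q-binomials.\<close>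

lemma F_one_poly:
  "\<exists>P. (\<forall>y::real. F_one q l mu y = poly P y) \<and> (\<forall>s < psize l - psize mu. coeff P s = 0) \<and>
    (\<not> interlaces mu l \<longrightarrow> P = 0) \<and>
    (interlaces mu l \<longrightarrow> coeff P (psize l - psize mu) =
      (\<Prod>r<plength l. qpoch q q (l r - l (Suc r)) /
         (qpoch q q (l r - mu r) * qpoch q q (mu r - l (Suc r)))))"
proof (cases "interlaces mu l")
  case True
  define C where "C r = qpoch q q (l r - l (Suc r)) /
         (qpoch q q (l r - mu r) * qpoch q q (mu r - l (Suc r)))" for r
  define P where "P = (\<Prod>r<plength l. (\<Prod>i<mu r - l (Suc r). [:1, - (q ^ i):]) * [:C r:])"
  have P: "poly P y = (\<Prod>r<plength l. qpoch y q (mu r - l (Suc r)) * C r)" for y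
    unfolding P_def qpoch_def by (simp add: poly_prod mult.commute)
  have "qpoch 0 q k = 1" for k by (simp add: qpoch_def)
  then have "coeff P 0 = (\<Prod>r<plength l. C r)"
    using P[of 0] by (simp add: poly_0_coeff_0)
  then show ?thesis using True
    by (intro exI[of _ "monom 1 (psize l - psize mu) * P"])
       (simp add: F_one_def P poly_monom C_def coeff_monom_mult)
qed (auto intro!: exI[of _ 0] simp: F_one_def)

section \<open>Identities carried over to power series\<close>

context
  fixes q :: real
  assumes q0: "0 < q" and q1: "q < 1"
begin

lemma agree_F_skew: "is_partition l \<Longrightarrow> agree N (F_skew q l mu) (F_fin q Var N l mu)"
  by (simp add: agree_def coeff_F_skew[OF q0 q1])

lemma agree_iter:
  assumes "is_partition l"
  shows "agree N (\<Sum>k\<in>subparts l. c k *\<^sub>R F_skew q l k) (iter q Var N l (\<lambda>k. of_real (c k)))"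
  unfolding iter_eq_sum[OF assms]
  by (intro agree_sum) (simp add: agree_scaleR agree_F_skew[OF assms] mult.commute[of _ "of_real _"] flip: scaleR_conv_of_real)

lemma F_skew_eq_0:
  assumes "is_partition l" "\<not> partition_le mu l"
  shows "F_skew q l mu = 0"
proof (rule agree_eqI)
  fix N show "agree N (F_skew q l mu) 0"
    using agree_F_skew[OF assms(1), of N mu] by (simp add: F_fin_eq_0[OF assms(2)])
qed

lemma F_skew_empty: "FF q empty_partition = 1"
  using agree_F_skew[of empty_partition _ empty_partition]
  by (intro agree_eqI) (simp add: F_fin_empty[OF q0 q1])

lemma F_skew_sum_1:
  assumes "is_partition l"
  shows "(\<Sum>k\<in>subparts l. F_skew q l k) = 1"
  using agree_iter[OF assms, of _ "\<lambda>_. 1"] by (intro agree_eqI) (simp add: iter_1[OF q0 q1 assms])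

lemma F_skew_first_moment:
  assumes "is_partition l" "l J = 0"
  shows "(\<Sum>k\<in>subparts l. (1/q) ^ k 0 *\<^sub>R F_skew q l k) = (1/q) ^ l 0 *\<^sub>R 1 -
    (\<Sum>j<J. ((1/q) ^ l j - (1/q) ^ l (Suc j)) *\<^sub>R FF q (column_partition (Suc j)))"
proof (rule agree_eqI)
  fix N
  have "agree N (\<Sum>k\<in>subparts l. (1/q) ^ k 0 *\<^sub>R F_skew q l k) (iter q Var N l (\<lambda>k. of_real ((1/q) ^ k 0)))"
    by (rule agree_iter[OF assms(1)])
  also have "iter q Var N l (\<lambda>k. of_real ((1/q) ^ k 0)) = (1/q) ^ l 0 *\<^sub>R 1 -
    (\<Sum>j<J. ((1/q) ^ l j - (1/q) ^ l (Suc j)) *\<^sub>R F_fin q Var N (column_partition (Suc j)) empty_partition)"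
    using iter_first_moment[OF q0 q1 assms(1), of 0 J Var N] assms(2)
    by (simp add: scaleR_conv_of_real mult.commute)
  finally show "agree N (\<Sum>k\<in>subparts l. (1/q) ^ k 0 *\<^sub>R F_skew q l k) ((1/q) ^ l 0 *\<^sub>R 1 -
    (\<Sum>j<J. ((1/q) ^ l j - (1/q) ^ l (Suc j)) *\<^sub>R FF q (column_partition (Suc j))))"
    by (rule agree_trans) (intro agree_diff agree_refl agree_sum agree_scaleR agree_sym[OF agree_F_skew] column_partition)
qed

lemma F_skew_last:
  assumes "is_partition l" "l (Suc M) = 0"
  shows "(\<Sum>k | k \<in> subparts l \<and> k M = a. F_skew q l k) =
    F_skew q (pcons (l M) empty_partition) (pcons a empty_partition)"
proof (rule agree_eqI)
  fix N
  let ?g = "\<lambda>b. if b = a then 1 else (0::real)"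
  have row: "is_partition (pcons (l M) empty_partition)" by simp
  have "(\<Sum>k | k \<in> subparts l \<and> k M = a. F_skew q l k) = (\<Sum>k\<in>subparts l. ?g (k M) *\<^sub>R F_skew q l k)"
    using finite_subparts[OF assms(1)] by (intro sum.mono_neutral_cong_left) auto
  moreover have "agree N \<dots> (iter q Var N l (\<lambda>k. of_real (?g (k M))))"
    by (rule agree_iter[OF assms(1)])
  moreover have "iter q Var N l (\<lambda>k. of_real (?g (k M))) = iter q Var N (pcons (l M) empty_partition) (\<lambda>k. of_real (?g (k 0)))"
    using iter_last[OF q0 q1 assms, of Var N "\<lambda>b. of_real (?g b)"] .
  moreover have "\<dots> = F_fin q Var N (pcons (l M) empty_partition) (pcons a empty_partition)"
    unfolding F_fin_iter[of q Var N "pcons (l M) empty_partition" "pcons a empty_partition"] iter_eq_sum[OF row]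
    by (intro sum.cong refl) (auto simp: subparts_row)
  ultimately show "agree N (\<Sum>k | k \<in> subparts l \<and> k M = a. F_skew q l k)
     (F_skew q (pcons (l M) empty_partition) (pcons a empty_partition))"
    using agree_trans[OF _ agree_sym[OF agree_F_skew[OF row]]] by simp
qed

lemma F_skew_box_compl:
  assumes l: "is_partition l" "l 0 \<le> K" "l M = 0" and mu: "is_partition mu" "mu 0 \<le> K" "mu M = 0"
  shows "(gap_prod q (Suc M) (pcons K mu) / gap_prod q (Suc M) (pcons K l)) *\<^sub>R F_skew q (pcons K l) (pcons K mu) =
    F_skew q (box_compl K M mu) (box_compl K M l)"
proof (rule agree_eqI)
  fix N
  have "is_partition (pcons K l)" "is_partition (box_compl K M mu)"
    using l mu by (simp_all add: is_partition_box_compl)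
  note A = agree_F_skew[OF this(1), of N "pcons K mu"] agree_F_skew[OF this(2), of N "box_compl K M l"]
  show "agree N ((gap_prod q (Suc M) (pcons K mu) / gap_prod q (Suc M) (pcons K l)) *\<^sub>R F_skew q (pcons K l) (pcons K mu))
     (F_skew q (box_compl K M mu) (box_compl K M l))"
    using agree_trans[OF agree_scaleR[OF A(1), unfolded scaleR_conv_of_real]
        agree_sym[OF A(2), folded F_fin_box_compl[OF q0 q1 assms]]]
    by (simp only: scaleR_conv_of_real)
qed

text \<open>A finite real linear relation between skew functions for each number \<open>y\<close>,
  with coefficients polynomial in \<open>y\<close>. Comparing these coefficients shows that skew
  functions lie in the span.\<close>

lemma F_skew_commute:
  assumes "is_partition l"
  shows "(\<Sum>k\<in>subparts l. F_one q k mu y *\<^sub>R F_skew q l k) =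
    (\<Sum>nu | is_partition nu \<and> interlaces nu l. F_one q l nu y *\<^sub>R F_skew q nu mu)"
proof (rule agree_eqI)
  fix N
  have "agree N (\<Sum>k\<in>subparts l. F_one q k mu y *\<^sub>R F_skew q l k)
    (\<Sum>k\<in>subparts l. F_one q k mu y *\<^sub>R F_fin q Var N l k)"
    by (intro agree_sum agree_scaleR agree_F_skew assms)
  also have "(\<Sum>k\<in>subparts l. F_one q k mu y *\<^sub>R F_fin q Var N l k) =
     (\<Sum>nu | is_partition nu \<and> interlaces nu l. F_one q l nu y *\<^sub>R F_fin q Var N nu mu)"
    using F_fin_commute[OF q0 q1 assms, of Var N mu "of_real y"]
    by (simp add: branch_def F_one_of_real scaleR_conv_of_real mult.commute)
  finally show "agree N (\<Sum>k\<in>subparts l. F_one q k mu y *\<^sub>R F_skew q l k)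
    (\<Sum>nu | is_partition nu \<and> interlaces nu l. F_one q l nu y *\<^sub>R F_skew q nu mu)"
    by (rule agree_trans) (auto intro!: agree_sum agree_scaleR agree_sym[OF agree_F_skew])
qed

text \<open>Lift of \<open>iter_moment\<close> with \<open>g\<close> the indicator of
  \<open>mu\<close>, so that only the first row \<open>m\<close> of the target remains free.\<close>

lemma F_skew_moment:
  assumes l: "is_partition l" and mu: "is_partition mu"
  shows "\<exists>r. r d = F_skew q (pcons d empty_partition) (pcons d empty_partition) * F_skew q l mu \<and>
    (\<forall>K\<ge>l 0. (\<Sum>m\<in>{mu 0..K}. (1/q) ^ (m * d) *\<^sub>R F_skew q (pcons K l) (pcons m mu)) =
       (\<Sum>s\<le>d. (1/q) ^ (K * s) *\<^sub>R r s))"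
proof -
  let ?g = "\<lambda>k. if k = mu then 1 else (0::pseries)"
  let ?f = "\<lambda>k. of_real ((1/q) ^ (k 0 * d)) * ?g (\<lambda>i. k (Suc i))"
  let ?W = "\<lambda>K. \<Sum>m\<in>{mu 0..K}. (1/q) ^ (m * d) *\<^sub>R F_skew q (pcons K l) (pcons m mu)"
  let ?Q = "F_skew q (pcons d empty_partition) (pcons d empty_partition)"
  have "\<forall>N. \<exists>r. r d = (\<Prod>i<N. qpoch (Var i) (of_real q) d) * iter q Var N l ?g \<and>
     (\<forall>K\<ge>l 0. iter q Var N (pcons K l) ?f = (\<Sum>s\<le>d. of_real ((1/q) ^ (K * s)) * r s))"
    using iter_moment[OF q0 q1 l, where d = d and x = Var and g = ?g] unfolding qpoly_def by blast
  from choice[OF this] obtain r where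
    r1: "\<And>N. r N d = (\<Prod>i<N. qpoch (Var i) (of_real q) d) * iter q Var N l ?g" and
    r2: "\<And>N K. K \<ge> l 0 \<Longrightarrow> iter q Var N (pcons K l) ?f = (\<Sum>s\<le>d. of_real ((1/q) ^ (K * s)) * r N s)"
    by blast
  have A1: "agree N (?Q * F_skew q l mu) (r N d)" for N
    unfolding r1 F_fin_row[OF q0 q1, symmetric] F_fin_iter[symmetric]
    by (intro agree_mult agree_F_skew l) simp
  have A2: "agree N (?W K) (\<Sum>s\<le>d. (1/q) ^ (K * s) *\<^sub>R r N s)" if K: "K \<ge> l 0" for N K
  proof -
    have p: "is_partition (pcons K l)" using l K by simp
    have "iter q Var N (pcons K l) ?f = (\<Sum>k\<in>subparts (pcons K l). F_fin q Var N (pcons K l) k * ?f k)"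
      by (rule iter_eq_sum[OF p])
    also have "\<dots> = (\<Sum>k\<in>(\<lambda>m. pcons m mu) ` {mu 0..K}. F_fin q Var N (pcons K l) k * ?f k)"
    proof (rule sum.mono_neutral_cong)
      fix k assume "k \<in> (\<lambda>m. pcons m mu) ` {mu 0..K} - subparts (pcons K l)"
      then show "F_fin q Var N (pcons K l) k * ?f k = 0"
        using mu by (auto simp: subparts_def F_fin_eq_0)
    next
      fix k assume k: "k \<in> subparts (pcons K l) - (\<lambda>m. pcons m mu) ` {mu 0..K}"
      have "(\<lambda>i. k (Suc i)) \<noteq> mu"
      proof
        assume e: "(\<lambda>i. k (Suc i)) = mu"
        then have kk: "k = pcons (k 0) mu" using pcons_hd_tl[of k] by simp
        have "is_partition (pcons (k 0) mu)" "partition_le (pcons (k 0) mu) (pcons K l)"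
          using k kk by (auto simp: subparts_def)
        then have "k 0 \<in> {mu 0..K}" by simp
        then have "k \<in> (\<lambda>m. pcons m mu) ` {mu 0..K}" using kk by (rule rev_image_eqI)
        then show False using k by simp
      qed
      then show "F_fin q Var N (pcons K l) k * ?f k = 0" by simp
    qed (use finite_subparts[OF p] in auto)
    also have "\<dots> = (\<Sum>m\<in>{mu 0..K}. (1/q) ^ (m * d) *\<^sub>R F_fin q Var N (pcons K l) (pcons m mu))"
      by (subst sum.reindex) (auto simp: inj_on_def scaleR_conv_of_real mult.commute)
    finally have "agree N (?W K) (iter q Var N (pcons K l) ?f)"
      by (auto intro!: agree_sum agree_scaleR agree_F_skew[OF p])
    then show ?thesis unfolding r2[OF K] scaleR_conv_of_real .
  qed
  \<comment> \<open>The coefficients \<open>r N\<close> are chosen separately for each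
    \<open>N\<close>, so no compatibility between them is at hand. Each monomial is therefore read
    off at one sufficiently large \<open>N\<close>.\<close>
  define nv where "nv m = (SOME N. Poly_Mapping.keys m \<subseteq> {..<N})" for m :: "nat \<Rightarrow>\<^sub>0 nat"
  have nv: "Poly_Mapping.keys m \<subseteq> {..<nv m}" for m :: "nat \<Rightarrow>\<^sub>0 nat"
    unfolding nv_def by (rule someI_ex) (use finite_nat_iff_bounded[of "Poly_Mapping.keys m"] in auto)
  define R where "R s = Abs_pseries (\<lambda>m. coeff_ps (r (nv m) s) m)" for s
  have R: "coeff_ps (R s) m = coeff_ps (r (nv m) s) m" for s m
    unfolding R_def by (simp add: Abs_pseries_inverse)
  show ?thesis
  proof (intro exI[of _ R] conjI allI impI)
    show "R d = ?Q * F_skew q l mu"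
    proof (rule pseries_eqI)
      fix m show "coeff_ps (R d) m = coeff_ps (?Q * F_skew q l mu) m"
        using A1[of "nv m"] nv[of m] by (simp add: R agree_def)
    qed
    fix K assume K: "l 0 \<le> K"
    show "?W K = (\<Sum>s\<le>d. (1/q) ^ (K * s) *\<^sub>R R s)"
    proof (rule pseries_eqI)
      fix m
      have "coeff_ps (?W K) m = coeff_ps (\<Sum>s\<le>d. (1/q) ^ (K * s) *\<^sub>R r (nv m) s) m"
        using A2[OF K, of "nv m"] nv[of m] unfolding agree_def by blast
      then show "coeff_ps (?W K) m = coeff_ps (\<Sum>s\<le>d. (1/q) ^ (K * s) *\<^sub>R R s) m"
        by (simp add: coeff_ps_sum scaleR_pseries.rep_eq R)
    qed
  qed
qed

section \<open>Skew functions lie in the span\<close>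

lemma subspace_Gamma: "subspace (Gamma q)"
  by (simp add: Gamma_def)

text \<open>
  Let \<open>k\<close> be the last part of \<open>mu\<close> and \<open>mu'\<close> the rest of \<open>mu\<close>. The coefficient of \<open>y\<^sup>k\<close> in lemma
  \<open>F_skew_commute\<close> for \<open>mu'\<close> expresses \<open>F_skew q l mu\<close> by functions that are smaller in the order \<open>R\<close>; as \<open>y\<close>
  is a number, the coefficient is extracted from the values at \<open>y = q\<^bsup>-K\<^esup>\<close>.
\<close>

lemma F_skew_in_Gamma:
  assumes "is_partition l" "is_partition mu"
  shows "F_skew q l mu \<in> Gamma q"
proof -
  define R where "R = inv_image (less_than <*lex*> less_than <*lex*> less_than)
    (\<lambda>mu :: nat \<Rightarrow> nat. (psize mu, plength mu, mu (plength mu - 1)))"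
  have "wf R" unfolding R_def by (intro wf_inv_image wf_lex_prod wf_less_than)
  then have "\<forall>l. is_partition l \<longrightarrow> is_partition mu \<longrightarrow> F_skew q l mu \<in> Gamma q"
  proof (induction mu rule: wf_induct_rule)
    case (less mu)
    show ?case
    proof (intro allI impI)
      fix l assume l: "is_partition l" and mu: "is_partition mu"
      show "F_skew q l mu \<in> Gamma q"
      proof (cases "mu \<in> subparts l \<and> plength mu \<noteq> 0")
        case False
        then consider "\<not> partition_le mu l" | "plength mu = 0" using mu by (auto simp: subparts_def)
        then show ?thesis
        proof cases
          case 1
          then show ?thesis using F_skew_eq_0[OF l 1] subspace_0[OF subspace_Gamma] by simp
        next
          case 2
          then have "mu = empty_partition"
            using partition_eq_0_iff[OF mu] by (auto simp: empty_partition_apply)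
          then show ?thesis using l by (auto simp: Gamma_def intro: span_base)
        qed
      next
        case True
        define n where "n = plength mu - 1"
        have Sn: "plength mu = Suc n" using True by (simp add: n_def)
        define mu' where "mu' = mu(n := 0)"
        define k where "k = mu n"
        have z: "mu i = 0 \<longleftrightarrow> n < i" for i using partition_eq_0_iff[OF mu, of i] Sn by auto
        have mu': "is_partition mu'"
          unfolding is_partition_def
        proof
          show "antimono mu'"
            unfolding antimono_iff_le_Suc mu'_def using partition_antimono[OF mu] z by auto
          show "finite {i. mu' i \<noteq> 0}"
            using mu by (auto simp: is_partition_def mu'_def intro: finite_subset[of _ "{i. mu i \<noteq> 0}"])
        qed
        have pm': "psize mu' = (\<Sum>i<n. mu i)"
          using psize_eq[OF mu', of n] by (simp add: mu'_def)
        have pm: "psize mu = (\<Sum>i<n. mu i) + k"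
          using psize_eq[OF mu, of "Suc n"] z by (simp add: k_def)
        have k0: "k > 0" using z[of n] by (auto simp: k_def)
        have imu: "interlaces mu' mu"
          unfolding interlaces_def mu'_def using partition_antimono[OF mu] z by auto
        \<comment> \<open>If the sizes agree and \<open>kap\<close> differs from \<open>mu\<close>,
          the rows before \<open>n\<close> are at least those of \<open>mu\<close> and one is
          longer, which forces row \<open>n\<close> to be shorter. If that row becomes empty, the
          number of rows drops.\<close>
        have small: "(kap, mu) \<in> R"
          if kap: "is_partition kap" and i: "interlaces mu' kap" and s: "psize kap - psize mu' \<le> k" and ne: "kap \<noteq> mu"
          for kap
        proof -
          have ki: "mu' i \<le> kap i" "kap (Suc i) \<le> mu' i" for i using i by (auto simp: interlaces_def)
          have kz: "kap (Suc n) = 0" using ki(2)[of n] by (simp add: mu'_def)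
          then have len: "plength kap \<le> Suc n" using partition_eq_0_iff[OF kap] by simp
          have pk: "psize kap = (\<Sum>i<n. kap i) + kap n"
            using psize_eq[OF kap kz] by simp
          have le: "(\<Sum>i<n. mu i) \<le> (\<Sum>i<n. kap i)"
            using ki(1) by (intro sum_mono) (metis fun_upd_other lessThan_iff less_irrefl mu'_def)
          have "psize kap \<le> psize mu" using s pm pm' by simp
          moreover have "kap n < mu n" if eq: "psize kap = psize mu"
          proof (rule ccontr)
            assume "\<not> kap n < mu n"
            then have e: "kap n = mu n" "(\<Sum>i<n. kap i) = (\<Sum>i<n. mu i)"
              using le pk pm eq by (auto simp: k_def)
            have "\<forall>i<n. mu i = kap i"
            proof (rule ccontr)
              assume "\<not> (\<forall>i<n. mu i = kap i)"
              then obtain i where i: "i < n" "mu i \<noteq> kap i" by blast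
              have le': "mu i \<le> kap i" if "i < n" for i
                using ki(1)[of i] that by (simp add: mu'_def)
              then have "(\<Sum>i<n. mu i) < (\<Sum>i<n. kap i)"
                using i le'[OF i(1)] by (intro sum_strict_mono_ex1) (auto intro!: bexI[of _ i] simp: order_less_le)
              then show False using e(2) by simp
            qed
            moreover have "kap i = 0" if "n < i" for i
              using partition_antimono[OF kap, of "Suc n" i] kz that by simp
            ultimately have "kap = mu"
              using e(1) z by (metis ext linorder_neqE_nat)
            then show False using ne by simp
          qed
          ultimately show ?thesis
            unfolding R_def using len Sn by (auto simp: order_le_less)
        qed
        have "(mu', mu) \<in> R" unfolding R_def using pm pm' k0 by simp
        then have IH1: "F_skew q nu mu' \<in> Gamma q" if "is_partition nu" for nu
          using less mu' that by blast
        have "\<forall>kap. \<exists>P. (\<forall>y::real. F_one q kap mu' y = poly P y) \<and> (\<forall>s < psize kap - psize mu'. coeff P s = 0) \<and>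
            (\<not> interlaces mu' kap \<longrightarrow> P = 0) \<and>
            (interlaces mu' kap \<longrightarrow> coeff P (psize kap - psize mu') =
              (\<Prod>r<plength kap. qpoch q q (kap r - kap (Suc r)) /
                 (qpoch q q (kap r - mu' r) * qpoch q q (mu' r - kap (Suc r)))))"
          using F_one_poly by blast
        from choice[OF this] obtain P where
          P: "\<And>kap y. F_one q kap mu' y = poly (P kap) y"
            "\<And>kap s. s < psize kap - psize mu' \<Longrightarrow> coeff (P kap) s = 0"
            "\<And>kap. \<not> interlaces mu' kap \<Longrightarrow> P kap = 0"
            "\<And>kap. interlaces mu' kap \<Longrightarrow> coeff (P kap) (psize kap - psize mu') =
              (\<Prod>r<plength kap. qpoch q q (kap r - kap (Suc r)) /
                 (qpoch q q (kap r - mu' r) * qpoch q q (mu' r - kap (Suc r))))"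
          by blast
        \<comment> \<open>For \<open>kap = mu\<close>, row \<open>n\<close> is lost entirely and the
          other rows stay, so all q-binomials are trivial and \<open>F_skew q l mu\<close> enters
          with coefficient 1.\<close>
        have "qpoch q q (mu r - mu (Suc r)) / (qpoch q q (mu r - mu' r) * qpoch q q (mu' r - mu (Suc r))) = 1"
          if "r < Suc n" for r
          using that z[of "Suc n"] by (cases "r = n") (auto simp: mu'_def qpoch_q_nz[OF q0 q1])
        then have top: "coeff (P mu) k = 1"
          using P(4)[OF imu] pm pm' by (simp add: Sn qpoch_q_nz[OF q0 q1])
        define D where "D = Max (insert k ((\<lambda>kap. degree (P kap)) ` subparts l))"
        have D: "k \<le> D" "\<And>kap. kap \<in> subparts l \<Longrightarrow> degree (P kap) \<le> D"
          unfolding D_def using finite_subparts[OF l] by auto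
        have ex: "poly (P kap) y = (\<Sum>s\<le>D. y ^ s * coeff (P kap) s)" if "kap \<in> subparts l" for kap y
          unfolding poly_altdef using D(2)[OF that]
          by (intro sum.mono_neutral_cong_left) (auto simp: coeff_eq_0 mult.commute)
        \<comment> \<open>This is \<open>F_skew_commute\<close> at \<open>y = q^-K\<close>, whose
          right side contains only skew functions over the smaller \<open>mu'\<close>.\<close>
        have W: "(\<Sum>s\<le>D. (1/q) ^ (K * s) *\<^sub>R (\<Sum>kap\<in>subparts l. coeff (P kap) s *\<^sub>R F_skew q l kap)) \<in> Gamma q" for K
        proof -
          have "(\<Sum>s\<le>D. (1/q) ^ (K * s) *\<^sub>R (\<Sum>kap\<in>subparts l. coeff (P kap) s *\<^sub>R F_skew q l kap)) =
            (\<Sum>kap\<in>subparts l. \<Sum>s\<le>D. (((1/q) ^ K) ^ s * coeff (P kap) s) *\<^sub>R F_skew q l kap)"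
            unfolding scaleR_sum_right by (subst sum.swap) (simp add: power_mult)
          also have "\<dots> = (\<Sum>kap\<in>subparts l. F_one q kap mu' ((1/q) ^ K) *\<^sub>R F_skew q l kap)"
            unfolding P(1) by (intro sum.cong refl) (simp add: ex scaleR_sum_left)
          also have "\<dots> \<in> Gamma q"
            unfolding F_skew_commute[OF l]
            by (intro subspace_sum subspace_scale subspace_Gamma) (auto intro: IH1)
          finally show ?thesis .
        qed
        have "(\<Sum>kap\<in>subparts l. coeff (P kap) k *\<^sub>R F_skew q l kap) \<in> Gamma q"
          by (rule subspace_qpoly_coeffs[OF subspace_Gamma _ _ D(1), where p = "1/q" and a = 0 and
                r = "\<lambda>s. \<Sum>kap\<in>subparts l. coeff (P kap) s *\<^sub>R F_skew q l kap"])
             (use q0 q1 W in simp_all)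
        moreover have "(\<Sum>kap\<in>subparts l - {mu}. coeff (P kap) k *\<^sub>R F_skew q l kap) \<in> Gamma q"
        proof (intro subspace_sum subspace_Gamma)
          fix kap assume kap: "kap \<in> subparts l - {mu}"
          show "coeff (P kap) k *\<^sub>R F_skew q l kap \<in> Gamma q"
          proof (cases "coeff (P kap) k = 0")
            case False
            then have "interlaces mu' kap" "psize kap - psize mu' \<le> k"
              using P(2)[of k kap] P(3)[of kap] by (metis coeff_0, metis leI)
            then have "(kap, mu) \<in> R" using kap small by (auto simp: subparts_def)
            then have "F_skew q l kap \<in> Gamma q" using less kap l by (auto simp: subparts_def)
            then show ?thesis by (rule subspace_scale[OF subspace_Gamma])
          qed (simp add: subspace_0[OF subspace_Gamma])
        qed
        ultimately have "(\<Sum>kap\<in>subparts l. coeff (P kap) k *\<^sub>R F_skew q l kap) -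
          (\<Sum>kap\<in>subparts l - {mu}. coeff (P kap) k *\<^sub>R F_skew q l kap) \<in> Gamma q"
          by (rule subspace_diff[OF subspace_Gamma])
        then show ?thesis
          using True top finite_subparts[OF l] by (simp add: sum.remove[of "subparts l" mu])
      qed
    qed
  qed
  then show ?thesis using assms by blast
qed

end


section \<open>Positive specializations\<close>

text \<open>Nonnegative numbers are squares, so \<open>g\<close> is monotone; it fixes the
  rationals, which are dense.\<close>

lemma real_ring_hom_eq_id:
  fixes g :: "real \<Rightarrow> real"
  assumes add: "\<And>x y. g (x + y) = g x + g y" and mult: "\<And>x y. g (x * y) = g x * g y" and one: "g 1 = 1"
  shows "g x = x"
proof -
  have zero: "g 0 = 0" using add[of 0 0] by simp
  have minus: "g (- x) = - g x" for x using add[of x "- x"] zero by simp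
  have nonneg: "0 \<le> g x" if "0 \<le> x" for x
    using mult[of "sqrt x" "sqrt x"] that by simp
  have mono: "g x \<le> g y" if "x \<le> y" for x y
    using nonneg[of "y - x"] add[of x "y - x"] that by simp
  have nat: "g (real n) = real n" for n
    by (induction n) (simp_all add: zero add one)
  have int: "g (real_of_int n) = real_of_int n" for n
    using nat minus by (cases n rule: int_cases2) simp_all
  have rat: "g r = r" if r: "r \<in> \<rat>" for r
  proof -
    obtain a b :: int where ab: "b > 0" "r = of_int a / of_int b"
      using r by (rule Rats_cases') auto
    then have rb: "r * of_int b = of_int a" by simp
    have "g r * of_int b = g (r * of_int b)" by (simp only: mult int)
    also have "\<dots> = r * of_int b" by (simp only: rb int)
    finally show ?thesis using ab(1) by simp
  qed
  show ?thesis
  proof (rule linorder_cases[of "g x" x])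
    assume "g x < x"
    then obtain r where r: "r \<in> \<rat>" "g x < r" "r < x" using Rats_dense_in_real by blast
    then show ?thesis using rat[OF r(1)] mono[of r x] by simp
  next
    assume "x < g x"
    then obtain r where r: "r \<in> \<rat>" "x < r" "r < g x" using Rats_dense_in_real by blast
    then show ?thesis using rat[OF r(1)] mono[of x r] by simp
  qed
qed

text \<open>The approximating sequence and its limit depend on \<open>e\<close>, hence the Cauchy
  criterion rather than a limit named in advance.\<close>

lemma convergent_uniform_approx:
  fixes R :: "nat \<Rightarrow> real"
  assumes "\<And>e. e > 0 \<Longrightarrow> \<exists>Y L. Y \<longlonglongrightarrow> L \<and> (\<forall>\<^sub>F n in sequentially. \<bar>R n - Y n\<bar> \<le> e)"
  shows "convergent R"
proof (rule Cauchy_convergent, rule CauchyI)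
  fix e :: real assume "0 < e"
  then obtain Y L where Y: "Y \<longlonglongrightarrow> L" "\<forall>\<^sub>F n in sequentially. \<bar>R n - Y n\<bar> \<le> e / 5"
    using assms[of "e / 5"] by auto
  have "\<forall>\<^sub>F n in sequentially. dist (Y n) L < e / 5"
    using Y(1) \<open>0 < e\<close> by (intro tendstoD) simp_all
  with Y(2) have "\<forall>\<^sub>F n in sequentially. \<bar>R n - L\<bar> < 2 * e / 5"
    by eventually_elim (auto simp: dist_real_def abs_if split: if_splits)
  then obtain N where N: "\<And>n. n \<ge> N \<Longrightarrow> \<bar>R n - L\<bar> < 2 * e / 5"
    unfolding eventually_sequentially by blast
  show "\<exists>M. \<forall>m\<ge>M. \<forall>n\<ge>M. norm (R m - R n) < e"
  proof (intro exI allI impI)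
    fix m n assume "N \<le> m" "N \<le> n"
    then have "\<bar>R m - L\<bar> < 2 * e / 5" "\<bar>R n - L\<bar> < 2 * e / 5" using N by auto
    then show "norm (R m - R n) < e" using \<open>0 < e\<close> by (simp add: abs_if split: if_splits)
  qed
qed

lemma has_sum_nonneg_approx:
  fixes f :: "'b \<Rightarrow> real"
  assumes nonneg: "\<And>x. x \<in> A \<Longrightarrow> 0 \<le> f x"
    and le: "\<And>F. finite F \<Longrightarrow> F \<subseteq> A \<Longrightarrow> sum f F \<le> S"
    and ge: "\<And>e. e > 0 \<Longrightarrow> \<exists>F. finite F \<and> F \<subseteq> A \<and> S - e \<le> sum f F"
  shows "(f has_sum S) A"
proof -
  let ?F = "{F. finite F \<and> F \<subseteq> A}"
  have bdd: "bdd_above (sum f ` ?F)" using le by (intro bdd_aboveI[of _ S]) auto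
  have "(SUP F\<in>?F. sum f F) = S"
  proof (rule antisym)
    show "(SUP F\<in>?F. sum f F) \<le> S" using le by (intro cSUP_least) auto
    show "S \<le> (SUP F\<in>?F. sum f F)"
    proof (rule field_le_epsilon)
      fix e :: real assume "0 < e"
      then obtain F where F: "finite F" "F \<subseteq> A" "S - e \<le> sum f F" using ge by blast
      then have "sum f F \<le> (SUP F\<in>?F. sum f F)" by (intro cSUP_upper bdd) auto
      then show "S \<le> (SUP F\<in>?F. sum f F) + e" using F(3) by simp
    qed
  qed
  moreover have "?F = {F. F \<subseteq> A \<and> finite F}" by auto
  ultimately show ?thesis
    using nonneg_bdd_above_has_sum[of A f, OF nonneg] bdd by simp
qed

section \<open>Positive specializations as Markov kernels\<close>

locale positive_specialization =
  fixes q :: real and \<phi> :: "pseries \<Rightarrow> real"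
  assumes q0: "0 < q" and q1: "q < 1" and spec: "specialization q \<phi>" and pos: "F_positive q \<phi>"
begin

lemma one_in_Gamma: "1 \<in> Gamma q"
  using F_skew_in_Gamma[OF q0 q1, of empty_partition empty_partition] by (simp add: F_skew_empty[OF q0 q1])

lemma phi_add: "f \<in> Gamma q \<Longrightarrow> g \<in> Gamma q \<Longrightarrow> \<phi> (f + g) = \<phi> f + \<phi> g"
  and phi_mult: "f \<in> Gamma q \<Longrightarrow> g \<in> Gamma q \<Longrightarrow> \<phi> (f * g) = \<phi> f * \<phi> g"
  and phi_1: "\<phi> 1 = 1"
  using spec by (simp_all add: specialization_def)

text \<open>On multiples of 1 the specialization is a ring endomorphism of the reals, hence the
  identity.\<close>

lemma phi_scaleR:
  assumes "f \<in> Gamma q"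
  shows "\<phi> (c *\<^sub>R f) = c * \<phi> f"
proof -
  have G: "x *\<^sub>R 1 \<in> Gamma q" for x
    by (rule subspace_scale[OF subspace_Gamma[OF q0 q1] one_in_Gamma])
  have "\<phi> (x *\<^sub>R 1) = x" for x
  proof (rule real_ring_hom_eq_id)
    fix x y :: real
    show "\<phi> ((x + y) *\<^sub>R 1) = \<phi> (x *\<^sub>R 1) + \<phi> (y *\<^sub>R 1)"
      using phi_add[OF G[of x] G[of y]] by (simp add: scaleR_add_left)
    show "\<phi> ((x * y) *\<^sub>R 1) = \<phi> (x *\<^sub>R 1) * \<phi> (y *\<^sub>R 1)"
      using phi_mult[OF G[of x] G[of y]] by (simp add: mult.commute)
  qed (simp add: phi_1)
  then show ?thesis using phi_mult[OF G[of c] assms] by simp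
qed

lemma phi_diff:
  assumes "f \<in> Gamma q" "g \<in> Gamma q"
  shows "\<phi> (f - g) = \<phi> f - \<phi> g"
  using phi_add[OF assms(1) subspace_scale[OF subspace_Gamma[OF q0 q1] assms(2), of "- 1"]]
    phi_scaleR[OF assms(2), of "- 1"] by simp

lemma phi_sum:
  assumes "\<And>i. i \<in> A \<Longrightarrow> f i \<in> Gamma q"
  shows "\<phi> (\<Sum>i\<in>A. c i *\<^sub>R f i) = (\<Sum>i\<in>A. c i * \<phi> (f i))"
  using assms
proof (induction A rule: infinite_finite_induct)
  case (insert i A)
  have "\<phi> (c i *\<^sub>R f i + (\<Sum>i\<in>A. c i *\<^sub>R f i)) = \<phi> (c i *\<^sub>R f i) + \<phi> (\<Sum>i\<in>A. c i *\<^sub>R f i)"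
    using insert.prems by (intro phi_add subspace_sum subspace_scale subspace_Gamma[OF q0 q1]) auto
  then show ?case using insert phi_scaleR[of "f i" "c i"] by simp
qed (use phi_scaleR[OF one_in_Gamma, of 0] in simp_all)

text \<open>By positivity and \<open>sum_wgt\<close>, these are transition probabilities from
  \<open>l\<close> to the partitions contained in it.\<close>

definition wgt :: "(nat \<Rightarrow> nat) \<Rightarrow> (nat \<Rightarrow> nat) \<Rightarrow> real" where
  "wgt l mu = \<phi> (F_skew q l mu)"

lemma wgt_nonneg: "is_partition l \<Longrightarrow> is_partition mu \<Longrightarrow> 0 \<le> wgt l mu"
  using pos by (simp add: F_positive_def wgt_def)

lemma wgt_subparts_nonneg: "is_partition l \<Longrightarrow> mu \<in> subparts l \<Longrightarrow> 0 \<le> wgt l mu"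
  by (simp add: wgt_nonneg subparts_def)

lemma subparts_partition: "mu \<in> subparts l \<Longrightarrow> is_partition mu"
  by (simp add: subparts_def)

lemma phi_sum_F_skew:
  assumes "\<And>i. i \<in> A \<Longrightarrow> is_partition (l i) \<and> is_partition (mu i)"
  shows "\<phi> (\<Sum>i\<in>A. c i *\<^sub>R F_skew q (l i) (mu i)) = (\<Sum>i\<in>A. c i * wgt (l i) (mu i))"
  unfolding wgt_def by (intro phi_sum) (use assms F_skew_in_Gamma[OF q0 q1] in blast)

lemma sum_wgt:
  assumes "is_partition l"
  shows "(\<Sum>k\<in>subparts l. wgt l k) = 1"
  using phi_sum_F_skew[of "subparts l" "\<lambda>_. l" "\<lambda>k. k" "\<lambda>_. 1"] assms
  by (simp add: F_skew_sum_1[OF q0 q1 assms] phi_1 subparts_partition)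

text \<open>Shrinking the first row lowers \<open>q^(l 0 - k 0)\<close> from 1 to at most
  \<open>q\<close>. Since the rows with indices up to \<open>M\<close> are equal, the expected loss
  of this quantity in the first moment formula involves only columns longer than
  \<open>M\<close>.\<close>

lemma wgt_tail:
  assumes l: "is_partition l" and M: "l M = l 0"
    and sm: "summable (\<lambda>n. \<phi> (FF q (column_partition n)))"
  shows "(1 - q) * (\<Sum>k | k \<in> subparts l \<and> k 0 \<noteq> l 0. wgt l k) \<le>
    suminf (\<lambda>j. \<phi> (FF q (column_partition (j + Suc M))))"
proof -
  let ?p = "1/q"
  let ?c = "\<lambda>n. \<phi> (FF q (column_partition n))"
  define J where "J = M + plength l"
  have lJ: "l J = 0" using partition_eq_0_iff[OF l] by (simp add: J_def)
  have cn: "0 \<le> ?c n" for n using wgt_nonneg[of "column_partition n" empty_partition] by (simp add: wgt_def)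
  have pq: "q ^ a * ?p ^ b = q ^ (a - b)" if "b \<le> a" for a b :: nat
  proof -
    have "q ^ a = q ^ (a - b) * q ^ b" using that by (simp flip: power_add)
    then show ?thesis using q0 by (simp add: power_one_over)
  qed
  have l0: "l j \<le> l 0" for j using partition_antimono[OF l] by simp
  have k0: "k 0 \<le> l 0" if "k \<in> subparts l" for k using that by (simp add: subparts_def partition_le_def)
  have "(\<Sum>k\<in>subparts l. ?p ^ k 0 * wgt l k) = \<phi> (?p ^ l 0 *\<^sub>R 1 -
    (\<Sum>j<J. (?p ^ l j - ?p ^ l (Suc j)) *\<^sub>R FF q (column_partition (Suc j))))"
    using phi_sum_F_skew[of "subparts l" "\<lambda>_. l" "\<lambda>k. k" "\<lambda>k. ?p ^ k 0"] l
    by (simp add: F_skew_first_moment[OF q0 q1 l lJ] subparts_partition)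
  also have "\<dots> = \<phi> (?p ^ l 0 *\<^sub>R 1) - \<phi> (\<Sum>j<J. (?p ^ l j - ?p ^ l (Suc j)) *\<^sub>R FF q (column_partition (Suc j)))"
    by (intro phi_diff subspace_sum subspace_scale subspace_Gamma[OF q0 q1] one_in_Gamma F_skew_in_Gamma[OF q0 q1]) simp_all
  also have "\<dots> = ?p ^ l 0 - (\<Sum>j<J. (?p ^ l j - ?p ^ l (Suc j)) * ?c (Suc j))"
    by (subst phi_sum) (simp_all add: phi_scaleR one_in_Gamma phi_1 F_skew_in_Gamma[OF q0 q1])
  finally have mom: "(\<Sum>k\<in>subparts l. ?p ^ k 0 * wgt l k) = \<dots>" .
  have "(\<Sum>k\<in>subparts l. (1 - q ^ (l 0 - k 0)) * wgt l k) =
    (\<Sum>k\<in>subparts l. wgt l k) - q ^ l 0 * (\<Sum>k\<in>subparts l. ?p ^ k 0 * wgt l k)"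
    unfolding sum_distrib_left sum_subtractf[symmetric]
    by (intro sum.cong refl) (simp add: k0 pq[symmetric] left_diff_distrib mult.assoc)
  also have "\<dots> = (\<Sum>j<J. (q ^ l 0 * ?p ^ l j - q ^ l 0 * ?p ^ l (Suc j)) * ?c (Suc j))"
  proof -
    have "q ^ l 0 * ?p ^ l 0 = 1" using pq[of "l 0" "l 0"] by simp
    then show ?thesis unfolding sum_wgt[OF l] mom right_diff_distrib sum_distrib_left
      by (simp add: left_diff_distrib right_diff_distrib mult.assoc)
  qed
  also have "\<dots> = (\<Sum>j\<in>{M..<J}. (q ^ l 0 * ?p ^ l j - q ^ l 0 * ?p ^ l (Suc j)) * ?c (Suc j))"
  proof (rule sum.mono_neutral_right)
    have eq0: "l j = l 0" if "j \<le> M" for j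
      using partition_antimono[OF l that] M l0[of j] by simp
    show "\<forall>j\<in>{..<J} - {M..<J}. (q ^ l 0 * ?p ^ l j - q ^ l 0 * ?p ^ l (Suc j)) * ?c (Suc j) = 0"
    proof
      fix j assume "j \<in> {..<J} - {M..<J}"
      then have "l j = l 0" "l (Suc j) = l 0" by (auto intro: eq0)
      then show "(q ^ l 0 * ?p ^ l j - q ^ l 0 * ?p ^ l (Suc j)) * ?c (Suc j) = 0"
        by (simp only: diff_self mult_zero_left)
    qed
  qed auto
  also have "\<dots> \<le> (\<Sum>j\<in>{M..<J}. 1 * ?c (Suc j))"
  proof (intro sum_mono mult_right_mono cn)
    fix j
    have "q ^ l 0 * ?p ^ l j \<le> 1" unfolding pq[OF l0] using q0 q1 by (simp add: power_le_one)
    moreover have "0 \<le> q ^ l 0 * ?p ^ l (Suc j)" using q0 by simp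
    ultimately show "q ^ l 0 * ?p ^ l j - q ^ l 0 * ?p ^ l (Suc j) \<le> 1" by linarith
  qed
  also have "\<dots> = (\<Sum>i<J - M. ?c (i + Suc M))"
    by (rule sum.reindex_bij_witness[of _ "\<lambda>i. i + M" "\<lambda>j. j - M"]) auto
  also have "\<dots> \<le> suminf (\<lambda>j. ?c (j + Suc M))"
    using summable_ignore_initial_segment[OF sm, of "Suc M"] cn by (intro sum_le_suminf) auto
  finally have up: "(\<Sum>k\<in>subparts l. (1 - q ^ (l 0 - k 0)) * wgt l k) \<le> suminf (\<lambda>j. ?c (j + Suc M))" .
  have "(1 - q) * (\<Sum>k | k \<in> subparts l \<and> k 0 \<noteq> l 0. wgt l k) \<le> (\<Sum>k | k \<in> subparts l \<and> k 0 \<noteq> l 0. (1 - q ^ (l 0 - k 0)) * wgt l k)"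
    unfolding sum_distrib_left
  proof (intro sum_mono mult_right_mono)
    fix k assume k: "k \<in> {k. k \<in> subparts l \<and> k 0 \<noteq> l 0}"
    then have "l 0 - k 0 = Suc (l 0 - k 0 - 1)" using k0[of k] by auto
    then have "q ^ (l 0 - k 0) \<le> q ^ 1" using q0 q1 by (intro power_decreasing) simp_all
    then show "1 - q \<le> 1 - q ^ (l 0 - k 0)" by simp
    show "0 \<le> wgt l k" using k by (auto intro: wgt_subparts_nonneg[OF l])
  qed
  also have "\<dots> \<le> (\<Sum>k\<in>subparts l. (1 - q ^ (l 0 - k 0)) * wgt l k)"
    using q0 q1 by (intro sum_mono2 finite_subparts l mult_nonneg_nonneg) (auto intro: wgt_subparts_nonneg[OF l] simp: power_le_one)
  finally show ?thesis using up by linarith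
qed

lemma wgt_last:
  assumes "is_partition l" "l (Suc M) = 0"
  shows "(\<Sum>k | k \<in> subparts l \<and> k M = a. wgt l k) = wgt (pcons (l M) empty_partition) (pcons a empty_partition)"
proof -
  have "\<phi> (\<Sum>k | k \<in> subparts l \<and> k M = a. 1 *\<^sub>R F_skew q l k) = (\<Sum>k | k \<in> subparts l \<and> k M = a. 1 * wgt l k)"
    using assms by (intro phi_sum_F_skew) (auto simp: subparts_partition)
  then show ?thesis unfolding wgt_def using F_skew_last[OF q0 q1 assms, of a] by simp
qed

text \<open>Division of the polynomial in \<open>q^-K\<close> by \<open>q^-(K d)\<close> leaves the
  top coefficient in the limit, and multiplicativity of \<open>\<phi>\<close> factors it.\<close>

lemma wgt_moment:
  assumes l: "is_partition l" and mu: "is_partition mu"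
  shows "(\<lambda>K. \<Sum>m\<in>{mu 0..K}. q ^ ((K - m) * d) * wgt (pcons K l) (pcons m mu))
    \<longlonglongrightarrow> wgt (pcons d empty_partition) (pcons d empty_partition) * wgt l mu"
proof -
  let ?p = "1/q"
  let ?Q = "F_skew q (pcons d empty_partition) (pcons d empty_partition)"
  obtain r where r: "r d = ?Q * F_skew q l mu"
    "\<And>K. K \<ge> l 0 \<Longrightarrow> (\<Sum>m\<in>{mu 0..K}. ?p ^ (m * d) *\<^sub>R F_skew q (pcons K l) (pcons m mu)) = (\<Sum>s\<le>d. ?p ^ (K * s) *\<^sub>R r s)"
    using F_skew_moment[OF q0 q1 l mu, of d] by blast
  \<comment> \<open>\<open>\<phi>\<close> is additive only on the span, so the coefficients have to
    lie there.\<close>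
  have rG: "r s \<in> Gamma q" if "s \<le> d" for s
  proof (rule subspace_qpoly_coeffs[OF subspace_Gamma[OF q0 q1] _ _ that])
    show "1 < ?p" using q0 q1 by simp
    fix K assume "l 0 \<le> K"
    then show "(\<Sum>s\<le>d. ?p ^ (K * s) *\<^sub>R r s) \<in> Gamma q"
      unfolding r(2)[symmetric, OF \<open>l 0 \<le> K\<close>] using l mu
      by (intro subspace_sum subspace_scale subspace_Gamma[OF q0 q1] F_skew_in_Gamma[OF q0 q1]) auto
  qed
  have top: "\<phi> (r d) = wgt (pcons d empty_partition) (pcons d empty_partition) * wgt l mu"
    unfolding r(1) wgt_def using l mu by (intro phi_mult F_skew_in_Gamma[OF q0 q1]) simp_all
  have eq: "(\<Sum>m\<in>{mu 0..K}. q ^ ((K - m) * d) * wgt (pcons K l) (pcons m mu)) = (\<Sum>s\<le>d. (q ^ (d - s)) ^ K * \<phi> (r s))"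
    if K: "l 0 \<le> K" for K
  proof -
    have e1: "q ^ (K * d) * ?p ^ (m * d) = q ^ ((K - m) * d)" if "m \<le> K" for m
    proof -
      have "K * d = (K - m) * d + m * d" using that by (simp flip: distrib_right)
      then show ?thesis using q0 by (simp add: power_add power_one_over)
    qed
    have e2: "q ^ (K * d) * ?p ^ (K * s) = (q ^ (d - s)) ^ K" if sd: "s \<le> d" for s
    proof -
      obtain e where "d = s + e" using le_Suc_ex[OF sd] by blast
      then show ?thesis using q0
        by (simp add: power_add power_one_over distrib_left mult.commute[of e] flip: power_mult)
    qed
    have "(\<Sum>m\<in>{mu 0..K}. ?p ^ (m * d) * wgt (pcons K l) (pcons m mu)) = (\<Sum>s\<le>d. ?p ^ (K * s) * \<phi> (r s))"
      using arg_cong[OF r(2)[OF K], of \<phi>] phi_sum[of "{..d}" r "\<lambda>s. ?p ^ (K * s)"] rG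
        phi_sum_F_skew[of "{mu 0..K}" "\<lambda>_. pcons K l" "\<lambda>m. pcons m mu" "\<lambda>m. ?p ^ (m * d)"] l mu K
      by simp
    then have "q ^ (K * d) * (\<Sum>m\<in>{mu 0..K}. ?p ^ (m * d) * wgt (pcons K l) (pcons m mu)) = 
        q ^ (K * d) * (\<Sum>s\<le>d. ?p ^ (K * s) * \<phi> (r s))" by simp
    then show ?thesis unfolding sum_distrib_left by (simp add: mult.assoc[symmetric] e1 e2)
  qed
  have "(\<lambda>K. \<Sum>s\<le>d. (q ^ (d - s)) ^ K * \<phi> (r s)) \<longlonglongrightarrow> (\<Sum>s\<le>d. (if s = d then 1 else 0) * \<phi> (r s))"
  proof (intro tendsto_intros)
    fix s assume "s \<in> {..d}"
    show "(\<lambda>K. (q ^ (d - s)) ^ K) \<longlonglongrightarrow> (if s = d then 1 else 0)"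
    proof (cases "s = d")
      case False
      then have "0 < d - s" using \<open>s \<in> {..d}\<close> by simp
      then have "q ^ (d - s) < 1" using q0 q1 by (simp add: power_less_one_iff)
      then show ?thesis using False q0 by (simp add: LIMSEQ_realpow_zero)
    qed simp
  qed
  moreover have "(\<Sum>s\<le>d. (if s = d then 1 else 0) * \<phi> (r s)) = \<phi> (r d)"
    by (simp add: if_distrib[of "\<lambda>x. x * _"] cong: if_cong)
  ultimately have "(\<lambda>K. \<Sum>s\<le>d. (q ^ (d - s)) ^ K * \<phi> (r s)) \<longlonglongrightarrow> \<phi> (r d)" by simp
  moreover have "\<forall>\<^sub>F K in sequentially. (\<Sum>s\<le>d. (q ^ (d - s)) ^ K * \<phi> (r s)) =
      (\<Sum>m\<in>{mu 0..K}. q ^ ((K - m) * d) * wgt (pcons K l) (pcons m mu))"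
    using eventually_ge_at_top[of "l 0"] by eventually_elim (simp only: eq)
  ultimately show ?thesis unfolding top[symmetric] by (rule Lim_transform_eventually)
qed

end


section \<open>The limit of long first rows\<close>

text \<open>Empty rows of \<open>l\<close> become full rows of the complement; they form the block
  of equal first rows to which \<open>wgt_tail\<close> applies.\<close>

lemma box_compl_init:
  assumes "is_partition l" "plength l \<le> M"
  shows "box_compl K M l (M - plength l) = K"
proof -
  have "Suc M - (M - plength l) = Suc (plength l)" using assms(2) by simp
  moreover have "l (plength l) = 0" using partition_eq_0_iff[OF assms(1)] by simp
  ultimately show ?thesis by (simp add: box_compl_def)
qed

lemma gap_prod_Suc_pcons: "gap_prod q (Suc M) (pcons K l) = qpoch q q (K - l 0) * gap_prod q M l"
  unfolding gap_prod_def by (subst prod.lessThan_Suc_shift) simp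

text \<open>Level \<open>j\<close> above \<open>mu\<close>, made finite by allowing at most
  \<open>M\<close> rows.\<close>

definition ext_parts :: "(nat \<Rightarrow> nat) \<Rightarrow> nat \<Rightarrow> nat \<Rightarrow> (nat \<Rightarrow> nat) set" where
  "ext_parts mu M j = {l. is_partition l \<and> partition_le mu l \<and> l 0 = mu 0 + j \<and> l M = 0}"

lemma finite_ext_parts: "finite (ext_parts mu M j)"
proof (rule finite_subset)
  let ?r = "\<lambda>i. if i < M then mu 0 + j else 0"
  have "is_partition ?r" by (auto simp: is_partition_def antimono_def)
  then show "finite (subparts ?r)" by (rule finite_subparts)
  show "ext_parts mu M j \<subseteq> subparts ?r"
  proof
    fix l assume "l \<in> ext_parts mu M j"
    then have l: "is_partition l" "l 0 = mu 0 + j" "l M = 0" by (auto simp: ext_parts_def)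
    have "l i \<le> ?r i" for i
      using partition_antimono[OF l(1), of 0 i] partition_antimono[OF l(1), of M i] l by auto
    then show "l \<in> subparts ?r" using l by (simp add: subparts_def partition_le_def)
  qed
qed

context
  fixes q :: real
  assumes q0: "0 < q" and q1: "q < 1"
begin

lemma qpoch_ratio_tendsto: "(\<lambda>K. qpoch q q (K - a) / qpoch q q (K - a - j)) \<longlonglongrightarrow> 1"
proof -
  have "(\<lambda>n. qpoch q q (n + j) / qpoch q q n) \<longlonglongrightarrow> 1"
  proof (induction j)
    case 0
    show ?case by (simp add: qpoch_q_nz[OF q0 q1])
  next
    case (Suc j)
    have z: "(\<lambda>n. q ^ n) \<longlonglongrightarrow> 0" using q0 q1 by (simp add: LIMSEQ_realpow_zero)
    have "(\<lambda>n. qpoch q q (n + j) / qpoch q q n * (1 - q * (q ^ n * q ^ j))) \<longlonglongrightarrow> 1 * (1 - q * (0 * q ^ j))"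
      by (intro tendsto_mult tendsto_diff tendsto_const Suc z)
    then show ?case by (simp add: qpoch_Suc power_add)
  qed
  then have "(\<lambda>n. qpoch q q (n + (a + j) - a) / qpoch q q (n + (a + j) - a - j)) \<longlonglongrightarrow> 1"
    by simp
  then show ?thesis by (rule LIMSEQ_offset)
qed

lemma c_coeff_nonneg: "is_partition l \<Longrightarrow> is_partition mu \<Longrightarrow> 0 \<le> c_coeff q l mu"
  unfolding c_coeff_def conj_mult_prod_def
  by (intro divide_nonneg_nonneg prod_nonneg) (auto intro: less_imp_le[OF qpoch_q_pos[OF q0 q1]])

end

section \<open>Convergence for long first rows\<close>

locale summable_specialization = positive_specialization +
  assumes small: "\<phi> (FF q (column_partition 1)) < 1"
    and sm: "summable (\<lambda>n. \<phi> (FF q (column_partition n)))"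
begin

abbreviation (input) row where "row n \<equiv> pcons n empty_partition"

text \<open>The value of \<open>\<phi>\<close> on the product of all \<open>(x_i;q)_d\<close>, by
  \<open>F_fin_row\<close>.\<close>

definition row_stay :: "nat \<Rightarrow> real" where "row_stay d = wgt (row d) (row d)"

lemma wgt_empty: "wgt empty_partition empty_partition = 1"
  by (simp add: wgt_def F_skew_empty[OF q0 q1] phi_1)

text \<open>The moment of order 0, which forgets the first row.\<close>

lemma sum_wgt_pcons:
  assumes l: "is_partition l" and mu: "is_partition mu" and K: "l 0 \<le> K"
  shows "(\<Sum>m\<in>{mu 0..K}. wgt (pcons K l) (pcons m mu)) = wgt l mu"
proof -
  obtain r where r: "r 0 = F_skew q (row 0) (row 0) * F_skew q l mu"
    "\<And>K. K \<ge> l 0 \<Longrightarrow> (\<Sum>m\<in>{mu 0..K}. (1/q) ^ (m * 0) *\<^sub>R F_skew q (pcons K l) (pcons m mu)) = (\<Sum>s\<le>0. (1/q) ^ (K * s) *\<^sub>R r s)"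
    using F_skew_moment[OF q0 q1 l mu, of 0] by blast
  have "\<phi> (\<Sum>m\<in>{mu 0..K}. 1 *\<^sub>R F_skew q (pcons K l) (pcons m mu)) = (\<Sum>m\<in>{mu 0..K}. 1 * wgt (pcons K l) (pcons m mu))"
    using l mu K by (intro phi_sum_F_skew) auto
  then show ?thesis using r(1) r(2)[OF K] by (simp add: F_skew_empty[OF q0 q1] wgt_def)
qed

text \<open>The term \<open>m = K\<close> has factor 1 and every other term a factor of at most
  \<open>q^d\<close>; without these factors the terms sum to \<open>wgt l mu\<close>.\<close>

lemma wgt_pcons_approx:
  assumes l: "is_partition l" and mu: "is_partition mu"
  shows "\<forall>\<^sub>F K in sequentially. \<bar>wgt (pcons K l) (pcons K mu) -
    (\<Sum>m\<in>{mu 0..K}. q ^ ((K - m) * d) * wgt (pcons K l) (pcons m mu))\<bar> \<le> q ^ d * wgt l mu"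
  using eventually_ge_at_top[of "max (l 0) (mu 0)"]
proof eventually_elim
  case (elim K)
  then have K: "l 0 \<le> K" "mu 0 \<le> K" by auto
  have nn: "0 \<le> wgt (pcons K l) (pcons m mu)" if "m \<in> {mu 0..K}" for m
    using that l mu K by (intro wgt_nonneg) auto
  have split: "{mu 0..K} = insert K {mu 0..<K}" using K by auto
  have "(\<Sum>m\<in>{mu 0..<K}. q ^ ((K - m) * d) * wgt (pcons K l) (pcons m mu)) \<le> (\<Sum>m\<in>{mu 0..<K}. q ^ d * wgt (pcons K l) (pcons m mu))"
  proof (intro sum_mono mult_right_mono)
    fix m assume m: "m \<in> {mu 0..<K}"
    have "1 * d \<le> (K - m) * d" using m by (intro mult_le_mono1) auto
    then show "q ^ ((K - m) * d) \<le> q ^ d" using q0 q1 by (intro power_decreasing) simp_all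
    show "0 \<le> wgt (pcons K l) (pcons m mu)" using m by (intro nn) auto
  qed
  also have "\<dots> \<le> (\<Sum>m\<in>{mu 0..K}. q ^ d * wgt (pcons K l) (pcons m mu))"
    using nn q0 by (intro sum_mono2) auto
  also have "\<dots> = q ^ d * wgt l mu"
    unfolding sum_distrib_left[symmetric] sum_wgt_pcons[OF l mu K(1)] ..
  finally have "(\<Sum>m\<in>{mu 0..<K}. q ^ ((K - m) * d) * wgt (pcons K l) (pcons m mu)) \<le> q ^ d * wgt l mu" .
  moreover have "0 \<le> (\<Sum>m\<in>{mu 0..<K}. q ^ ((K - m) * d) * wgt (pcons K l) (pcons m mu))"
    using nn q0 by (intro sum_nonneg mult_nonneg_nonneg) auto
  moreover have "(\<Sum>m\<in>{mu 0..K}. q ^ ((K - m) * d) * wgt (pcons K l) (pcons m mu)) =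
    wgt (pcons K l) (pcons K mu) + (\<Sum>m\<in>{mu 0..<K}. q ^ ((K - m) * d) * wgt (pcons K l) (pcons m mu))"
    unfolding split by (subst sum.insert) simp_all
  ultimately show ?case by simp
qed

lemma wgt_moment_tendsto:
  assumes "is_partition l" "is_partition mu"
  shows "(\<lambda>K. \<Sum>m\<in>{mu 0..K}. q ^ ((K - m) * d) * wgt (pcons K l) (pcons m mu)) \<longlonglongrightarrow> row_stay d * wgt l mu"
  using wgt_moment[OF assms, of d] by (simp add: row_stay_def)

lemma convergent_wgt_pcons:
  assumes l: "is_partition l" and mu: "is_partition mu"
  shows "convergent (\<lambda>K. wgt (pcons K l) (pcons K mu))"
proof (rule convergent_uniform_approx)
  fix e :: real assume "0 < e"
  have "(\<lambda>d. q ^ d * wgt l mu) \<longlonglongrightarrow> 0 * wgt l mu"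
    using q0 q1 by (intro tendsto_intros LIMSEQ_realpow_zero) simp_all
  then have "(\<lambda>d. q ^ d * wgt l mu) \<longlonglongrightarrow> 0" by simp
  then have "\<forall>\<^sub>F d in sequentially. q ^ d * wgt l mu < e"
    using \<open>0 < e\<close> by (rule order_tendstoD)
  then obtain d where d: "q ^ d * wgt l mu \<le> e"
    unfolding eventually_sequentially by (meson less_imp_le order_refl)
  have "\<forall>\<^sub>F K in sequentially. \<bar>wgt (pcons K l) (pcons K mu) -
      (\<Sum>m\<in>{mu 0..K}. q ^ ((K - m) * d) * wgt (pcons K l) (pcons m mu))\<bar> \<le> e"
    using wgt_pcons_approx[OF assms, of d] by eventually_elim (use d in linarith)
  with wgt_moment_tendsto[OF assms, of d]
  show "\<exists>Y L. Y \<longlonglongrightarrow> L \<and> (\<forall>\<^sub>F K in sequentially. \<bar>wgt (pcons K l) (pcons K mu) - Y K\<bar> \<le> e)"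
    by blast
qed

text \<open>The error \<open>q^d * wgt l mu\<close> does not depend on \<open>K\<close>, so
  \<open>K\<close> can tend to infinity before \<open>d\<close>. Convergence of
  \<open>row_stay\<close> itself is the case of empty partitions.\<close>

lemma wgt_pcons_tendsto:
  assumes l: "is_partition l" and mu: "is_partition mu"
  shows "(\<lambda>K. wgt (pcons K l) (pcons K mu)) \<longlonglongrightarrow> lim row_stay * wgt l mu"
proof -
  have "convergent row_stay"
    using convergent_wgt_pcons[of empty_partition empty_partition] by (simp add: row_stay_def[abs_def])
  then have P: "row_stay \<longlonglongrightarrow> lim row_stay" by (simp add: convergent_LIMSEQ_iff)
  obtain L where L: "(\<lambda>K. wgt (pcons K l) (pcons K mu)) \<longlonglongrightarrow> L"
    using convergent_wgt_pcons[OF assms] by (auto simp: convergent_def)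
  have "\<bar>L - row_stay d * wgt l mu\<bar> \<le> q ^ d * wgt l mu" for d
    by (rule tendsto_upperbound[OF tendsto_rabs[OF tendsto_diff[OF L wgt_moment_tendsto[OF assms]]] wgt_pcons_approx[OF assms]]) simp
  moreover have "(\<lambda>d. \<bar>L - row_stay d * wgt l mu\<bar>) \<longlonglongrightarrow> \<bar>L - lim row_stay * wgt l mu\<bar>"
    by (intro tendsto_intros P)
  moreover have "(\<lambda>d. q ^ d * wgt l mu) \<longlonglongrightarrow> 0 * wgt l mu"
    using q0 q1 by (intro tendsto_intros LIMSEQ_realpow_zero) simp_all
  ultimately have "\<bar>L - lim row_stay * wgt l mu\<bar> \<le> 0 * wgt l mu"
    by (intro LIMSEQ_le) auto
  then show ?thesis using L by simp
qed

section \<open>Comparison with the step of a single row\<close>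

definition tail :: "nat \<Rightarrow> real" where
  "tail M = suminf (\<lambda>j. \<phi> (FF q (column_partition (j + Suc M)))) / (1 - q)"

lemma tail_tendsto: "tail \<longlonglongrightarrow> 0"
proof -
  have "(\<lambda>n. suminf (\<lambda>j. \<phi> (FF q (column_partition (j + n))))) \<longlonglongrightarrow> 0"
    unfolding LIMSEQ_iff using suminf_exist_split[OF _ sm] by simp
  then have "(\<lambda>n. suminf (\<lambda>j. \<phi> (FF q (column_partition (j + Suc n))))) \<longlonglongrightarrow> 0"
    by (rule LIMSEQ_Suc)
  then have "(\<lambda>n. suminf (\<lambda>j. \<phi> (FF q (column_partition (j + Suc n)))) / (1 - q)) \<longlonglongrightarrow> 0 / (1 - q)"
    using q1 by (intro tendsto_intros) simp_all
  then show ?thesis by (simp add: tail_def[abs_def])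
qed

definition part_sum :: "(nat \<Rightarrow> nat) \<Rightarrow> nat \<Rightarrow> nat \<Rightarrow> real" where
  "part_sum mu M j = (\<Sum>l\<in>ext_parts mu M j. c_coeff q l mu * wgt l mu)"

text \<open>The counterpart of \<open>part_sum\<close> with a first row \<open>K\<close> on top; the
  ratio of \<open>qpoch\<close> is the share of the gap below that row in the ratio of gap
  products.\<close>

definition box_sum :: "(nat \<Rightarrow> nat) \<Rightarrow> nat \<Rightarrow> nat \<Rightarrow> nat \<Rightarrow> real" where
  "box_sum mu M j K = (\<Sum>l\<in>ext_parts mu M j.
     qpoch q q (K - mu 0) / qpoch q q (K - mu 0 - j) * c_coeff q l mu * wgt (pcons K l) (pcons K mu))"

text \<open>The last row of the complement of \<open>mu\<close> moves like a single row of length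
  \<open>K - mu 0\<close>. Transitions that keep the first row at \<open>K\<close> are the
  complements of \<open>ext_parts mu M j\<close> and give \<open>box_sum\<close>; the others have
  probability at most \<open>tail\<close>.\<close>

lemma row_bounds:
  assumes mu: "is_partition mu" and M: "plength mu \<le> M" and K: "mu 0 + j \<le> K"
  shows "box_sum mu M j K \<le> wgt (row (K - mu 0)) (row (K - mu 0 - j))"
    and "wgt (row (K - mu 0)) (row (K - mu 0 - j)) \<le> box_sum mu M j K + tail (M - plength mu)"
proof -
  let ?c = "box_compl K M"
  let ?nu = "?c mu"
  let ?a = "K - mu 0 - j"
  have muM: "mu M = 0" "mu (Suc M) = 0" using partition_eq_0_iff[OF mu] M by auto
  have nu: "is_partition ?nu" using mu K by (intro is_partition_box_compl) simp_all
  have nu0: "?nu 0 = K" using muM by (simp add: box_compl_0)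
  let ?S = "{k. k \<in> subparts ?nu \<and> k M = ?a}"
  have finS: "finite ?S" using finite_subparts[OF nu] by simp
  have row: "wgt (row (K - mu 0)) (row ?a) = (\<Sum>k\<in>?S. wgt ?nu k)"
    using wgt_last[OF nu box_compl_Suc, of ?a] by (simp add: box_compl_last)
  have "(\<Sum>k\<in>?S. wgt ?nu k) = (\<Sum>k\<in>{k\<in>?S. k 0 = K} \<union> {k\<in>?S. k 0 \<noteq> K}. wgt ?nu k)"
    by (rule sum.cong) auto
  also have "\<dots> = (\<Sum>k\<in>{k\<in>?S. k 0 = K}. wgt ?nu k) + (\<Sum>k\<in>{k\<in>?S. k 0 \<noteq> K}. wgt ?nu k)"
    by (rule sum.union_disjoint; (rule rev_finite_subset[OF finS])?) auto
  finally have "(\<Sum>k\<in>?S. wgt ?nu k) = \<dots>" .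
  moreover have "(\<Sum>k\<in>{k\<in>?S. k 0 = K}. wgt ?nu k) = box_sum mu M j K"
    unfolding box_sum_def
  proof (rule sum.reindex_bij_witness[of _ ?c ?c])
    fix k assume "k \<in> {k\<in>?S. k 0 = K}"
    then have k: "is_partition k" "partition_le k ?nu" "k M = ?a" "k 0 = K" by (auto simp: subparts_def)
    have kS: "k (Suc M) = 0" using k(2) box_compl_Suc[of K M mu] by (metis partition_le_def le_zero_eq)
    show "?c (?c k) = k" using k kS by (intro box_compl_box_compl) simp_all
    have "partition_le (?c ?nu) (?c k)" by (rule box_compl_antimono[OF k(2)])
    then have "partition_le mu (?c k)" using mu muM K by (simp add: box_compl_box_compl)
    then show "?c k \<in> ext_parts mu M j"
      using k K by (simp add: ext_parts_def is_partition_box_compl box_compl_0 box_compl_last)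
  next
    fix l assume "l \<in> ext_parts mu M j"
    then have l: "is_partition l" "partition_le mu l" "l 0 = mu 0 + j" "l M = 0" by (auto simp: ext_parts_def)
    have lS: "l (Suc M) = 0" using partition_antimono[OF l(1), of M "Suc M"] l(4) by simp
    show "?c (?c l) = l" using l lS K by (intro box_compl_box_compl) simp_all
    show "?c l \<in> {k\<in>?S. k 0 = K}"
      using l K by (simp add: subparts_def is_partition_box_compl box_compl_antimono box_compl_0 box_compl_last)
  next
    fix k assume "k \<in> {k\<in>?S. k 0 = K}"
    then have k: "is_partition k" "partition_le k ?nu" "k M = ?a" "k 0 = K" by (auto simp: subparts_def)
    have kS: "k (Suc M) = 0" using k(2) box_compl_Suc[of K M mu] by (metis partition_le_def le_zero_eq)
    define l where "l = ?c k"
    have l: "is_partition l" "l 0 = mu 0 + j" "l M = 0"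
      using k K by (simp_all add: l_def is_partition_box_compl box_compl_0 box_compl_last)
    have kl: "k = ?c l" unfolding l_def using k kS by (intro box_compl_box_compl[symmetric]) simp_all
    have g1: "(gap_prod q (Suc M) (pcons K mu) / gap_prod q (Suc M) (pcons K l)) * wgt (pcons K l) (pcons K mu) = wgt ?nu k"
      unfolding wgt_def kl using l mu muM K
      by (subst F_skew_box_compl[OF q0 q1, symmetric]) (simp_all add: phi_scaleR F_skew_in_Gamma[OF q0 q1])
    have g2: "gap_prod q (Suc M) (pcons K mu) / gap_prod q (Suc M) (pcons K l) =
        qpoch q q (K - mu 0) / qpoch q q (K - mu 0 - j) * c_coeff q l mu"
      unfolding gap_prod_Suc_pcons c_coeff_def conj_mult_prod_eq[OF l(1,3)] conj_mult_prod_eq[OF mu muM(1)]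
      by (simp add: l(2))
    show "qpoch q q (K - mu 0) / qpoch q q (K - mu 0 - j) * c_coeff q (?c k) mu * wgt (pcons K (?c k)) (pcons K mu) = wgt ?nu k"
      using g1[unfolded g2] unfolding l_def .
  qed
  moreover have "0 \<le> (\<Sum>k\<in>{k\<in>?S. k 0 \<noteq> K}. wgt ?nu k)"
    using nu by (intro sum_nonneg wgt_nonneg) (auto simp: subparts_def)
  moreover have "(\<Sum>k\<in>{k\<in>?S. k 0 \<noteq> K}. wgt ?nu k) \<le> tail (M - plength mu)"
  proof -
    have "finite {k. k \<in> subparts ?nu \<and> k 0 \<noteq> ?nu 0}" using finite_subparts[OF nu] by simp
    then have "(\<Sum>k\<in>{k\<in>?S. k 0 \<noteq> K}. wgt ?nu k) \<le> (\<Sum>k | k \<in> subparts ?nu \<and> k 0 \<noteq> ?nu 0. wgt ?nu k)"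
      using nu nu0 by (intro sum_mono2) (auto simp: subparts_def intro: wgt_nonneg)
    moreover have "(1 - q) * \<dots> \<le> (1 - q) * tail (M - plength mu)"
      using wgt_tail[OF nu _ sm, of "M - plength mu"] box_compl_init[OF mu M, of K] nu0 q1
      by (simp add: tail_def)
    ultimately show ?thesis using q1 by simp
  qed
  ultimately show "box_sum mu M j K \<le> wgt (row (K - mu 0)) (row ?a)"
    "wgt (row (K - mu 0)) (row ?a) \<le> box_sum mu M j K + tail (M - plength mu)"
    unfolding row by simp_all
qed

lemma box_sum_tendsto:
  assumes "is_partition mu"
  shows "box_sum mu M j \<longlonglongrightarrow> lim row_stay * part_sum mu M j"
proof -
  have "(\<lambda>K. box_sum mu M j K) \<longlonglongrightarrow> (\<Sum>l\<in>ext_parts mu M j. 1 * c_coeff q l mu * (lim row_stay * wgt l mu))"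
    unfolding box_sum_def
    by (intro tendsto_sum tendsto_mult tendsto_const qpoch_ratio_tendsto[OF q0 q1] wgt_pcons_tendsto assms)
       (simp add: ext_parts_def)
  then show ?thesis by (simp add: part_sum_def sum_distrib_left mult.left_commute)
qed

definition row_move :: "nat \<Rightarrow> nat \<Rightarrow> real" where "row_move j n = wgt (row n) (row (n - j))"

text \<open>For empty \<open>mu\<close>, \<open>box_sum\<close> converges for each \<open>M\<close>
  and approximates \<open>row_move j\<close> within \<open>tail M\<close>, uniformly in large
  \<open>K\<close>.\<close>

lemma row_move_tendsto: "row_move j \<longlonglongrightarrow> lim (row_move j)"
proof -
  have "convergent (row_move j)"
  proof (rule convergent_uniform_approx)
    fix e :: real assume "0 < e"
    then have "\<forall>\<^sub>F M in sequentially. tail M < e" by (rule order_tendstoD[OF tail_tendsto])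
    then obtain M where M: "tail M \<le> e" unfolding eventually_sequentially by (meson less_imp_le order_refl)
    have "\<forall>\<^sub>F K in sequentially. \<bar>row_move j K - box_sum empty_partition M j K\<bar> \<le> e"
      using eventually_ge_at_top[of j]
    proof eventually_elim
      case (elim K)
      have "plength empty_partition = 0" by (simp add: plength_def empty_partition_def)
      then show ?case
        using row_bounds[of empty_partition M j K] elim M by (simp add: row_move_def)
    qed
    then show "\<exists>Y L. Y \<longlonglongrightarrow> L \<and> (\<forall>\<^sub>F K in sequentially. \<bar>row_move j K - Y K\<bar> \<le> e)"
      using box_sum_tendsto[of empty_partition M j] by auto
  qed
  then show ?thesis by (simp add: convergent_LIMSEQ_iff)
qed

text \<open>With \<open>K\<close> also \<open>K - mu 0\<close> tends to infinity, so the limit of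
  the single row does not see \<open>mu\<close>.\<close>

lemma row_move_bounds:
  assumes mu: "is_partition mu" and M: "plength mu \<le> M"
  shows "lim row_stay * part_sum mu M j \<le> lim (row_move j)"
    and "lim (row_move j) \<le> lim row_stay * part_sum mu M j + tail (M - plength mu)"
proof -
  have R: "(\<lambda>K. row_move j (K - mu 0)) \<longlonglongrightarrow> lim (row_move j)"
    by (rule LIMSEQ_offset[of _ "mu 0"]) (simp add: row_move_tendsto)
  have ev: "\<forall>\<^sub>F K in sequentially. mu 0 + j \<le> K" by (rule eventually_ge_at_top)
  have e1: "\<forall>\<^sub>F K in sequentially. box_sum mu M j K \<le> row_move j (K - mu 0)"
    using ev by eventually_elim (use row_bounds(1)[OF mu M] in \<open>simp add: row_move_def\<close>)
  show "lim row_stay * part_sum mu M j \<le> lim (row_move j)"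
    by (rule tendsto_le[OF sequentially_bot R box_sum_tendsto[OF mu] e1])
  have e2: "\<forall>\<^sub>F K in sequentially. row_move j (K - mu 0) \<le> box_sum mu M j K + tail (M - plength mu)"
    using ev by eventually_elim (use row_bounds(2)[OF mu M] in \<open>simp add: row_move_def\<close>)
  show "lim (row_move j) \<le> lim row_stay * part_sum mu M j + tail (M - plength mu)"
    by (rule tendsto_le[OF sequentially_bot tendsto_add[OF box_sum_tendsto[OF mu] tendsto_const] R e2])
qed

lemma row_move_nonneg: "0 \<le> row_move j n"
  unfolding row_move_def by (intro wgt_nonneg) simp_all

lemma sum_row_move: "J \<le> Suc n \<Longrightarrow> (\<Sum>j<J. row_move j n) \<le> 1"
proof -
  assume J: "J \<le> Suc n"
  have "(\<Sum>j<J. row_move j n) \<le> (\<Sum>j<Suc n. row_move j n)"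
    using J by (intro sum_mono2) (auto intro: row_move_nonneg)
  also have "\<dots> = (\<Sum>m\<le>n. wgt (row n) (row m))"
    unfolding row_move_def by (rule sum.reindex_bij_witness[of _ "\<lambda>m. n - m" "\<lambda>j. n - j"]) auto
  also have "\<dots> = (\<Sum>k\<in>subparts (row n). wgt (row n) k)"
    unfolding subparts_row by (subst sum.reindex) (auto simp: inj_on_def)
  also have "\<dots> = 1" by (rule sum_wgt) simp
  finally show ?thesis .
qed

text \<open>A single box either stays or is removed, with total weight 1.\<close>

lemma row_stay_1: "row_stay 1 = 1 - \<phi> (FF q (column_partition 1))"
proof -
  have "(\<Sum>k\<in>subparts (row 1). wgt (row 1) k) = 1" by (rule sum_wgt) simp
  moreover have "(\<Sum>k\<in>subparts (row 1). wgt (row 1) k) = wgt (row 1) (row 0) + wgt (row 1) (row 1)"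
    unfolding subparts_row by (subst sum.reindex) (auto simp: inj_on_def atMost_Suc)
  ultimately show ?thesis by (simp add: row_stay_def wgt_def column_Suc)
qed

text \<open>If the limit were 0, every \<open>lim (row_move j)\<close> would vanish. Then
  \<open>row_stay 1\<close>, the limit of the averages of \<open>q^j\<close> over the removed boxes
  \<open>j\<close>, would be at most \<open>q^J\<close> for every \<open>J\<close>, although it is
  positive by \<open>small\<close>.\<close>

lemma row_stay_lim_pos: "0 < lim row_stay"
proof (rule ccontr)
  assume neg: "\<not> 0 < lim row_stay"
  have "(\<lambda>K. wgt (row K) (row K)) \<longlonglongrightarrow> lim row_stay"
    using wgt_pcons_tendsto[of empty_partition empty_partition] by (simp add: wgt_empty)
  then have "0 \<le> lim row_stay"
    by (rule LIMSEQ_le_const) (auto intro!: wgt_nonneg)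
  with neg have p0: "lim row_stay = 0" by simp
  have len: "plength empty_partition = 0" by (simp add: plength_def empty_partition_def)
  have zero: "lim (row_move j) = 0" for j
  proof (rule antisym)
    have "lim (row_move j) \<le> tail M" for M
      using row_move_bounds(2)[of empty_partition M j] by (simp add: p0 len)
    then show "lim (row_move j) \<le> 0" by (intro LIMSEQ_le_const[OF tail_tendsto]) auto
    show "0 \<le> lim (row_move j)"
      by (rule LIMSEQ_le_const[OF row_move_tendsto]) (auto intro: row_move_nonneg)
  qed
  have bound: "row_stay 1 \<le> q ^ J" for J
  proof -
    have S: "(\<lambda>K. \<Sum>m\<in>{0..K}. q ^ (K - m) * wgt (row K) (row m)) \<longlonglongrightarrow> row_stay 1"
      using wgt_moment_tendsto[of empty_partition empty_partition 1] by (simp add: wgt_empty)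
    have T: "(\<lambda>K. (\<Sum>j<J. q ^ j * row_move j K) + q ^ J) \<longlonglongrightarrow> (\<Sum>j<J. q ^ j * 0) + q ^ J"
      using row_move_tendsto by (intro tendsto_intros) (simp add: zero)
    have "\<forall>\<^sub>F K in sequentially. (\<Sum>m\<in>{0..K}. q ^ (K - m) * wgt (row K) (row m)) \<le> (\<Sum>j<J. q ^ j * row_move j K) + q ^ J"
      using eventually_ge_at_top[of J]
    proof eventually_elim
      case (elim K)
      have "(\<Sum>m\<in>{0..K}. q ^ (K - m) * wgt (row K) (row m)) = (\<Sum>j<Suc K. q ^ j * row_move j K)"
        unfolding row_move_def by (rule sum.reindex_bij_witness[of _ "\<lambda>j. K - j" "\<lambda>m. K - m"]) auto
      also have "\<dots> = (\<Sum>j\<in>{..<J} \<union> {J..<Suc K}. q ^ j * row_move j K)"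
        using elim by (intro sum.cong) auto
      also have "\<dots> = (\<Sum>j<J. q ^ j * row_move j K) + (\<Sum>j\<in>{J..<Suc K}. q ^ j * row_move j K)"
        by (rule sum.union_disjoint) auto
      also have "(\<Sum>j\<in>{J..<Suc K}. q ^ j * row_move j K) \<le> (\<Sum>j\<in>{J..<Suc K}. q ^ J * row_move j K)"
        using q0 q1 by (intro sum_mono mult_right_mono power_decreasing row_move_nonneg) auto
      also have "\<dots> = q ^ J * (\<Sum>j\<in>{J..<Suc K}. row_move j K)" by (rule sum_distrib_left[symmetric])
      also have "\<dots> \<le> q ^ J * 1"
      proof (intro mult_left_mono)
        have "(\<Sum>j\<in>{J..<Suc K}. row_move j K) \<le> (\<Sum>j<Suc K. row_move j K)"
          by (intro sum_mono2) (auto intro: row_move_nonneg)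
        also have "\<dots> \<le> 1" by (rule sum_row_move) simp
        finally show "(\<Sum>j\<in>{J..<Suc K}. row_move j K) \<le> 1" .
      qed (use q0 in simp)
      finally show ?case by simp
    qed
    from tendsto_le[OF _ T S this] show ?thesis by simp
  qed
  have "(\<lambda>J. q ^ J) \<longlonglongrightarrow> 0" using q0 q1 by (simp add: LIMSEQ_realpow_zero)
  then have "row_stay 1 \<le> 0" by (rule LIMSEQ_le_const) (use bound in auto)
  then show False using row_stay_1 small by simp
qed

section \<open>Summation over all levels\<close>

definition level_sum :: "nat \<Rightarrow> real" where "level_sum j = lim (row_move j) / lim row_stay"

lemma level_sum_nonneg: "0 \<le> level_sum j"
  unfolding level_sum_def
  by (intro divide_nonneg_pos row_stay_lim_pos LIMSEQ_le_const[OF row_move_tendsto]) (auto intro: row_move_nonneg)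

text \<open>The distinct moves of a row of length \<open>n\<close> have total probability 1; for
  fixed \<open>J\<close> the bound for the first \<open>J\<close> of them passes to the limit in
  \<open>n\<close>.\<close>

lemma sum_level_sum_le: "(\<Sum>j<J. level_sum j) \<le> 1 / lim row_stay"
proof -
  have "(\<lambda>n. \<Sum>j<J. row_move j n) \<longlonglongrightarrow> (\<Sum>j<J. lim (row_move j))"
    by (intro tendsto_intros row_move_tendsto)
  then have "(\<Sum>j<J. lim (row_move j)) \<le> 1"
    by (rule LIMSEQ_le_const2) (auto intro!: exI[of _ J] sum_row_move)
  then show ?thesis
    unfolding level_sum_def sum_divide_distrib[symmetric] using row_stay_lim_pos by (intro divide_right_mono) simp_all
qed

lemma summable_level_sum: "summable level_sum"
  by (intro summableI_nonneg_bounded[of _ "1 / lim row_stay"] level_sum_nonneg sum_level_sum_le)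

lemma part_sum_le:
  assumes "is_partition mu" "plength mu \<le> M"
  shows "part_sum mu M j \<le> level_sum j"
  using row_move_bounds(1)[OF assms, of j] row_stay_lim_pos by (simp add: level_sum_def field_simps)

text \<open>The limit does not depend on \<open>mu\<close>, which is why one normalization serves
  every \<open>mu\<close>.\<close>

lemma part_sum_tendsto:
  assumes mu: "is_partition mu"
  shows "(\<lambda>M. part_sum mu (M + plength mu) j) \<longlonglongrightarrow> level_sum j"
proof (rule tendsto_sandwich[OF _ _ _ tendsto_const])
  have "level_sum j - tail M / lim row_stay \<le> part_sum mu (M + plength mu) j" for M
  proof -
    have "lim (row_move j) / lim row_stay \<le> (lim row_stay * part_sum mu (M + plength mu) j + tail M) / lim row_stay"
      using row_move_bounds(2)[OF mu, of "M + plength mu" j] row_stay_lim_pos by (intro divide_right_mono) simp_all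
    then show ?thesis using row_stay_lim_pos by (simp add: level_sum_def add_divide_distrib)
  qed
  then show "\<forall>\<^sub>F M in sequentially. level_sum j - tail M / lim row_stay \<le> part_sum mu (M + plength mu) j" by simp
  have "(\<lambda>M. level_sum j - tail M / lim row_stay) \<longlonglongrightarrow> level_sum j - 0 / lim row_stay"
    using row_stay_lim_pos by (intro tendsto_intros tail_tendsto) simp
  then show "(\<lambda>M. level_sum j - tail M / lim row_stay) \<longlonglongrightarrow> level_sum j" by simp
  show "\<forall>\<^sub>F M in sequentially. part_sum mu (M + plength mu) j \<le> level_sum j"
    using part_sum_le[OF mu] by simp
qed

lemma summand_nonneg: "is_partition l \<Longrightarrow> is_partition mu \<Longrightarrow> 0 \<le> c_coeff q l mu * wgt l mu"
  by (intro mult_nonneg_nonneg c_coeff_nonneg[OF q0 q1] wgt_nonneg)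

lemma sum_part_sum:
  "(\<Sum>l\<in>(\<Union>j<J. ext_parts mu M j). c_coeff q l mu * wgt l mu) = (\<Sum>j<J. part_sum mu M j)"
  unfolding part_sum_def
  by (rule sum.UNION_disjoint) (auto simp: finite_ext_parts, auto simp: ext_parts_def)

text \<open>A finite set of partitions lies in finitely many levels with bounded length, which gives
  the upper bound. For the lower bound, first the number \<open>J\<close> of levels and then the
  bound on the rows is chosen, each at a cost below \<open>e / 2\<close>.\<close>

lemma has_sum_summand:
  assumes mu: "is_partition mu"
  shows "((\<lambda>l. c_coeff q l mu * wgt l mu) has_sum suminf level_sum) {l. is_partition l \<and> partition_le mu l}"
proof (rule has_sum_nonneg_approx)
  fix l assume "l \<in> {l. is_partition l \<and> partition_le mu l}"
  then show "0 \<le> c_coeff q l mu * wgt l mu" using mu by (intro summand_nonneg) auto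
next
  fix F assume F: "finite F" "F \<subseteq> {l. is_partition l \<and> partition_le mu l}"
  define J where "J = Suc (Max (insert 0 ((\<lambda>l. l 0) ` F)))"
  define M where "M = Max (insert (plength mu) (plength ` F))"
  have "F \<subseteq> (\<Union>j<J. ext_parts mu M j)"
  proof
    fix l assume l: "l \<in> F"
    then have p: "is_partition l" "partition_le mu l" using F by auto
    have "l 0 < J" using F(1) l by (auto simp: J_def less_Suc_eq_le)
    moreover have "plength l \<le> M" using F(1) l by (auto simp: M_def)
    then have "l M = 0" using partition_eq_0_iff[OF p(1)] by simp
    moreover have "mu 0 \<le> l 0" using p(2) by (simp add: partition_le_def)
    ultimately show "l \<in> (\<Union>j<J. ext_parts mu M j)"
      using p by (auto simp: ext_parts_def intro!: bexI[of _ "l 0 - mu 0"])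
  qed
  moreover have "0 \<le> c_coeff q l mu * wgt l mu" if "l \<in> (\<Union>j<J. ext_parts mu M j)" for l
    using that mu by (auto simp: ext_parts_def intro!: summand_nonneg)
  ultimately have "(\<Sum>l\<in>F. c_coeff q l mu * wgt l mu) \<le> (\<Sum>l\<in>(\<Union>j<J. ext_parts mu M j). c_coeff q l mu * wgt l mu)"
    by (intro sum_mono2) (simp_all add: finite_ext_parts)
  also have "\<dots> \<le> (\<Sum>j<J. level_sum j)"
    unfolding sum_part_sum using F(1) by (intro sum_mono part_sum_le mu) (simp add: M_def)
  also have "\<dots> \<le> suminf level_sum"
    using summable_level_sum level_sum_nonneg by (intro sum_le_suminf) auto
  finally show "(\<Sum>l\<in>F. c_coeff q l mu * wgt l mu) \<le> suminf level_sum" .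
next
  fix e :: real assume e: "0 < e"
  have "(\<lambda>J. \<Sum>j<J. level_sum j) \<longlonglongrightarrow> suminf level_sum" using summable_level_sum by (rule summable_LIMSEQ)
  then have "\<forall>\<^sub>F J in sequentially. suminf level_sum - e / 2 < (\<Sum>j<J. level_sum j)"
    by (rule order_tendstoD(1)) (use e in linarith)
  then obtain J where J: "suminf level_sum - e / 2 < (\<Sum>j<J. level_sum j)"
    unfolding eventually_sequentially by blast
  have "(\<lambda>M. \<Sum>j<J. part_sum mu (M + plength mu) j) \<longlonglongrightarrow> (\<Sum>j<J. level_sum j)"
    by (intro tendsto_intros part_sum_tendsto mu)
  then have "\<forall>\<^sub>F M in sequentially. (\<Sum>j<J. level_sum j) - e / 2 < (\<Sum>j<J. part_sum mu (M + plength mu) j)"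
    by (rule order_tendstoD(1)) (use e in linarith)
  then obtain M where M: "(\<Sum>j<J. level_sum j) - e / 2 < (\<Sum>j<J. part_sum mu (M + plength mu) j)"
    unfolding eventually_sequentially by blast
  show "\<exists>F. finite F \<and> F \<subseteq> {l. is_partition l \<and> partition_le mu l} \<and>
      suminf level_sum - e \<le> (\<Sum>l\<in>F. c_coeff q l mu * wgt l mu)"
    using J M sum_part_sum[of mu "M + plength mu" J]
    by (intro exI[of _ "\<Union>j<J. ext_parts mu (M + plength mu) j"]) (auto simp: finite_ext_parts, auto simp: ext_parts_def)
qed

text \<open>Level 0 above the empty partition contains just that partition, with weight 1.\<close>

lemma suminf_level_sum_pos: "0 < suminf level_sum"
proof -
  have len: "plength empty_partition = 0" by (simp add: plength_def empty_partition_def)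
  have "l = empty_partition" if "is_partition l" "l 0 = 0" for l
    using partition_antimono[OF that(1), of 0] that(2) by (simp add: fun_eq_iff empty_partition_apply)
  then have "ext_parts empty_partition 0 0 = {empty_partition}"
    by (auto simp: ext_parts_def) (simp add: partition_le_def)
  moreover have "c_coeff q empty_partition empty_partition = 1"
    by (simp add: c_coeff_def conj_mult_prod_eq[of _ 0] gap_prod_def)
  ultimately have "part_sum empty_partition 0 0 = 1" by (simp add: part_sum_def wgt_empty)
  then have "1 \<le> level_sum 0" using part_sum_le[of empty_partition 0 0] by (simp add: len)
  also have "level_sum 0 \<le> suminf level_sum"
    using sum_le_suminf[OF summable_level_sum, of "{0}"] level_sum_nonneg by simp
  finally show ?thesis by simp
qed

lemma exists_normalization:
  "\<exists>Z>0. \<forall>mu. is_partition mu \<longrightarrow>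
    prob_distribution_on {l. is_partition l \<and> partition_le mu l}
      (\<lambda>l. c_coeff q l mu * \<phi> (F_skew q l mu) / Z)"
proof (intro exI[of _ "suminf level_sum"] conjI suminf_level_sum_pos allI impI)
  fix mu assume mu: "is_partition mu"
  have "((\<lambda>l. c_coeff q l mu * wgt l mu / suminf level_sum) has_sum 1) {l. is_partition l \<and> partition_le mu l}"
    using has_sum_divide_const[OF has_sum_summand[OF mu], of "suminf level_sum"] suminf_level_sum_pos by simp
  then show "prob_distribution_on {l. is_partition l \<and> partition_le mu l}
      (\<lambda>l. c_coeff q l mu * \<phi> (F_skew q l mu) / suminf level_sum)"
    using summand_nonneg[OF _ mu] suminf_level_sum_pos
    by (auto simp: prob_distribution_on_def wgt_def intro!: divide_nonneg_pos)
qed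

end


theorem theorem5p1:
  fixes q :: real and \<phi> :: "pseries \<Rightarrow> real"
  assumes "0 < q" and "q < 1"
    and "specialization q \<phi>"
    and "F_positive q \<phi>"
    and "\<phi> (FF q (column_partition 1)) < 1"
    and "summable (\<lambda>n. \<phi> (FF q (column_partition n)))"
  shows "\<exists>Z>0. \<forall>mu. is_partition mu \<longrightarrow>
    prob_distribution_on {l. is_partition l \<and> partition_le mu l}
      (\<lambda>l. c_coeff q l mu * \<phi> (F_skew q l mu) / Z)"
proof -
  interpret summable_specialization q \<phi> by unfold_locales (fact assms)+
  show ?thesis by (rule exists_normalization)
qed

end
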